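(* If a subvariety $\mathcal{V}$ of $\mathsf{SRL}$ is axiomatized (relative to $\mathsf{SRL}$) by a knotted identity, a weak commutativity identity and any additional (possibly empty) set of equations over $\{\vee,\cdot,1\}$, then $\mathcal{V}$ has the finite embeddability property.
   Context: A residuated lattice is an algebra $(R,\wedge,\vee,\cdot,\backslash,/,1)$ such that $(R,\wedge,\vee)$ is a lattice, $(R,\cdot,1)$ is a monoid, and $xy\le z \iff y\le x\backslash z \iff x\le z/y$ for all $x,y,z$. A residuated lattice is unilinear if it satisfies $\forall u_1,u_2,z,w\,(u_1\le u_2 \text{ or } u_2\le u_1 \text{ or } (u_1\wedge u_2\le w \text{ and } z\le u_1\vee u_2))$. $\mathsf{SRL}$ is the variety generated by all unilinear residuated lattices. A knotted identity is one of the form $x^m\le x^n$ with $m\neq n$ natural numbers. A weak commutativity identity is one of the form $$xy_1xy_2\cdots y_nx=x^{a_0}y_1x^{a_1}y_2\cdots y_nx^{a_n},$$ where $n\in\mathbb{Z}^+$ and $(a_0,a_1,\dots,a_n)$ is a tuple of natural numbers with $a_0+a_1+\dots+a_n=n+1$, not all $a_i$ equal to $1$ (for example $xyx=xxy$). An equation over $\{\vee,\cdot,1\}$ is an equation between terms built from variables using only $\vee,\cdot,1$. A class $\mathcal{K}$ has the finite embeddability property if for every $\mathbf{A}\in\mathcal{K}$ and finite subset $B$ of $A$ there is a finite algebra $\mathbf{C}\in\mathcal{K}$ such that the partial subalgebra of $\mathbf{A}$ induced by $B$ (operations of $\mathbf{A}$ defined on tuples of $B$ exactly when the value lies in $B$)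 embeds in $\mathbf{C}$, via an injective map that preserves all defined operations. *)

theory Defs
  imports "HOL-Algebra.Group" "HOL-Library.Countable_Set" "HOL-Library.Countable"
begin

text \<open>Residuated lattices. The monoid part is the one of HOL-Algebra.\<close>

record 'a rl = "'a monoid" +
  wedge :: "'a \<Rightarrow> 'a \<Rightarrow> 'a"  (infixl \<open>\<^bold>\<and>\<index>\<close> 65)
  vee :: "'a \<Rightarrow> 'a \<Rightarrow> 'a"  (infixl \<open>\<^bold>\<or>\<index>\<close> 65)
  under :: "'a \<Rightarrow> 'a \<Rightarrow> 'a"  \<comment> \<open>\<open>under R x z\<close> is the left residual, x under z\<close>
  over :: "'a \<Rightarrow> 'a \<Rightarrow> 'a"   \<comment> \<open>\<open>over R z y\<close> is the right residual, z over y\<close>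

definition rl_le :: "('a, 'b) rl_scheme \<Rightarrow> 'a \<Rightarrow> 'a \<Rightarrow> bool"  (infix \<open>\<preceq>\<index>\<close> 50)
  where "x \<preceq>\<^bsub>R\<^esub> y \<longleftrightarrow> x \<^bold>\<and>\<^bsub>R\<^esub> y = x"

locale residuated_lattice = monoid R for R (structure) +
  assumes wedge_closed: "\<lbrakk>x \<in> carrier R; y \<in> carrier R\<rbrakk> \<Longrightarrow> x \<^bold>\<and> y \<in> carrier R"
    and vee_closed: "\<lbrakk>x \<in> carrier R; y \<in> carrier R\<rbrakk> \<Longrightarrow> x \<^bold>\<or> y \<in> carrier R"
    and under_closed: "\<lbrakk>x \<in> carrier R; y \<in> carrier R\<rbrakk> \<Longrightarrow> under R x y \<in> carrier R"
    and over_closed: "\<lbrakk>x \<in> carrier R; y \<in> carrier R\<rbrakk> \<Longrightarrow> over R x y \<in> carrier R"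
    and wedge_comm: "\<lbrakk>x \<in> carrier R; y \<in> carrier R\<rbrakk> \<Longrightarrow> x \<^bold>\<and> y = y \<^bold>\<and> x"
    and vee_comm: "\<lbrakk>x \<in> carrier R; y \<in> carrier R\<rbrakk> \<Longrightarrow> x \<^bold>\<or> y = y \<^bold>\<or> x"
    and wedge_assoc: "\<lbrakk>x \<in> carrier R; y \<in> carrier R; z \<in> carrier R\<rbrakk>
      \<Longrightarrow> (x \<^bold>\<and> y) \<^bold>\<and> z = x \<^bold>\<and> (y \<^bold>\<and> z)"
    and vee_assoc: "\<lbrakk>x \<in> carrier R; y \<in> carrier R; z \<in> carrier R\<rbrakk>
      \<Longrightarrow> (x \<^bold>\<or> y) \<^bold>\<or> z = x \<^bold>\<or> (y \<^bold>\<or> z)"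
    and wedge_absorb: "\<lbrakk>x \<in> carrier R; y \<in> carrier R\<rbrakk> \<Longrightarrow> x \<^bold>\<and> (x \<^bold>\<or> y) = x"
    and vee_absorb: "\<lbrakk>x \<in> carrier R; y \<in> carrier R\<rbrakk> \<Longrightarrow> x \<^bold>\<or> (x \<^bold>\<and> y) = x"
    and residual_under: "\<lbrakk>x \<in> carrier R; y \<in> carrier R; z \<in> carrier R\<rbrakk>
      \<Longrightarrow> x \<otimes> y \<preceq> z \<longleftrightarrow> y \<preceq> under R x z"
    and residual_over: "\<lbrakk>x \<in> carrier R; y \<in> carrier R; z \<in> carrier R\<rbrakk>
      \<Longrightarrow> x \<otimes> y \<preceq> z \<longleftrightarrow> x \<preceq> over R z y"

definition unilinear :: "('a, 'b) rl_scheme \<Rightarrow> bool" where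
  "unilinear R \<longleftrightarrow>
    (\<forall>u\<^sub>1\<in>carrier R. \<forall>u\<^sub>2\<in>carrier R. \<forall>z\<in>carrier R. \<forall>w\<in>carrier R.
      u\<^sub>1 \<preceq>\<^bsub>R\<^esub> u\<^sub>2 \<or> u\<^sub>2 \<preceq>\<^bsub>R\<^esub> u\<^sub>1 \<or> (u\<^sub>1 \<^bold>\<and>\<^bsub>R\<^esub> u\<^sub>2 \<preceq>\<^bsub>R\<^esub> w \<and> z \<preceq>\<^bsub>R\<^esub> u\<^sub>1 \<^bold>\<or>\<^bsub>R\<^esub> u\<^sub>2))"


text \<open>Terms over countably many variables, and equations between them.\<close>

datatype trm =
    Var nat
  | One
  | Mult trm trm
  | Meet trm trm
  | Join trm trm
  | Under trm trm
  | Over trm trm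

type_synonym equation = "trm \<times> trm"

primrec eval :: "('a, 'b) rl_scheme \<Rightarrow> (nat \<Rightarrow> 'a) \<Rightarrow> trm \<Rightarrow> 'a" where
  "eval R v (Var i) = v i"
| "eval R v One = \<one>\<^bsub>R\<^esub>"
| "eval R v (Mult s t) = eval R v s \<otimes>\<^bsub>R\<^esub> eval R v t"
| "eval R v (Meet s t) = eval R v s \<^bold>\<and>\<^bsub>R\<^esub> eval R v t"
| "eval R v (Join s t) = eval R v s \<^bold>\<or>\<^bsub>R\<^esub> eval R v t"
| "eval R v (Under s t) = under R (eval R v s) (eval R v t)"
| "eval R v (Over s t) = over R (eval R v s) (eval R v t)"

definition models :: "equation set \<Rightarrow> 'a rl set" where
  "models E = {R. \<forall>(s, t)\<in>E. \<forall>v. range v \<subseteq> carrier R \<longrightarrow> eval R v s = eval R v t}"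


text \<open>
  \<open>SRL\<close> is the least equational class of residuated lattices that contains the unilinear ones.
  A definition in HOL cannot quantify over types, so the generating algebras are those with carrier
  in \<^typ>\<open>nat\<close>. Nothing is lost: lemma \<open>unilinear_in_SRL\<close> below shows that \<open>SRL\<close> contains
  every unilinear residuated lattice, over every type.
\<close>

definition SRL :: "'a rl set" where
  "SRL = {R. residuated_lattice R \<and>
    (\<forall>E. {U :: nat rl. residuated_lattice U \<and> unilinear U} \<subseteq> models E \<longrightarrow> R \<in> models E)}"


fun trm_prod :: "trm list \<Rightarrow> trm" where
  "trm_prod [] = One"
| "trm_prod [t] = t"
| "trm_prod (t # u # ts) = Mult t (trm_prod (u # ts))"

definition trm_pow :: "trm \<Rightarrow> nat \<Rightarrow> trm" where
  "trm_pow t k = trm_prod (replicate k t)"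

text \<open>An inequality \<open>s \<le> t\<close> between terms is the equation \<open>s \<or> t = t\<close>.\<close>

definition trm_le :: "trm \<Rightarrow> trm \<Rightarrow> equation" where
  "trm_le s t = (Join s t, t)"

definition knotted_identities :: "equation set" where
  "knotted_identities = {trm_le (trm_pow (Var 0) m) (trm_pow (Var 0) n) | m n. m \<noteq> n}"

text \<open>With \<open>x = Var 0\<close> and \<open>y\<^sub>i = Var i\<close>, \<open>interleaved n a\<close> is
  \<open>x^(a 0) y\<^sub>1 x^(a 1) y\<^sub>2 \<dots> y\<^sub>n x^(a n)\<close>.\<close>

definition interleaved :: "nat \<Rightarrow> (nat \<Rightarrow> nat) \<Rightarrow> trm" where
  "interleaved n a = trm_prod (trm_pow (Var 0) (a 0) #
     concat (map (\<lambda>i. [Var i, trm_pow (Var 0) (a i)]) [1..<Suc n]))"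

definition weak_commutativity_identities :: "equation set" where
  "weak_commutativity_identities =
    {(interleaved n (\<lambda>_. 1), interleaved n a) | n a.
      n \<ge> 1 \<and> (\<Sum>i\<le>n. a i) = n + 1 \<and> (\<exists>i\<le>n. a i \<noteq> 1)}"

inductive_set join_mult_one_terms :: "trm set" where
  "Var i \<in> join_mult_one_terms"
| "One \<in> join_mult_one_terms"
| "\<lbrakk>s \<in> join_mult_one_terms; t \<in> join_mult_one_terms\<rbrakk> \<Longrightarrow> Mult s t \<in> join_mult_one_terms"
| "\<lbrakk>s \<in> join_mult_one_terms; t \<in> join_mult_one_terms\<rbrakk> \<Longrightarrow> Join s t \<in> join_mult_one_terms"


definition partial_embedding :: "'a rl \<Rightarrow> 'a set \<Rightarrow> 'b rl \<Rightarrow> ('a \<Rightarrow> 'b) \<Rightarrow> bool" where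
  "partial_embedding A B C f \<longleftrightarrow>
    f ` B \<subseteq> carrier C \<and> inj_on f B \<and>
    (\<one>\<^bsub>A\<^esub> \<in> B \<longrightarrow> f \<one>\<^bsub>A\<^esub> = \<one>\<^bsub>C\<^esub>) \<and>
    (\<forall>x\<in>B. \<forall>y\<in>B.
      (x \<otimes>\<^bsub>A\<^esub> y \<in> B \<longrightarrow> f (x \<otimes>\<^bsub>A\<^esub> y) = f x \<otimes>\<^bsub>C\<^esub> f y) \<and>
      (x \<^bold>\<and>\<^bsub>A\<^esub> y \<in> B \<longrightarrow> f (x \<^bold>\<and>\<^bsub>A\<^esub> y) = f x \<^bold>\<and>\<^bsub>C\<^esub> f y) \<and>
      (x \<^bold>\<or>\<^bsub>A\<^esub> y \<in> B \<longrightarrow> f (x \<^bold>\<or>\<^bsub>A\<^esub> y) = f x \<^bold>\<or>\<^bsub>C\<^esub> f y) \<and>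
      (under A x y \<in> B \<longrightarrow> f (under A x y) = under C (f x) (f y)) \<and>
      (over A x y \<in> B \<longrightarrow> f (over A x y) = over C (f x) (f y)))"

text \<open>
  A class of algebras that spans all types is passed twice: \<open>K\<close> is its part over an arbitrary
  type, \<open>L\<close> its part over \<^typ>\<open>nat\<close>, where every finite algebra has an isomorphic copy.
\<close>

definition finite_embeddability_property :: "'a rl set \<Rightarrow> nat rl set \<Rightarrow> bool" where
  "finite_embeddability_property K L \<longleftrightarrow>
    (\<forall>A\<in>K. \<forall>B. B \<subseteq> carrier A \<and> finite B \<longrightarrow>
      (\<exists>C\<in>L. finite (carrier C) \<and> (\<exists>f. partial_embedding A B C f)))"


instance trm :: countable
  by countable_datatype

lemma unilinear_in_SRL:
  fixes U :: "'a rl"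
  assumes U: "residuated_lattice U" and lin: "unilinear U"
  shows "U \<in> SRL"
proof -
  interpret residuated_lattice U by (rule U)
  have "U \<in> models E"
    if E: "{N :: nat rl. residuated_lattice N \<and> unilinear N} \<subseteq> models E" for E
  proof -
    have "eval U v s = eval U v t" if st: "(s, t) \<in> E" and v: "range v \<subseteq> carrier U" for s t v
    proof -
      \<comment> \<open>a copy over \<^typ>\<open>nat\<close> of the subalgebra generated by the values of \<open>v\<close>\<close>
      define S where "S = range (eval U v)"
      define g where "g = to_nat_on S"
      define h where "h = inv_into S g"
      have inj: "inj_on g S"
        unfolding g_def S_def by (intro inj_on_to_nat_on countable_image) simp
      have hg [simp]: "h (g x) = x" if "x \<in> S" for x
        using inj that by (simp add: h_def)
      have gi [simp]: "g x = g y \<longleftrightarrow> x = y" if "x \<in> S" "y \<in> S" for x y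
        using inj that by (auto dest: inj_onD)
      have evc: "eval U v r \<in> carrier U" for r
        using v by (induction r) (auto intro: wedge_closed vee_closed under_closed over_closed)
      then have sub: "x \<in> carrier U" if "x \<in> S" for x
        using that by (auto simp: S_def)
      have evS [simp]: "eval U v r \<in> S" for r
        by (simp add: S_def)
      have closed [simp]: "\<one>\<^bsub>U\<^esub> \<in> S" "x \<otimes>\<^bsub>U\<^esub> y \<in> S" "x \<^bold>\<and>\<^bsub>U\<^esub> y \<in> S"
        "x \<^bold>\<or>\<^bsub>U\<^esub> y \<in> S" "under U x y \<in> S" "over U x y \<in> S"
        if xy: "x \<in> S" "y \<in> S" for x y
      proof -
        obtain p q where "x = eval U v p" "y = eval U v q"
          using xy by (auto simp: S_def)
        then show "\<one>\<^bsub>U\<^esub> \<in> S" "x \<otimes>\<^bsub>U\<^esub> y \<in> S" "x \<^bold>\<and>\<^bsub>U\<^esub> y \<in> S"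
          "x \<^bold>\<or>\<^bsub>U\<^esub> y \<in> S" "under U x y \<in> S" "over U x y \<in> S"
          unfolding S_def by (metis eval.simps rangeI)+
      qed
      have one [simp]: "\<one>\<^bsub>U\<^esub> \<in> S"
        using closed(1) evS by blast
      define N :: "nat rl" where
        "N = \<lparr>carrier = g ` S, monoid.mult = (\<lambda>x y. g (h x \<otimes>\<^bsub>U\<^esub> h y)), one = g \<one>\<^bsub>U\<^esub>,
          wedge = (\<lambda>x y. g (h x \<^bold>\<and>\<^bsub>U\<^esub> h y)), vee = (\<lambda>x y. g (h x \<^bold>\<or>\<^bsub>U\<^esub> h y)),
          under = (\<lambda>x y. g (under U (h x) (h y))), over = (\<lambda>x y. g (over U (h x) (h y)))\<rparr>"
      have le [simp]: "g x \<preceq>\<^bsub>N\<^esub> g y \<longleftrightarrow> x \<preceq>\<^bsub>U\<^esub> y" if "x \<in> S" "y \<in> S" for x y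
        using that by (simp add: rl_le_def N_def)
      have N [simp]: "carrier N = g ` S" "\<one>\<^bsub>N\<^esub> = g \<one>\<^bsub>U\<^esub>"
        "\<And>x y. x \<otimes>\<^bsub>N\<^esub> y = g (h x \<otimes>\<^bsub>U\<^esub> h y)"
        "\<And>x y. x \<^bold>\<and>\<^bsub>N\<^esub> y = g (h x \<^bold>\<and>\<^bsub>U\<^esub> h y)"
        "\<And>x y. x \<^bold>\<or>\<^bsub>N\<^esub> y = g (h x \<^bold>\<or>\<^bsub>U\<^esub> h y)"
        "\<And>x y. under N x y = g (under U (h x) (h y))"
        "\<And>x y. over N x y = g (over U (h x) (h y))"
        by (simp_all add: N_def)
      have "residuated_lattice N"
        by unfold_locales
          (auto simp: sub m_assoc wedge_assoc vee_assoc wedge_absorb vee_absorb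
             residual_under residual_over[symmetric]
             intro: wedge_comm[OF sub sub] vee_comm[OF sub sub])
      moreover have "unilinear N"
        using lin unfolding unilinear_def by simp (meson sub)
      ultimately have "N \<in> models E"
        using E by blast
      moreover have "range (g \<circ> v) \<subseteq> carrier N"
        using evS[of "Var _"] by auto
      ultimately have "eval N (g \<circ> v) s = eval N (g \<circ> v) t"
        using st by (auto simp: models_def)
      moreover have "eval N (g \<circ> v) r = g (eval U v r)" for r
        by (induction r) auto
      ultimately show ?thesis
        by simp
    qed
    then show ?thesis
      by (auto simp: models_def)
  qed
  then show ?thesis
    using U by (simp add: SRL_def)
qed

end

theory Submission
  imports Defs
begin

text \<open>
  Let \<open>A\<close> be in the variety and \<open>B\<close> a finite set of its elements. The finite algebra is built from sets
  of elements of \<open>A\<close>, multiplied elementwise and then closed. Such an algebra inherits every equation over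
  join, multiplication and unit (\<open>galois_algebra_satisfies\<close>): a monomial of one side, evaluated at closed
  sets, consists of products of elements of \<open>A\<close>, and the equation of \<open>A\<close>, read at finite joins of these
  elements, bounds each of the products. Knotted and weak commutativity identities have this form too. So
  it remains to make the algebra finite, to get it into \<open>SRL\<close>, and to keep the elements of \<open>B\<close> apart.

  Suppose first that \<open>A\<close> is unilinear, and let \<open>W\<close> be the submonoid generated by \<open>B\<close>. The closed sets
  are the intersections of the cuts \<open>{x \<in> W. u x v \<le> b}\<close> with \<open>u\<close>, \<open>v\<close> in \<open>W\<close> and \<open>b\<close> in \<open>B\<close>. They form a
  residuated lattice into which \<open>b \<mapsto> {x \<in> W. x \<le> b}\<close> embeds \<open>B\<close> (\<open>partial_hom_principal\<close>). It is again
  unilinear (\<open>unilinear_galois_algebra\<close>), because a cut is the trace on \<open>W\<close> of a principal down-set of \<open>A\<close>.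
  It is finite because there are finitely many cuts (\<open>finite_cuts\<close>). Indeed, weak commutativity moves
  powers of one generator onto each other, so that every element of \<open>W\<close> is a product of boundedly many
  powers of generators (\<open>few_blocks\<close>). Then \<open>u x v \<le> b\<close> is a condition on vectors of exponents, and by the
  knotted identity it is preserved in one direction when a large exponent is raised by a fixed amount.
  Such a condition is eventually periodic in every coordinate, with a uniform threshold
  (\<open>step_closed_threshold\<close>), which leaves finitely many cuts.

  A general \<open>A\<close> in \<open>SRL\<close> is a subdirect product of unilinear algebras. This is proved here without
  congruence distributivity or ultraproducts: a deductive filter that is maximal among those that omit
  \<open>a\<close> under \<open>b\<close> yields a unilinear quotient that separates \<open>a\<close> and \<open>b\<close> (\<open>SRL_prime_filter\<close>). The reason is
  that unilinearity, a disjunction, becomes an equation of \<open>SRL\<close> once the disjuncts are turned into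
  iterated conjugates and joined, and maximal filters split such joins. The quotient itself is never
  formed; the construction above works for any preorder on \<open>A\<close> that is compatible with the operations,
  and \<open>residuated_preorder\<close> collects what it uses. Finally, a product over the finitely many pairs
  \<open>a\<close>, \<open>b\<close> of elements of \<open>B\<close> with \<open>\<not> a \<le> b\<close> separates all of \<open>B\<close>.
\<close>

section \<open>Residuation and compatible preorders\<close>

context residuated_lattice
begin

lemma wedge_idem: "x \<in> carrier R \<Longrightarrow> x \<^bold>\<and> x = x"
  by (metis vee_absorb wedge_absorb wedge_closed)

lemma le_refl [simp]: "x \<in> carrier R \<Longrightarrow> x \<preceq> x"
  by (simp add: rl_le_def wedge_idem)

lemma le_antisym: "\<lbrakk>x \<preceq> y; y \<preceq> x; x \<in> carrier R; y \<in> carrier R\<rbrakk> \<Longrightarrow> x = y"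
  by (metis rl_le_def wedge_comm)

lemma le_trans: "\<lbrakk>x \<preceq> y; y \<preceq> z; x \<in> carrier R; y \<in> carrier R; z \<in> carrier R\<rbrakk> \<Longrightarrow> x \<preceq> z"
  by (metis rl_le_def wedge_assoc)

lemma wedge_le1: "\<lbrakk>x \<in> carrier R; y \<in> carrier R\<rbrakk> \<Longrightarrow> x \<^bold>\<and> y \<preceq> x"
  by (metis rl_le_def wedge_assoc wedge_comm wedge_idem)

lemma wedge_le2: "\<lbrakk>x \<in> carrier R; y \<in> carrier R\<rbrakk> \<Longrightarrow> x \<^bold>\<and> y \<preceq> y"
  by (metis wedge_comm wedge_le1)

lemma wedge_greatest:
  "\<lbrakk>z \<preceq> x; z \<preceq> y; x \<in> carrier R; y \<in> carrier R; z \<in> carrier R\<rbrakk> \<Longrightarrow> z \<preceq> x \<^bold>\<and> y"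
  by (metis rl_le_def wedge_assoc)

lemma le_iff_vee: "\<lbrakk>x \<in> carrier R; y \<in> carrier R\<rbrakk> \<Longrightarrow> x \<preceq> y \<longleftrightarrow> x \<^bold>\<or> y = y"
  by (metis rl_le_def vee_absorb vee_comm wedge_absorb wedge_comm)

lemma vee_ge1: "\<lbrakk>x \<in> carrier R; y \<in> carrier R\<rbrakk> \<Longrightarrow> x \<preceq> x \<^bold>\<or> y"
  by (simp add: rl_le_def wedge_absorb)

lemma vee_ge2: "\<lbrakk>x \<in> carrier R; y \<in> carrier R\<rbrakk> \<Longrightarrow> y \<preceq> x \<^bold>\<or> y"
  by (metis vee_comm vee_ge1)

lemma vee_least:
  "\<lbrakk>x \<preceq> z; y \<preceq> z; x \<in> carrier R; y \<in> carrier R; z \<in> carrier R\<rbrakk> \<Longrightarrow> x \<^bold>\<or> y \<preceq> z"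
  by (metis le_iff_vee vee_assoc vee_closed)

lemmas closed = m_closed one_closed wedge_closed vee_closed under_closed over_closed

lemma eval_closed: "range v \<subseteq> carrier R \<Longrightarrow> eval R v t \<in> carrier R"
  by (induction t) (auto intro: closed)

end

text \<open>
  A preorder that plays the role of the order of a quotient of \<open>R\<close>: the residuation laws make it
  compatible with multiplication, and \<open>join_least\<close> and \<open>meet_greatest\<close> say that joins and meets of \<open>R\<close>
  become those of the quotient.
\<close>

locale residuated_preorder = residuated_lattice R for R (structure) +
  fixes le :: "'a \<Rightarrow> 'a \<Rightarrow> bool"  (infix \<open>\<unlhd>\<close> 50)
  assumes le_of_order: "\<lbrakk>x \<preceq> y; x \<in> carrier R; y \<in> carrier R\<rbrakk> \<Longrightarrow> x \<unlhd> y"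
    and trans: "\<lbrakk>x \<unlhd> y; y \<unlhd> z; x \<in> carrier R; y \<in> carrier R; z \<in> carrier R\<rbrakk> \<Longrightarrow> x \<unlhd> z"
    and join_least: "\<lbrakk>x \<unlhd> z; y \<unlhd> z; x \<in> carrier R; y \<in> carrier R; z \<in> carrier R\<rbrakk> \<Longrightarrow> x \<^bold>\<or> y \<unlhd> z"
    and meet_greatest: "\<lbrakk>z \<unlhd> x; z \<unlhd> y; x \<in> carrier R; y \<in> carrier R; z \<in> carrier R\<rbrakk> \<Longrightarrow> z \<unlhd> x \<^bold>\<and> y"
    and under_iff: "\<lbrakk>x \<in> carrier R; y \<in> carrier R; z \<in> carrier R\<rbrakk>
      \<Longrightarrow> x \<otimes> y \<unlhd> z \<longleftrightarrow> y \<unlhd> under R x z"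
    and over_iff: "\<lbrakk>x \<in> carrier R; y \<in> carrier R; z \<in> carrier R\<rbrakk>
      \<Longrightarrow> x \<otimes> y \<unlhd> z \<longleftrightarrow> x \<unlhd> over R z y"
begin

lemma refl [simp]: "x \<in> carrier R \<Longrightarrow> x \<unlhd> x"
  by (simp add: le_of_order)

lemma mult_mono:
  assumes "x \<unlhd> x'" "y \<unlhd> y'" "x \<in> carrier R" "y \<in> carrier R" "x' \<in> carrier R" "y' \<in> carrier R"
  shows "x \<otimes> y \<unlhd> x' \<otimes> y'"
proof -
  have "x \<unlhd> over R (x' \<otimes> y) y"
    using assms over_iff[of x' y "x' \<otimes> y"] trans[of x x'] by (simp add: closed)
  then have "x \<otimes> y \<unlhd> x' \<otimes> y"
    using assms by (simp add: over_iff)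
  moreover have "y \<unlhd> under R x' (x' \<otimes> y')"
    using assms under_iff[of x' y' "x' \<otimes> y'"] trans[of y y'] by (simp add: closed)
  then have "x' \<otimes> y \<unlhd> x' \<otimes> y'"
    using assms by (simp add: under_iff)
  ultimately show ?thesis
    using assms trans by (meson m_closed)
qed

lemma under_cancel: "\<lbrakk>x \<in> carrier R; z \<in> carrier R\<rbrakk> \<Longrightarrow> x \<otimes> under R x z \<unlhd> z"
  by (simp add: under_iff closed)

lemma over_cancel: "\<lbrakk>x \<in> carrier R; z \<in> carrier R\<rbrakk> \<Longrightarrow> over R z x \<otimes> x \<unlhd> z"
  by (simp add: over_iff closed)

lemma join_le_iff:
  "\<lbrakk>x \<in> carrier R; y \<in> carrier R; z \<in> carrier R\<rbrakk> \<Longrightarrow> x \<^bold>\<or> y \<unlhd> z \<longleftrightarrow> x \<unlhd> z \<and> y \<unlhd> z"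
  by (meson join_least le_of_order trans vee_closed vee_ge1 vee_ge2)

lemma le_meet_iff:
  "\<lbrakk>x \<in> carrier R; y \<in> carrier R; z \<in> carrier R\<rbrakk> \<Longrightarrow> z \<unlhd> x \<^bold>\<and> y \<longleftrightarrow> z \<unlhd> x \<and> z \<unlhd> y"
  by (meson meet_greatest le_of_order trans wedge_closed wedge_le1 wedge_le2)

end

context residuated_lattice
begin

sublocale order: residuated_preorder R "rl_le R"
  by unfold_locales
    (fact le_trans vee_least wedge_greatest residual_under residual_over | assumption)+

end

definition lprod :: "('a, 'b) monoid_scheme \<Rightarrow> 'a list \<Rightarrow> 'a" where
  "lprod G xs = foldr (mult G) xs \<one>\<^bsub>G\<^esub>"

lemma lprod_simps [simp]:
  "lprod G [] = \<one>\<^bsub>G\<^esub>"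
  "lprod G (x # xs) = x \<otimes>\<^bsub>G\<^esub> lprod G xs"
  by (simp_all add: lprod_def)

lemma (in monoid) lprod_closed [simp]: "set xs \<subseteq> carrier G \<Longrightarrow> lprod G xs \<in> carrier G"
  by (induction xs) auto

lemma (in monoid) lprod_append:
  "\<lbrakk>set xs \<subseteq> carrier G; set ys \<subseteq> carrier G\<rbrakk> \<Longrightarrow> lprod G (xs @ ys) = lprod G xs \<otimes> lprod G ys"
  by (induction xs) (auto simp: m_assoc)

text \<open>
  Multiplication distributes over joins, so a term over join, multiplication and unit is the join of
  its monomials, written as lists of variables. The value on the other terms is arbitrary.
\<close>

fun monomials :: "trm \<Rightarrow> nat list set" where
  "monomials (Var i) = {[i]}"
| "monomials One = {[]}"
| "monomials (Mult s t) = (\<lambda>(p, q). p @ q) ` (monomials s \<times> monomials t)"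
| "monomials (Join s t) = monomials s \<union> monomials t"
| "monomials _ = {}"

lemma finite_monomials: "finite (monomials t)"
  by (induction t) auto

text \<open>
  Upper bounds suffice to describe the join of the monomials, and residuation reduces a bound on a
  product to a bound on each factor. For the order of \<open>R\<close> this determines the value of the term; for a
  preorder it does so in the quotient.
\<close>

lemma (in residuated_preorder) eval_le_iff_monomials:
  assumes "t \<in> join_mult_one_terms" "range v \<subseteq> carrier R" "c \<in> carrier R"
  shows "eval R v t \<unlhd> c \<longleftrightarrow> (\<forall>m\<in>monomials t. lprod R (map v m) \<unlhd> c)"
  using assms(1,3)
proof (induction t arbitrary: c rule: join_mult_one_terms.induct)
  case (3 s t)
  have v: "set (map v m) \<subseteq> carrier R" for m
    using assms(2) by auto
  then have [simp]: "lprod R (map v m) \<in> carrier R" for m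
    by (rule lprod_closed)
  have [simp]: "eval R v r \<in> carrier R" for r
    using assms(2) by (rule eval_closed)
  have "eval R v (Mult s t) \<unlhd> c \<longleftrightarrow> eval R v s \<unlhd> over R c (eval R v t)"
    using 3 by (simp add: over_iff)
  also have "\<dots> \<longleftrightarrow> (\<forall>p\<in>monomials s. lprod R (map v p) \<otimes> eval R v t \<unlhd> c)"
    using 3 by (simp add: over_iff over_closed)
  also have "\<dots> \<longleftrightarrow> (\<forall>p\<in>monomials s. \<forall>q\<in>monomials t. lprod R (map v p) \<otimes> lprod R (map v q) \<unlhd> c)"
    using 3 by (simp add: under_iff under_closed)
  finally show ?case
    using v by (auto simp: lprod_append)
next
  case (4 s t)
  have [simp]: "eval R v r \<in> carrier R" for r
    using assms(2) by (rule eval_closed)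
  show ?case
    using 4 by (auto simp: join_le_iff)
qed (use assms(2) in \<open>auto simp: range_subsetD\<close>)

section \<open>Deductive filters and iterated conjugates\<close>

locale unilinear_preorder = residuated_preorder +
  assumes unilin: "\<lbrakk>x \<in> carrier R; y \<in> carrier R; z \<in> carrier R; w \<in> carrier R\<rbrakk>
    \<Longrightarrow> x \<unlhd> y \<or> y \<unlhd> x \<or> (x \<^bold>\<and> y \<unlhd> w \<and> z \<unlhd> x \<^bold>\<or> y)"

text \<open>
  Conjugates are the maps under which the filters that correspond to congruences must be closed; they
  replace conjugation in a group. The first component of the pair selects between left and right.
  Meeting with the unit keeps the values in the negative cone.
\<close>

definition conjugate :: "('a, 'b) rl_scheme \<Rightarrow> bool \<times> 'a \<Rightarrow> 'a \<Rightarrow> 'a" where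
  "conjugate R p x =
    (if fst p then under R (snd p) (x \<otimes>\<^bsub>R\<^esub> snd p) else over R (snd p \<otimes>\<^bsub>R\<^esub> x) (snd p)) \<^bold>\<and>\<^bsub>R\<^esub> \<one>\<^bsub>R\<^esub>"

primrec iterated_conjugate :: "('a, 'b) rl_scheme \<Rightarrow> (bool \<times> 'a) list \<Rightarrow> 'a \<Rightarrow> 'a" where
  "iterated_conjugate R [] x = x \<^bold>\<and>\<^bsub>R\<^esub> \<one>\<^bsub>R\<^esub>"
| "iterated_conjugate R (p # ps) x = conjugate R p (iterated_conjugate R ps x)"

context residuated_lattice
begin

lemma vee_mono1:
  "\<lbrakk>x \<preceq> y; x \<in> carrier R; y \<in> carrier R; t \<in> carrier R\<rbrakk> \<Longrightarrow> x \<^bold>\<or> t \<preceq> y \<^bold>\<or> t"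
  by (meson le_trans vee_closed vee_ge1 vee_ge2 vee_least)

lemma conjugate_closed:
  "\<lbrakk>snd p \<in> carrier R; x \<in> carrier R\<rbrakk> \<Longrightarrow> conjugate R p x \<in> carrier R"
  by (simp add: conjugate_def closed)

lemma conjugate_mono:
  assumes "x \<preceq> y" "snd p \<in> carrier R" "x \<in> carrier R" "y \<in> carrier R"
  shows "conjugate R p x \<preceq> conjugate R p y"
proof -
  have "x \<otimes> snd p \<preceq> y \<otimes> snd p" "snd p \<otimes> x \<preceq> snd p \<otimes> y"
    using assms by (simp_all add: order.mult_mono)
  then have "under R (snd p) (x \<otimes> snd p) \<preceq> under R (snd p) (y \<otimes> snd p)"
     "over R (snd p \<otimes> x) (snd p) \<preceq> over R (snd p \<otimes> y) (snd p)"
    using assms order.under_cancel[of "snd p" "x \<otimes> snd p"] order.over_cancel[of "snd p" "snd p \<otimes> x"]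
    by (simp_all flip: residual_under residual_over add: closed)
      (meson closed le_trans)+
  then show ?thesis
    using assms unfolding conjugate_def
    by (auto intro!: wedge_greatest wedge_le2 intro: le_trans[OF wedge_le1] simp: closed)
qed

lemma conjugate_mult:
  assumes [simp]: "snd p \<in> carrier R" "x \<in> carrier R" "y \<in> carrier R"
  shows "conjugate R p x \<otimes> conjugate R p y \<preceq> conjugate R p (x \<otimes> y)"
proof -
  define a where "a = snd p"
  have [simp]: "a \<in> carrier R"
    by (simp add: a_def)
  have le: "conjugate R p z \<preceq> (if fst p then under R a (z \<otimes> a) else over R (a \<otimes> z) a)"
    if "z \<in> carrier R" for z
    using that by (simp add: conjugate_def a_def wedge_le1 closed)
  have [simp]: "conjugate R p z \<in> carrier R" if "z \<in> carrier R" for z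
    using that by (simp add: conjugate_closed)
  have one: "conjugate R p x \<otimes> conjugate R p y \<preceq> \<one> \<otimes> \<one>"
    by (intro order.mult_mono) (simp_all add: conjugate_def wedge_le2 closed)
  have "conjugate R p x \<otimes> conjugate R p y \<preceq>
    (if fst p then under R a ((x \<otimes> y) \<otimes> a) else over R (a \<otimes> (x \<otimes> y)) a)"
  proof (cases "fst p")
    case True
    have le: "a \<otimes> conjugate R p z \<preceq> z \<otimes> a" if "z \<in> carrier R" for z
      using le[OF that] that True by (simp add: residual_under closed)
    have "a \<otimes> (conjugate R p x \<otimes> conjugate R p y) \<preceq> (x \<otimes> a) \<otimes> conjugate R p y"
      using le[of x] by (simp flip: m_assoc add: order.mult_mono)
    also have "(x \<otimes> a) \<otimes> conjugate R p y = x \<otimes> (a \<otimes> conjugate R p y)"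
      by (simp add: m_assoc)
    finally have 1: "a \<otimes> (conjugate R p x \<otimes> conjugate R p y) \<preceq> x \<otimes> (a \<otimes> conjugate R p y)" .
    have "x \<otimes> (a \<otimes> conjugate R p y) \<preceq> (x \<otimes> y) \<otimes> a"
      using le[of y] by (simp add: m_assoc order.mult_mono)
    then have "a \<otimes> (conjugate R p x \<otimes> conjugate R p y) \<preceq> (x \<otimes> y) \<otimes> a"
      using 1 by (auto intro: le_trans)
    then show ?thesis
      using True by (simp add: residual_under closed)
  next
    case False
    have le: "conjugate R p z \<otimes> a \<preceq> a \<otimes> z" if "z \<in> carrier R" for z
      using le[OF that] that False by (simp add: residual_over closed)
    have "(conjugate R p x \<otimes> conjugate R p y) \<otimes> a \<preceq> conjugate R p x \<otimes> (a \<otimes> y)"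
      using le[of y] by (simp add: m_assoc order.mult_mono)
    also have "conjugate R p x \<otimes> (a \<otimes> y) = (conjugate R p x \<otimes> a) \<otimes> y"
      by (simp add: m_assoc)
    finally have 1: "(conjugate R p x \<otimes> conjugate R p y) \<otimes> a \<preceq> (conjugate R p x \<otimes> a) \<otimes> y" .
    have "(conjugate R p x \<otimes> a) \<otimes> y \<preceq> a \<otimes> (x \<otimes> y)"
      using le[of x] by (simp flip: m_assoc add: order.mult_mono)
    then have "(conjugate R p x \<otimes> conjugate R p y) \<otimes> a \<preceq> a \<otimes> (x \<otimes> y)"
      using 1 by (auto intro: le_trans)
    then show ?thesis
      using False by (simp add: residual_over closed)
  qed
  then show ?thesis
    using one unfolding conjugate_def[of R p "x \<otimes> y"] a_def
    by (auto intro!: wedge_greatest simp: closed)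
qed

lemma iterated_conjugate_closed:
  "\<lbrakk>snd ` set ps \<subseteq> carrier R; x \<in> carrier R\<rbrakk> \<Longrightarrow> iterated_conjugate R ps x \<in> carrier R"
  by (induction ps) (auto simp: closed conjugate_closed)

lemma iterated_conjugate_le_one:
  "\<lbrakk>snd ` set ps \<subseteq> carrier R; x \<in> carrier R\<rbrakk> \<Longrightarrow> iterated_conjugate R ps x \<preceq> \<one>"
  by (cases ps) (auto simp: wedge_le2 closed conjugate_def iterated_conjugate_closed)

lemma iterated_conjugate_mono:
  "\<lbrakk>x \<preceq> y; snd ` set ps \<subseteq> carrier R; x \<in> carrier R; y \<in> carrier R\<rbrakk>
    \<Longrightarrow> iterated_conjugate R ps x \<preceq> iterated_conjugate R ps y"
proof (induction ps)
  case Nil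
  then show ?case
    by (auto intro!: wedge_greatest wedge_le2 intro: le_trans[OF wedge_le1] simp: closed)
qed (auto intro!: conjugate_mono simp: iterated_conjugate_closed)

lemma iterated_conjugate_mult:
  assumes "snd ` set ps \<subseteq> carrier R" and [simp]: "x \<in> carrier R" "y \<in> carrier R"
  shows "iterated_conjugate R ps x \<otimes> iterated_conjugate R ps y \<preceq> iterated_conjugate R ps (x \<otimes> y)"
  using assms(1)
proof (induction ps)
  case Nil
  have "(x \<^bold>\<and> \<one>) \<otimes> (y \<^bold>\<and> \<one>) \<preceq> x \<otimes> y" "(x \<^bold>\<and> \<one>) \<otimes> (y \<^bold>\<and> \<one>) \<preceq> \<one> \<otimes> \<one>"
    by (intro order.mult_mono; simp add: closed wedge_le1 wedge_le2)+
  then show ?case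
    by (auto intro!: wedge_greatest simp: closed)
next
  case (Cons p ps)
  then have [simp]: "snd p \<in> carrier R"
    "z \<in> carrier R \<Longrightarrow> iterated_conjugate R ps z \<in> carrier R" for z
    by (auto simp: iterated_conjugate_closed)
  have 1: "conjugate R p (iterated_conjugate R ps x \<otimes> iterated_conjugate R ps y)
    \<preceq> conjugate R p (iterated_conjugate R ps (x \<otimes> y))"
    using Cons by (intro conjugate_mono) auto
  have "conjugate R p (iterated_conjugate R ps x) \<otimes> conjugate R p (iterated_conjugate R ps y)
    \<preceq> conjugate R p (iterated_conjugate R ps x \<otimes> iterated_conjugate R ps y)"
    by (rule conjugate_mult) simp_all
  from le_trans[OF this 1] show ?case
    by (simp add: conjugate_closed)
qed

text \<open>
  A conjugation of the argument can be absorbed into the list of conjugating elements, up to an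
  inequality that is due to the meet with the unit at the start of the iteration.
\<close>

lemma iterated_conjugate_snoc:
  assumes "snd ` set ps \<subseteq> carrier R" "snd p \<in> carrier R" and [simp]: "x \<in> carrier R"
  shows "iterated_conjugate R (ps @ [p]) x \<preceq> iterated_conjugate R ps (conjugate R p x)"
  using assms(1)
proof (induction ps)
  case Nil
  have "conjugate R p (x \<^bold>\<and> \<one>) \<preceq> conjugate R p x"
    using assms(2) by (intro conjugate_mono) (simp_all add: wedge_le1 closed)
  moreover have "conjugate R p (x \<^bold>\<and> \<one>) \<preceq> \<one>"
    using assms(2) by (simp add: conjugate_def wedge_le2 closed)
  ultimately show ?case
    using assms(2) by (auto intro!: wedge_greatest conjugate_closed simp: closed)
next
  case (Cons q ps)
  then show ?case
    using assms(2)
    by (simp, intro conjugate_mono iterated_conjugate_closed conjugate_closed)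
      (simp_all add: image_subset_iff)
qed

end

text \<open>
  The up-sets generated by the congruence classes of the unit: \<open>x\<close> is below \<open>y\<close> in the quotient if and only
  if the residual \<open>x\<close> under \<open>y\<close> lies in the filter.
\<close>

locale deductive_filter = residuated_lattice R for R (structure) + fixes F :: "'a set"
  assumes subset: "F \<subseteq> carrier R"
    and one: "\<one> \<in> F"
    and up: "\<lbrakk>x \<in> F; x \<preceq> y; y \<in> carrier R\<rbrakk> \<Longrightarrow> y \<in> F"
    and mult: "\<lbrakk>x \<in> F; y \<in> F\<rbrakk> \<Longrightarrow> x \<otimes> y \<in> F"
    and conj: "\<lbrakk>x \<in> F; snd p \<in> carrier R\<rbrakk> \<Longrightarrow> conjugate R p x \<in> F"
begin

lemma in_carrier: "x \<in> F \<Longrightarrow> x \<in> carrier R"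
  using subset by blast

lemma meet_one: "x \<in> F \<Longrightarrow> x \<^bold>\<and> \<one> \<in> F"
proof -
  assume x: "x \<in> F"
  then have [simp]: "x \<in> carrier R"
    by (rule in_carrier)
  have "conjugate R (True, \<one>) x = under R \<one> x \<^bold>\<and> \<one>"
    by (simp add: conjugate_def)
  moreover have "under R \<one> x \<^bold>\<and> \<one> \<preceq> x \<^bold>\<and> \<one>"
  proof (intro wedge_greatest)
    have "\<one> \<otimes> under R \<one> x \<preceq> x"
      by (rule order.under_cancel) auto
    then show "under R \<one> x \<^bold>\<and> \<one> \<preceq> x"
      using le_trans[OF wedge_le1] by (simp add: closed)
  qed (auto simp: closed wedge_le2)
  ultimately show "x \<^bold>\<and> \<one> \<in> F"
    using conj[OF x, of "(True, \<one>)"] up by (auto simp: closed)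
qed

lemma iterated_conjugate_mem:
  "\<lbrakk>x \<in> F; snd ` set ps \<subseteq> carrier R\<rbrakk> \<Longrightarrow> iterated_conjugate R ps x \<in> F"
  by (induction ps) (auto intro: conj meet_one)

lemma meet:
  assumes x: "x \<in> F" and y: "y \<in> F" shows "x \<^bold>\<and> y \<in> F"
proof -
  have [simp]: "x \<in> carrier R" "y \<in> carrier R"
    using assms in_carrier by auto
  have "(x \<^bold>\<and> \<one>) \<otimes> (y \<^bold>\<and> \<one>) \<preceq> x \<otimes> \<one>" "(x \<^bold>\<and> \<one>) \<otimes> (y \<^bold>\<and> \<one>) \<preceq> \<one> \<otimes> y"
    by (intro order.mult_mono; simp add: closed wedge_le1 wedge_le2)+
  then have "(x \<^bold>\<and> \<one>) \<otimes> (y \<^bold>\<and> \<one>) \<preceq> x \<^bold>\<and> y"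
    by (auto intro!: wedge_greatest simp: closed)
  then show ?thesis
    using mult[OF meet_one[OF x] meet_one[OF y]] up by (auto simp: closed)
qed

text \<open>
  This is where conjugation enters: \<open>y\<close> over \<open>x\<close> lies above a conjugate by \<open>x\<close> of \<open>x\<close> under \<open>y\<close>, and vice
  versa, so that left and right residuals define the same preorder.
\<close>

lemma under_mem_iff_over_mem:
  assumes [simp]: "x \<in> carrier R" "y \<in> carrier R"
  shows "under R x y \<in> F \<longleftrightarrow> over R y x \<in> F"
proof
  assume *: "under R x y \<in> F"
  have "over R (x \<otimes> under R x y) x \<otimes> x \<preceq> x \<otimes> under R x y" "x \<otimes> under R x y \<preceq> y"
    by (auto intro!: order.over_cancel order.under_cancel simp: closed)
  then have "over R (x \<otimes> under R x y) x \<preceq> over R y x"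
    by (auto simp flip: residual_over simp: closed intro: le_trans)
  then have "conjugate R (False, x) (under R x y) \<preceq> over R y x"
    by (auto simp: conjugate_def closed intro: le_trans[OF wedge_le1])
  then show "over R y x \<in> F"
    using conj[OF *, of "(False, x)"] up by (auto simp: closed)
next
  assume *: "over R y x \<in> F"
  have "x \<otimes> under R x (over R y x \<otimes> x) \<preceq> over R y x \<otimes> x" "over R y x \<otimes> x \<preceq> y"
    by (auto intro!: order.over_cancel order.under_cancel simp: closed)
  then have "under R x (over R y x \<otimes> x) \<preceq> under R x y"
    by (auto simp flip: residual_under simp: closed intro: le_trans)
  then have "conjugate R (True, x) (over R y x) \<preceq> under R x y"
    by (auto simp: conjugate_def closed intro: le_trans[OF wedge_le1])
  then show "under R x y \<in> F"
    using conj[OF *, of "(True, x)"] up by (auto simp: closed)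
qed

lemma residuated_preorder: "residuated_preorder R (\<lambda>x y. under R x y \<in> F)"
proof
  fix x y assume xy: "x \<preceq> y" and [simp]: "x \<in> carrier R" "y \<in> carrier R"
  then have "\<one> \<preceq> under R x y"
    by (simp flip: residual_under)
  then show "under R x y \<in> F"
    using one up by (auto simp: closed)
next
  fix x y z assume xy: "under R x y \<in> F" "under R y z \<in> F"
    and [simp]: "x \<in> carrier R" "y \<in> carrier R" "z \<in> carrier R"
  have "(x \<otimes> under R x y) \<otimes> under R y z \<preceq> y \<otimes> under R y z"
    by (auto intro!: order.mult_mono order.under_cancel simp: closed)
  then have "x \<otimes> (under R x y \<otimes> under R y z) \<preceq> z"
    using order.under_cancel[of y z] by (auto simp: closed m_assoc intro: le_trans)
  then have "under R x y \<otimes> under R y z \<preceq> under R x z"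
    by (simp add: residual_under closed)
  then show "under R x z \<in> F"
    using mult[OF xy] up by (auto simp: closed)
next
  fix x y z assume xy: "under R x z \<in> F" "under R y z \<in> F"
    and [simp]: "x \<in> carrier R" "y \<in> carrier R" "z \<in> carrier R"
  have "x \<otimes> (under R x z \<^bold>\<and> under R y z) \<preceq> z" "y \<otimes> (under R x z \<^bold>\<and> under R y z) \<preceq> z"
    by (simp_all add: residual_under closed wedge_le1 wedge_le2)
  then have "(x \<^bold>\<or> y) \<otimes> (under R x z \<^bold>\<and> under R y z) \<preceq> z"
    by (simp add: residual_over order.join_le_iff closed)
  then have "under R x z \<^bold>\<and> under R y z \<preceq> under R (x \<^bold>\<or> y) z"
    by (simp add: residual_under closed)
  then show "under R (x \<^bold>\<or> y) z \<in> F"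
    using meet[OF xy] up by (auto simp: closed)
next
  fix x y z assume xy: "under R z x \<in> F" "under R z y \<in> F"
    and [simp]: "x \<in> carrier R" "y \<in> carrier R" "z \<in> carrier R"
  have "z \<otimes> (under R z x \<^bold>\<and> under R z y) \<preceq> x \<^bold>\<and> y"
    by (simp add: order.le_meet_iff closed residual_under wedge_le1 wedge_le2)
  then have "under R z x \<^bold>\<and> under R z y \<preceq> under R z (x \<^bold>\<and> y)"
    by (simp add: residual_under closed)
  then show "under R z (x \<^bold>\<and> y) \<in> F"
    using meet[OF xy] up by (auto simp: closed)
next
  fix x y z assume [simp]: "x \<in> carrier R" "y \<in> carrier R" "z \<in> carrier R"
  have 1: "t \<preceq> under R (x \<otimes> y) z \<longleftrightarrow> t \<preceq> under R y (under R x z)" if "t \<in> carrier R" for t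
    using that by (simp add: m_assoc closed flip: residual_under)
  show "under R (x \<otimes> y) z \<in> F \<longleftrightarrow> under R y (under R x z) \<in> F"
    using 1[of "under R (x \<otimes> y) z"] 1[of "under R y (under R x z)"] up by (auto simp: closed)
  have 2: "t \<preceq> over R z (x \<otimes> y) \<longleftrightarrow> t \<preceq> over R (over R z y) x" if "t \<in> carrier R" for t
    using that by (simp add: m_assoc[symmetric] closed flip: residual_over)
  have "over R z (x \<otimes> y) \<in> F \<longleftrightarrow> over R (over R z y) x \<in> F"
    using 2[of "over R z (x \<otimes> y)"] 2[of "over R (over R z y) x"] up by (auto simp: closed)
  then show "under R (x \<otimes> y) z \<in> F \<longleftrightarrow> under R x (over R z y) \<in> F"
    by (simp add: under_mem_iff_over_mem closed)
qed

text \<open>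
  The set \<open>G\<close> of all elements whose iterated conjugates are, modulo the filter, orthogonal to \<open>T\<close>.
  Quantifying over all conjugates makes \<open>G\<close> closed under conjugation, and for negative elements
  \<open>(x \<or> t) (y \<or> t) \<le> x y \<or> t\<close> makes it closed under multiplication. It replaces an explicit description
  of the filter generated by a filter and one more element.
\<close>

lemma conjugate_polar:
  assumes T: "\<And>t. t \<in> T \<Longrightarrow> t \<in> carrier R \<and> t \<preceq> \<one>"
  defines "G \<equiv> {x \<in> carrier R. \<forall>ps. snd ` set ps \<subseteq> carrier R \<longrightarrow>
    (\<forall>t\<in>T. iterated_conjugate R ps x \<^bold>\<or> t \<in> F)}"
  shows "deductive_filter R G" and "F \<subseteq> G"
proof -
  show "F \<subseteq> G"
  proof
    fix x assume x: "x \<in> F"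
    have "iterated_conjugate R ps x \<^bold>\<or> t \<in> F" if "snd ` set ps \<subseteq> carrier R" "t \<in> T" for ps t
      using iterated_conjugate_mem[OF x that(1)] T[OF that(2)] up vee_ge1
      by (meson in_carrier vee_closed)
    then show "x \<in> G"
      using x in_carrier by (auto simp: G_def)
  qed
  then have "\<one> \<in> G"
    using one by blast
  show "deductive_filter R G"
  proof
    show "G \<subseteq> carrier R"
      by (auto simp: G_def)
    show "\<one> \<in> G" by fact
    show "y \<in> G" if "x \<in> G" "x \<preceq> y" and [simp]: "y \<in> carrier R" for x y
    proof -
      have [simp]: "x \<in> carrier R"
        using that by (simp add: G_def)
      have "iterated_conjugate R ps y \<^bold>\<or> t \<in> F" if ps: "snd ` set ps \<subseteq> carrier R" and t: "t \<in> T" for ps t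
      proof -
        have [simp]: "iterated_conjugate R ps x \<in> carrier R" "iterated_conjugate R ps y \<in> carrier R"
          "t \<in> carrier R"
          using ps t T by (auto simp: iterated_conjugate_closed)
        have "iterated_conjugate R ps x \<preceq> iterated_conjugate R ps y"
          using ps \<open>x \<preceq> y\<close> by (intro iterated_conjugate_mono) auto
        then have "iterated_conjugate R ps x \<^bold>\<or> t \<preceq> iterated_conjugate R ps y \<^bold>\<or> t"
          by (intro vee_mono1) auto
        moreover have "iterated_conjugate R ps x \<^bold>\<or> t \<in> F"
          using \<open>x \<in> G\<close> ps t by (auto simp: G_def)
        ultimately show ?thesis
          using up by (auto simp: closed)
      qed
      then show ?thesis
        by (simp add: G_def)
    qed
    show "x \<otimes> y \<in> G" if xy: "x \<in> G" "y \<in> G" for x y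
    proof -
      have [simp]: "x \<in> carrier R" "y \<in> carrier R"
        using xy by (simp_all add: G_def)
      have "iterated_conjugate R ps (x \<otimes> y) \<^bold>\<or> t \<in> F"
        if ps: "snd ` set ps \<subseteq> carrier R" and t: "t \<in> T" for ps t
      proof -
        define x' y' z' where "x' = iterated_conjugate R ps x" and "y' = iterated_conjugate R ps y"
          and "z' = iterated_conjugate R ps (x \<otimes> y)"
        have [simp]: "x' \<in> carrier R" "y' \<in> carrier R" "z' \<in> carrier R" "t \<in> carrier R"
          using ps t T by (auto simp: iterated_conjugate_closed x'_def y'_def z'_def)
        have "x' \<preceq> \<one>" "y' \<preceq> \<one>" "t \<preceq> \<one>"
          using ps t T by (auto simp: iterated_conjugate_le_one x'_def y'_def)
        have "x' \<otimes> y' \<preceq> z'"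
          unfolding x'_def y'_def z'_def using ps by (intro iterated_conjugate_mult) auto
        have "x' \<otimes> y' \<preceq> z' \<^bold>\<or> t"
          using \<open>x' \<otimes> y' \<preceq> z'\<close> by (rule le_trans) (simp_all add: vee_ge1 closed)
        moreover have "x' \<otimes> t \<preceq> z' \<^bold>\<or> t"
          using order.mult_mono[of x' \<one> t t] \<open>x' \<preceq> \<one>\<close> le_trans[of "x' \<otimes> t" t "z' \<^bold>\<or> t"]
          by (simp add: closed vee_ge2)
        moreover have "t \<otimes> (y' \<^bold>\<or> t) \<preceq> z' \<^bold>\<or> t"
          using order.mult_mono[of t t "y' \<^bold>\<or> t" \<one>] \<open>y' \<preceq> \<one>\<close> \<open>t \<preceq> \<one>\<close>
            le_trans[of "t \<otimes> (y' \<^bold>\<or> t)" t "z' \<^bold>\<or> t"]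
          by (simp add: closed order.join_le_iff vee_ge2)
        ultimately have "(x' \<^bold>\<or> t) \<otimes> (y' \<^bold>\<or> t) \<preceq> z' \<^bold>\<or> t"
          by (simp add: closed residual_over order.join_le_iff)
            (simp add: closed order.join_le_iff residual_under flip: residual_over)
        moreover have "(x' \<^bold>\<or> t) \<otimes> (y' \<^bold>\<or> t) \<in> F"
          using xy ps t by (intro mult) (auto simp: G_def x'_def y'_def)
        ultimately show ?thesis
          using up by (auto simp: closed simp flip: z'_def)
      qed
      then show ?thesis
        by (simp add: G_def)
    qed
    show "conjugate R p x \<in> G" if "x \<in> G" and p: "snd p \<in> carrier R" for x p
    proof -
      have [simp]: "x \<in> carrier R"
        using that by (simp add: G_def)
      have "iterated_conjugate R ps (conjugate R p x) \<^bold>\<or> t \<in> F"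
        if ps: "snd ` set ps \<subseteq> carrier R" and t: "t \<in> T" for ps t
      proof -
        have [simp]: "iterated_conjugate R (ps @ [p]) x \<in> carrier R"
           "iterated_conjugate R ps (conjugate R p x) \<in> carrier R" "t \<in> carrier R"
          using ps t T p by (simp_all add: iterated_conjugate_closed conjugate_closed)
        have "iterated_conjugate R (ps @ [p]) x \<preceq> iterated_conjugate R ps (conjugate R p x)"
          using ps p by (intro iterated_conjugate_snoc) auto
        then have "iterated_conjugate R (ps @ [p]) x \<^bold>\<or> t \<preceq> iterated_conjugate R ps (conjugate R p x) \<^bold>\<or> t"
          by (intro vee_mono1) auto
        moreover have "iterated_conjugate R (ps @ [p]) x \<^bold>\<or> t \<in> F"
          using \<open>x \<in> G\<close> ps t p by (auto simp: G_def)
        ultimately show ?thesis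
          using up by (auto simp: closed)
      qed
      then show ?thesis
        using p by (auto simp: G_def intro: conjugate_closed)
    qed
  qed
qed

end

section \<open>Unilinear quotients of an algebra in SRL\<close>

lemma (in residuated_lattice) positive_cone_filter: "deductive_filter R {x \<in> carrier R. \<one> \<preceq> x}"
proof
  show "x \<otimes> y \<in> {x \<in> carrier R. \<one> \<preceq> x}"
    if "x \<in> {x \<in> carrier R. \<one> \<preceq> x}" "y \<in> {x \<in> carrier R. \<one> \<preceq> x}" for x y
    using that order.mult_mono[of \<one> x \<one> y] by auto
  show "conjugate R p x \<in> {x \<in> carrier R. \<one> \<preceq> x}"
    if "x \<in> {x \<in> carrier R. \<one> \<preceq> x}" "snd p \<in> carrier R" for x p
  proof -
    have "snd p \<otimes> \<one> \<preceq> x \<otimes> snd p" "\<one> \<otimes> snd p \<preceq> snd p \<otimes> x"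
      using that order.mult_mono[of \<one> x "snd p" "snd p"] order.mult_mono[of "snd p" "snd p" \<one> x]
      by auto
    then have "\<one> \<preceq> conjugate R p x"
      using that unfolding conjugate_def
      by (intro wedge_greatest) (auto simp: closed simp flip: residual_under residual_over)
    then show ?thesis
      using that by (auto intro: conjugate_closed)
  qed
qed (auto intro: le_trans)

text \<open>
  The positive cone is a deductive filter, hence closed under iterated conjugates.
\<close>

lemma (in residuated_lattice) iterated_conjugate_eq_one:
  assumes "\<one> \<preceq> x" "x \<in> carrier R" "snd ` set ps \<subseteq> carrier R"
  shows "iterated_conjugate R ps x = \<one>"
proof -
  interpret P: deductive_filter R "{x \<in> carrier R. \<one> \<preceq> x}"
    by (rule positive_cone_filter)
  have "\<one> \<preceq> iterated_conjugate R ps x"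
    using P.iterated_conjugate_mem[of x ps] assms by auto
  then show ?thesis
    using assms by (intro le_antisym) (auto simp: iterated_conjugate_le_one iterated_conjugate_closed)
qed

text \<open>
  The disjunction that defines unilinearity, turned into an equation: each disjunct says that a certain
  residual is above the unit, in which case all of its conjugates are equal to the unit, while the other
  two joinands stay below it.
\<close>

lemma (in residuated_lattice) unilinear_imp_conjugate_prelinear:
  assumes "unilinear R"
    and [simp]: "x \<in> carrier R" "y \<in> carrier R" "z \<in> carrier R" "w \<in> carrier R"
    and ps: "snd ` set ps \<subseteq> carrier R" "snd ` set qs \<subseteq> carrier R" "snd ` set rs \<subseteq> carrier R"
  shows "iterated_conjugate R ps (under R x y) \<^bold>\<or> (iterated_conjugate R qs (under R y x) \<^bold>\<or>
    iterated_conjugate R rs (under R (x \<^bold>\<and> y) w \<^bold>\<and> under R z (x \<^bold>\<or> y))) = \<one>"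
    (is "?a \<^bold>\<or> (?b \<^bold>\<or> ?c) = \<one>")
proof -
  have [simp]: "?a \<in> carrier R" "?b \<in> carrier R" "?c \<in> carrier R"
    using ps by (auto simp: iterated_conjugate_closed closed)
  have le: "?a \<preceq> \<one>" "?b \<preceq> \<one>" "?c \<preceq> \<one>"
    using ps by (auto simp: iterated_conjugate_le_one closed)
  have one_le: "u \<preceq> v \<Longrightarrow> u \<in> carrier R \<Longrightarrow> v \<in> carrier R \<Longrightarrow> \<one> \<preceq> under R u v" for u v
    by (simp flip: residual_under)
  have "x \<preceq> y \<or> y \<preceq> x \<or> (x \<^bold>\<and> y \<preceq> w \<and> z \<preceq> x \<^bold>\<or> y)"

    using assms(1)[unfolded unilinear_def, rule_format, of x y z w] by simp
  then have "\<one> \<preceq> under R x y \<or> \<one> \<preceq> under R y x \<or> \<one> \<preceq> under R (x \<^bold>\<and> y) w \<^bold>\<and> under R z (x \<^bold>\<or> y)"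
    by (metis one_le wedge_greatest assms(2-5) closed)
  then have "?a = \<one> \<or> ?b = \<one> \<or> ?c = \<one>"
    using ps by (metis iterated_conjugate_eq_one assms(2-5) closed(3-6))
  moreover have j: "?a \<preceq> ?a \<^bold>\<or> (?b \<^bold>\<or> ?c)" "?b \<^bold>\<or> ?c \<preceq> ?a \<^bold>\<or> (?b \<^bold>\<or> ?c)"
    by (simp_all add: vee_ge1 vee_ge2 closed)
  moreover have "?b \<preceq> ?a \<^bold>\<or> (?b \<^bold>\<or> ?c)" "?c \<preceq> ?a \<^bold>\<or> (?b \<^bold>\<or> ?c)"
    by (rule le_trans[OF _ j(2)]; simp add: vee_ge1 vee_ge2 closed)+
  ultimately have "\<one> \<preceq> ?a \<^bold>\<or> (?b \<^bold>\<or> ?c)"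
    by metis
  then show ?thesis
    using le by (intro le_antisym) (simp_all add: order.join_le_iff closed)
qed

definition conjugate_trm :: "bool \<times> nat \<Rightarrow> trm \<Rightarrow> trm" where
  "conjugate_trm p t = Meet
    (if fst p then Under (Var (snd p)) (Mult t (Var (snd p))) else Over (Mult (Var (snd p)) t) (Var (snd p))) One"

definition iterated_conjugate_trm :: "(bool \<times> nat) list \<Rightarrow> trm \<Rightarrow> trm" where
  "iterated_conjugate_trm ps t = foldr conjugate_trm ps (Meet t One)"

lemma eval_iterated_conjugate_trm [simp]:
  "eval R v (iterated_conjugate_trm ps t) = iterated_conjugate R (map (map_prod id v) ps) (eval R v t)"
  by (induction ps) (auto simp: iterated_conjugate_trm_def conjugate_trm_def conjugate_def)

lemma SRL_satisfies:
  assumes "A \<in> SRL"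
    and "\<And>U :: nat rl. \<lbrakk>residuated_lattice U; unilinear U\<rbrakk> \<Longrightarrow> U \<in> models {(s, t)}"
    and "range v \<subseteq> carrier A"
  shows "eval A v s = eval A v t"
proof -
  have "A \<in> models {(s, t)}"
    using assms(1,2) by (auto simp: SRL_def)
  then show ?thesis
    using assms(3) by (auto simp: models_def)
qed

text \<open>
  The equation holds in the generating algebras and thus in \<open>SRL\<close>. Its three lists of conjugating
  elements are arbitrary, so that it is a scheme with one equation for each shape of the lists.
\<close>

lemma SRL_conjugate_prelinear:
  fixes A :: "'a rl" (structure)
  assumes A: "A \<in> SRL"
    and xyz: "x \<in> carrier A" "y \<in> carrier A" "z \<in> carrier A" "w \<in> carrier A"
    and ps: "snd ` set ps \<subseteq> carrier A" "snd ` set qs \<subseteq> carrier A" "snd ` set rs \<subseteq> carrier A"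
  shows "iterated_conjugate A ps (under A x y) \<^bold>\<or> (iterated_conjugate A qs (under A y x) \<^bold>\<or>
    iterated_conjugate A rs (under A (x \<^bold>\<and> y) w \<^bold>\<and> under A z (x \<^bold>\<or> y))) = \<one>"
proof -
  \<comment> \<open>a valuation that reaches every element occurring in the identity\<close>
  define xs where "xs = [x, y, z, w] @ map snd (ps @ qs @ rs)"
  define v where "v i = (if i < length xs then xs ! i else x)" for i
  have v: "range v \<subseteq> carrier A"
  proof -
    have "set xs \<subseteq> carrier A"
      using xyz ps by (auto simp: xs_def)
    then show ?thesis
      using xyz by (auto simp: v_def dest: nth_mem)
  qed
  have reach: "\<exists>i. u = v i" if "u \<in> set xs" for u
    using that by (auto simp: v_def in_set_conv_nth)
  obtain ix iy iz iw where i: "v ix = x" "v iy = y" "v iz = z" "v iw = w"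
    using reach[of x] reach[of y] reach[of z] reach[of w] by (auto simp: xs_def)
  have lists: "\<exists>is'. map (map_prod id v) is' = us" if "snd ` set us \<subseteq> set xs" for us :: "(bool \<times> 'a) list"
  proof -
    have "\<exists>q. p = map_prod id v q" if "p \<in> set us" for p
      using reach[of "snd p"] \<open>snd ` set us \<subseteq> set xs\<close> that
      by (metis (no_types, lifting) id_apply image_subset_iff map_prod_simp prod.collapse)
    then show ?thesis
      by (metis ex_map_conv)
  qed
  obtain ips iqs irs where lists': "map (map_prod id v) ips = ps" "map (map_prod id v) iqs = qs"
    "map (map_prod id v) irs = rs"
    using lists[of ps] lists[of qs] lists[of rs] by (auto simp: xs_def)
  let ?s = "Join (iterated_conjugate_trm ips (Under (Var ix) (Var iy)))
    (Join (iterated_conjugate_trm iqs (Under (Var iy) (Var ix)))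
      (iterated_conjugate_trm irs (Meet (Under (Meet (Var ix) (Var iy)) (Var iw))
        (Under (Var iz) (Join (Var ix) (Var iy))))))"
  have "eval A v ?s = eval A v One"
    using A
  proof (rule SRL_satisfies[OF _ _ v])
    fix U :: "nat rl" assume U: "residuated_lattice U" "unilinear U"
    have "eval U u ?s = eval U u One" if "range u \<subseteq> carrier U" for u
    proof -
      have u: "u i \<in> carrier U" for i
        using that by auto
      have "snd ` set (map (map_prod id u) js) \<subseteq> carrier U" for js :: "(bool \<times> nat) list"
        using u by auto
      from residuated_lattice.unilinear_imp_conjugate_prelinear[OF U u u u u this this this]
      show ?thesis
        by (simp only: eval.simps eval_iterated_conjugate_trm)
    qed
    then show "U \<in> models {(?s, One)}"
      by (simp add: models_def)
  qed
  then show ?thesis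
    by (simp add: i lists')
qed

text \<open>
  A filter \<open>F\<close> that is maximal among those omitting \<open>p\<close> is prime in the following sense: if all joins of
  iterated conjugates of three elements \<open>a\<close>, \<open>b\<close>, \<open>c\<close> lie in \<open>F\<close>, then so does one of the three. Otherwise
  the polars of \<open>conjugate_polar\<close>, being filters that properly extend \<open>F\<close>, contain \<open>p\<close>; this replaces
  \<open>a\<close>, \<open>b\<close> and \<open>c\<close> by \<open>p\<close>, one after the other, and the join of three copies of \<open>p\<close> ends up in \<open>F\<close>.
  The equations of \<open>SRL_conjugate_prelinear\<close> provide such triples.
\<close>

lemma SRL_prime_filter:
  fixes A :: "'a rl" (structure)
  assumes A: "A \<in> SRL" and p [simp]: "p \<in> carrier A" and np: "\<not> \<one> \<preceq> p"
  shows "\<exists>F. deductive_filter A F \<and> p \<notin> F \<and> unilinear_preorder A (\<lambda>x y. under A x y \<in> F)"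
proof -
  interpret residuated_lattice A
    using A by (simp add: SRL_def)
  define S where "S = {F. deductive_filter A F \<and> p \<notin> F}"
  have "S \<noteq> {}"
    using positive_cone_filter np by (auto simp: S_def)
  moreover have "\<Union>C \<in> S" if C: "C \<noteq> {}" "subset.chain S C" for C
  proof -
    have F: "deductive_filter A F" "p \<notin> F" if "F \<in> C" for F
      using C that by (auto simp: S_def subset.chain_def)
    have chain: "F \<subseteq> F' \<or> F' \<subseteq> F" if "F \<in> C" "F' \<in> C" for F F'
      using C that by (auto simp: subset.chain_def)
    have "deductive_filter A (\<Union>C)"
    proof
      show "\<Union>C \<subseteq> carrier A"
        using deductive_filter.subset[OF F(1)] by (rule Union_least)
      obtain F where "F \<in> C"
        using C by auto
      then show "\<one> \<in> \<Union>C"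
        using deductive_filter.one[OF F(1)] by auto
      show "y \<in> \<Union>C" if "x \<in> \<Union>C" "x \<preceq> y" "y \<in> carrier A" for x y
        using that(1) deductive_filter.up[OF F(1) _ that(2,3)] by auto
      show "x \<otimes> y \<in> \<Union>C" if xy: "x \<in> \<Union>C" "y \<in> \<Union>C" for x y
      proof -
        obtain F F' where FF': "F \<in> C" "x \<in> F" "F' \<in> C" "y \<in> F'"
          using xy by blast
        then obtain G where "G \<in> C" "x \<in> G" "y \<in> G"
          using chain[OF FF'(1,3)] by auto
        then show ?thesis
          using deductive_filter.mult[OF F(1)] by (auto intro!: bexI[of _ G])
      qed
      show "conjugate A p x \<in> \<Union>C" if "x \<in> \<Union>C" "snd p \<in> carrier A" for x p
        using that(1) deductive_filter.conj[OF F(1) _ that(2)] by auto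
    qed
    then show ?thesis
      using F(2) by (auto simp: S_def)
  qed
  ultimately obtain F where "F \<in> S" and max: "\<And>G. G \<in> S \<Longrightarrow> F \<subseteq> G \<Longrightarrow> G = F"
    using subset_Zorn_nonempty[of S] by blast
  then interpret F: deductive_filter A F
    by (simp add: S_def)
  have "p \<notin> F"
    using \<open>F \<in> S\<close> by (simp add: S_def)
  define H where "H a b c \<longleftrightarrow> (\<forall>ps qs rs. snd ` set ps \<subseteq> carrier A \<longrightarrow> snd ` set qs \<subseteq> carrier A \<longrightarrow>
    snd ` set rs \<subseteq> carrier A \<longrightarrow>
    iterated_conjugate A ps a \<^bold>\<or> (iterated_conjugate A qs b \<^bold>\<or> iterated_conjugate A rs c) \<in> F)" for a b c
  have rotate: "H b c a" if "H a b c" and [simp]: "a \<in> carrier A" "b \<in> carrier A" "c \<in> carrier A" for a b c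
    unfolding H_def
  proof (intro allI impI)
    fix qs rs ps :: "(bool \<times> 'a) list"
    assume *: "snd ` set qs \<subseteq> carrier A" "snd ` set rs \<subseteq> carrier A" "snd ` set ps \<subseteq> carrier A"
    let ?a = "iterated_conjugate A ps a" and ?b = "iterated_conjugate A qs b"
      and ?c = "iterated_conjugate A rs c"
    have "?a \<in> carrier A" "?b \<in> carrier A" "?c \<in> carrier A"
      using * by (simp_all add: iterated_conjugate_closed)
    then have "?b \<^bold>\<or> (?c \<^bold>\<or> ?a) = ?a \<^bold>\<or> (?b \<^bold>\<or> ?c)"
      by (metis vee_assoc vee_closed vee_comm)
    then show "?b \<^bold>\<or> (?c \<^bold>\<or> ?a) \<in> F"
      using that(1) * by (simp add: H_def)
  qed
  \<comment> \<open>the polar of the conjugates of \<open>b\<close> and \<open>c\<close> contains \<open>a\<close>, so it is larger than \<open>F\<close>\<close>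
  have replace: "H p b c" if "H a b c" "a \<notin> F" and [simp]: "a \<in> carrier A" "b \<in> carrier A" "c \<in> carrier A" for a b c
  proof -
    define T where "T = {iterated_conjugate A qs b \<^bold>\<or> iterated_conjugate A rs c | qs rs.
      snd ` set qs \<subseteq> carrier A \<and> snd ` set rs \<subseteq> carrier A}"
    define G where "G = {x \<in> carrier A. \<forall>ps. snd ` set ps \<subseteq> carrier A \<longrightarrow>
      (\<forall>t\<in>T. iterated_conjugate A ps x \<^bold>\<or> t \<in> F)}"
    have "t \<in> carrier A \<and> t \<preceq> \<one>" if "t \<in> T" for t
      using that by (auto simp: T_def iterated_conjugate_closed closed order.join_le_iff iterated_conjugate_le_one)
    note G = F.conjugate_polar[of T, OF this, folded G_def]
    have "a \<in> G"
      using that(1) by (auto simp: G_def T_def H_def)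
    then have "G \<notin> S"
      using max[OF _ G(2)] \<open>a \<notin> F\<close> by blast
    then have "p \<in> G"
      using G(1) by (simp add: S_def)
    then show ?thesis
      by (auto simp: G_def T_def H_def)
  qed
  have "unilinear_preorder A (\<lambda>x y. under A x y \<in> F)"
  proof (intro unilinear_preorder.intro unilinear_preorder_axioms.intro F.residuated_preorder, rule ccontr)
    fix x y z w assume [simp]: "x \<in> carrier A" "y \<in> carrier A" "z \<in> carrier A" "w \<in> carrier A"
    let ?a = "under A x y" and ?b = "under A y x"
    let ?c = "under A (x \<^bold>\<and> y) w \<^bold>\<and> under A z (x \<^bold>\<or> y)"
    have [simp]: "?a \<in> carrier A" "?b \<in> carrier A" "?c \<in> carrier A"
      by (simp_all add: closed)
    assume *: "\<not> (?a \<in> F \<or> ?b \<in> F \<or> under A (x \<^bold>\<and> y) w \<in> F \<and> under A z (x \<^bold>\<or> y) \<in> F)"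
    have "?c \<notin> F"
      using * F.up[of ?c "under A (x \<^bold>\<and> y) w"] F.up[of ?c "under A z (x \<^bold>\<or> y)"]
      by (simp add: closed wedge_le1 wedge_le2) blast
    have "H ?a ?b ?c"
      unfolding H_def using F.one by (intro allI impI, subst SRL_conjugate_prelinear[OF A]) auto
    then have "H p ?b ?c"
      by (rule replace) (use * in simp_all)
    then have "H ?b ?c p"
      by (rule rotate) simp_all
    then have "H p ?c p"
      by (rule replace) (use * in simp_all)
    then have "H ?c p p"
      by (rule rotate) simp_all
    then have "H p p p"
      by (rule replace) (use \<open>?c \<notin> F\<close> in simp_all)
    then have "iterated_conjugate A [] p \<^bold>\<or> (iterated_conjugate A [] p \<^bold>\<or> iterated_conjugate A [] p) \<in> F"
      unfolding H_def by (elim allE[of _ "[]"]) simp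
    then have "p \<in> F"
      using F.up[of _ p] by (simp add: order.join_le_iff closed wedge_le1)
    then show False
      using \<open>p \<notin> F\<close> by simp
  qed
  then show ?thesis
    using \<open>p \<notin> F\<close> F.deductive_filter_axioms by blast
qed

section \<open>The Galois algebra of a translation closed family of sets\<close>

definition galois_closure :: "('a, 'b) monoid_scheme \<Rightarrow> 'a set set \<Rightarrow> 'a set \<Rightarrow> 'a set" where
  "galois_closure M D X = {x \<in> carrier M. \<forall>d\<in>D. X \<subseteq> d \<longrightarrow> x \<in> d}"

text \<open>
  The closed sets with the operations of a nucleus image of the power set of the monoid. The residuals
  are those of the power set, because the residuals of a closed set are closed.
\<close>

definition galois_algebra :: "('a, 'b) monoid_scheme \<Rightarrow> 'a set set \<Rightarrow> 'a set rl" where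
  "galois_algebra M D = \<lparr>
    carrier = {X. galois_closure M D X = X},
    monoid.mult = (\<lambda>X Y. galois_closure M D {x \<otimes>\<^bsub>M\<^esub> y | x y. x \<in> X \<and> y \<in> Y}),
    one = galois_closure M D {\<one>\<^bsub>M\<^esub>},
    wedge = (\<inter>),
    vee = (\<lambda>X Y. galois_closure M D (X \<union> Y)),
    under = (\<lambda>X Z. {y \<in> carrier M. \<forall>x\<in>X. x \<otimes>\<^bsub>M\<^esub> y \<in> Z}),
    over = (\<lambda>Z Y. {x \<in> carrier M. \<forall>y\<in>Y. x \<otimes>\<^bsub>M\<^esub> y \<in> Z})\<rparr>"

lemma galois_algebra_simps [simp]:
  "carrier (galois_algebra M D) = {X. galois_closure M D X = X}"
  "X \<otimes>\<^bsub>galois_algebra M D\<^esub> Y = galois_closure M D {x \<otimes>\<^bsub>M\<^esub> y | x y. x \<in> X \<and> y \<in> Y}"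
  "\<one>\<^bsub>galois_algebra M D\<^esub> = galois_closure M D {\<one>\<^bsub>M\<^esub>}"
  "X \<^bold>\<and>\<^bsub>galois_algebra M D\<^esub> Y = X \<inter> Y"
  "X \<^bold>\<or>\<^bsub>galois_algebra M D\<^esub> Y = galois_closure M D (X \<union> Y)"
  "under (galois_algebra M D) X Z = {y \<in> carrier M. \<forall>x\<in>X. x \<otimes>\<^bsub>M\<^esub> y \<in> Z}"
  "over (galois_algebra M D) Z Y = {x \<in> carrier M. \<forall>y\<in>Y. x \<otimes>\<^bsub>M\<^esub> y \<in> Z}"
  by (simp_all add: galois_algebra_def)

lemma galois_algebra_le [simp]: "X \<preceq>\<^bsub>galois_algebra M D\<^esub> Y \<longleftrightarrow> X \<subseteq> Y"
  by (auto simp: rl_le_def)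

lemma finite_galois_algebra:
  assumes "finite D" shows "finite (carrier (galois_algebra M D))"
proof (rule finite_subset)
  show "carrier (galois_algebra M D) \<subseteq> (\<lambda>E. {x \<in> carrier M. \<forall>d\<in>E. x \<in> d}) ` Pow D"
  proof
    fix X assume "X \<in> carrier (galois_algebra M D)"
    then have "galois_closure M D X = X"
      by simp
    moreover have "galois_closure M D X = {x \<in> carrier M. \<forall>d\<in>{d \<in> D. X \<subseteq> d}. x \<in> d}"
      unfolding galois_closure_def by blast
    ultimately have "X = {x \<in> carrier M. \<forall>d\<in>{d \<in> D. X \<subseteq> d}. x \<in> d}"
      by (rule trans[OF sym])
    then show "X \<in> (\<lambda>E. {x \<in> carrier M. \<forall>d\<in>E. x \<in> d}) ` Pow D"
      by (rule image_eqI) blast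
  qed
qed (simp add: assms)

text \<open>
  If preimages of members of \<open>D\<close> under translations are again members, then residuals of closed sets are
  closed. This makes the closure a nucleus.
\<close>

locale translation_closed = monoid M for M (structure) + fixes D :: "'a set set"
  assumes left_translate: "\<lbrakk>d \<in> D; x \<in> carrier M\<rbrakk> \<Longrightarrow> {y \<in> carrier M. x \<otimes> y \<in> d} \<in> D"
    and right_translate: "\<lbrakk>d \<in> D; y \<in> carrier M\<rbrakk> \<Longrightarrow> {x \<in> carrier M. x \<otimes> y \<in> d} \<in> D"
begin

abbreviation cl where "cl \<equiv> galois_closure M D"

definition galois_closed where "galois_closed X \<longleftrightarrow> cl X = X"

lemma cl_subset_carrier: "cl X \<subseteq> carrier M"
  unfolding galois_closure_def by blast

lemma galois_closedD: "\<lbrakk>galois_closed X; x \<in> X\<rbrakk> \<Longrightarrow> x \<in> carrier M"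
  unfolding galois_closed_def using cl_subset_carrier by blast

lemma closed_mem:
  assumes "galois_closed X" "x \<in> carrier M" "\<And>d. \<lbrakk>d \<in> D; X \<subseteq> d\<rbrakk> \<Longrightarrow> x \<in> d"
  shows "x \<in> X"
proof -
  have "x \<in> cl X"
    using assms(2,3) unfolding galois_closure_def by blast
  then show ?thesis
    using assms(1) by (simp add: galois_closed_def)
qed

lemma subset_cl: "X \<subseteq> carrier M \<Longrightarrow> X \<subseteq> cl X"
  unfolding galois_closure_def by blast

lemma galois_closedI:
  assumes "X \<subseteq> carrier M"
    and "\<And>x. \<lbrakk>x \<in> carrier M; \<And>d. \<lbrakk>d \<in> D; X \<subseteq> d\<rbrakk> \<Longrightarrow> x \<in> d\<rbrakk> \<Longrightarrow> x \<in> X"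
  shows "galois_closed X"
  unfolding galois_closed_def
proof
  show "cl X \<subseteq> X"
    using assms(2) unfolding galois_closure_def by blast
qed (rule subset_cl[OF assms(1)])

lemma cl_mono: "X \<subseteq> Y \<Longrightarrow> cl X \<subseteq> cl Y"
  unfolding galois_closure_def by blast

lemma galois_closed_cl [simp]: "galois_closed (cl X)"
  by (rule galois_closedI[OF cl_subset_carrier]) (auto simp: galois_closure_def)

lemma cl_subset_iff:
  assumes "X \<subseteq> carrier M" "galois_closed Z" shows "cl X \<subseteq> Z \<longleftrightarrow> X \<subseteq> Z"
  using subset_cl[OF assms(1)] cl_mono[of X Z] assms(2) unfolding galois_closed_def by blast

text \<open>
  Equations between closures are proved by comparing the closed sets above both sides, since closures
  below a closed set can be dropped.
\<close>

lemma closed_eqI: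
  "\<lbrakk>galois_closed X; galois_closed Y; \<And>Z. galois_closed Z \<Longrightarrow> X \<subseteq> Z \<longleftrightarrow> Y \<subseteq> Z\<rbrakk> \<Longrightarrow> X = Y"
  by (metis order_refl subset_antisym)

lemma galois_closed_Int:
  assumes "galois_closed X" "galois_closed Y" shows "galois_closed (X \<inter> Y)"
proof (rule galois_closedI)
  show "X \<inter> Y \<subseteq> carrier M"
    using galois_closedD[OF assms(1)] by blast
  fix x assume "x \<in> carrier M" "\<And>d. \<lbrakk>d \<in> D; X \<inter> Y \<subseteq> d\<rbrakk> \<Longrightarrow> x \<in> d"
  then show "x \<in> X \<inter> Y"
    using closed_mem[OF assms(1)] closed_mem[OF assms(2)] by blast
qed

lemma galois_closed_left_translate:
  assumes "galois_closed Z" "x \<in> carrier M"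
  shows "galois_closed {y \<in> carrier M. x \<otimes> y \<in> Z}"
proof (rule galois_closedI)
  fix y assume y: "y \<in> carrier M"
    and *: "\<And>d. \<lbrakk>d \<in> D; {y \<in> carrier M. x \<otimes> y \<in> Z} \<subseteq> d\<rbrakk> \<Longrightarrow> y \<in> d"
  have "x \<otimes> y \<in> Z"
  proof (rule closed_mem[OF assms(1)])
    fix d assume "d \<in> D" "Z \<subseteq> d"
    then show "x \<otimes> y \<in> d"
      using *[OF left_translate[of d x]] assms(2) by auto
  qed (use y assms in auto)
  then show "y \<in> {y \<in> carrier M. x \<otimes> y \<in> Z}"
    using y by simp
qed auto

lemma galois_closed_right_translate:
  assumes "galois_closed Z" "y \<in> carrier M"
  shows "galois_closed {x \<in> carrier M. x \<otimes> y \<in> Z}"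
proof (rule galois_closedI)
  fix x assume x: "x \<in> carrier M"
    and *: "\<And>d. \<lbrakk>d \<in> D; {x \<in> carrier M. x \<otimes> y \<in> Z} \<subseteq> d\<rbrakk> \<Longrightarrow> x \<in> d"
  have "x \<otimes> y \<in> Z"
  proof (rule closed_mem[OF assms(1)])
    fix d assume "d \<in> D" "Z \<subseteq> d"
    then show "x \<otimes> y \<in> d"
      using *[OF right_translate[of d y]] assms(2) by auto
  qed (use x assms in auto)
  then show "x \<in> {x \<in> carrier M. x \<otimes> y \<in> Z}"
    using x by simp
qed auto

lemma galois_closed_under:
  assumes "galois_closed Z" "\<And>x. x \<in> X \<Longrightarrow> x \<in> carrier M"
  shows "galois_closed {y \<in> carrier M. \<forall>x\<in>X. x \<otimes> y \<in> Z}"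
proof (rule galois_closedI)
  fix y assume y: "y \<in> carrier M"
    and *: "\<And>d. \<lbrakk>d \<in> D; {y \<in> carrier M. \<forall>x\<in>X. x \<otimes> y \<in> Z} \<subseteq> d\<rbrakk> \<Longrightarrow> y \<in> d"
  have "y \<in> {y \<in> carrier M. x \<otimes> y \<in> Z}" if "x \<in> X" for x
    using galois_closed_left_translate[OF assms(1) assms(2)[OF that]] y
    by (rule closed_mem) (use that in \<open>auto intro!: *\<close>)
  then show "y \<in> {y \<in> carrier M. \<forall>x\<in>X. x \<otimes> y \<in> Z}"
    using y by auto
qed auto

lemma galois_closed_over:
  assumes "galois_closed Z" "\<And>y. y \<in> Y \<Longrightarrow> y \<in> carrier M"
  shows "galois_closed {x \<in> carrier M. \<forall>y\<in>Y. x \<otimes> y \<in> Z}"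
proof (rule galois_closedI)
  fix x assume x: "x \<in> carrier M"
    and *: "\<And>d. \<lbrakk>d \<in> D; {x \<in> carrier M. \<forall>y\<in>Y. x \<otimes> y \<in> Z} \<subseteq> d\<rbrakk> \<Longrightarrow> x \<in> d"
  have "x \<in> {x \<in> carrier M. x \<otimes> y \<in> Z}" if "y \<in> Y" for y
    using galois_closed_right_translate[OF assms(1) assms(2)[OF that]] x
    by (rule closed_mem) (use that in \<open>auto intro!: *\<close>)
  then show "x \<in> {x \<in> carrier M. \<forall>y\<in>Y. x \<otimes> y \<in> Z}"
    using x by auto
qed auto

abbreviation cmult where "cmult X Y \<equiv> cl {x \<otimes> y | x y. x \<in> X \<and> y \<in> Y}"

lemma cmult_subset_iff:
  assumes "X \<subseteq> carrier M" "Y \<subseteq> carrier M" "galois_closed Z"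
  shows "cmult X Y \<subseteq> Z \<longleftrightarrow> (\<forall>x\<in>X. \<forall>y\<in>Y. x \<otimes> y \<in> Z)"
proof -
  have "{x \<otimes> y | x y. x \<in> X \<and> y \<in> Y} \<subseteq> carrier M"
    using assms by auto
  from cl_subset_iff[OF this assms(3)] show ?thesis
    by blast
qed

lemma cmult_assoc:
  assumes "galois_closed X" "galois_closed Y" "galois_closed Z"
  shows "cmult (cmult X Y) Z = cmult X (cmult Y Z)"
proof (rule closed_eqI)
  fix V assume V: "galois_closed V"
  have sub: "X \<subseteq> carrier M" "Y \<subseteq> carrier M" "Z \<subseteq> carrier M" "cmult X Y \<subseteq> carrier M" "cmult Y Z \<subseteq> carrier M"
    using assms galois_closedD galois_closed_cl by blast+
  have "cmult (cmult X Y) Z \<subseteq> V \<longleftrightarrow> (\<forall>z\<in>Z. cmult X Y \<subseteq> {u \<in> carrier M. u \<otimes> z \<in> V})"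
    using sub by (subst cmult_subset_iff[OF _ _ V]) auto
  also have "\<dots> \<longleftrightarrow> (\<forall>z\<in>Z. \<forall>x\<in>X. \<forall>y\<in>Y. x \<otimes> y \<otimes> z \<in> V)"
  proof (rule ball_cong[OF HOL.refl])
    fix z assume "z \<in> Z"
    then have "z \<in> carrier M"
      using sub by blast
    from cmult_subset_iff[OF sub(1,2) galois_closed_right_translate[OF V this]]
    show "cmult X Y \<subseteq> {u \<in> carrier M. u \<otimes> z \<in> V} \<longleftrightarrow> (\<forall>x\<in>X. \<forall>y\<in>Y. x \<otimes> y \<otimes> z \<in> V)"
      using sub by (auto simp: subset_iff)
  qed
  also have "\<dots> \<longleftrightarrow> (\<forall>x\<in>X. \<forall>y\<in>Y. \<forall>z\<in>Z. x \<otimes> (y \<otimes> z) \<in> V)"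
    using sub by (auto simp: m_assoc subset_iff)
  also have "\<dots> \<longleftrightarrow> (\<forall>x\<in>X. cmult Y Z \<subseteq> {u \<in> carrier M. x \<otimes> u \<in> V})"
  proof (rule ball_cong[OF HOL.refl])
    fix x assume "x \<in> X"
    then have "x \<in> carrier M"
      using sub by blast
    from cmult_subset_iff[OF sub(2,3) galois_closed_left_translate[OF V this]]
    show "(\<forall>y\<in>Y. \<forall>z\<in>Z. x \<otimes> (y \<otimes> z) \<in> V) \<longleftrightarrow> cmult Y Z \<subseteq> {u \<in> carrier M. x \<otimes> u \<in> V}"
      using sub by (auto simp: subset_iff)
  qed
  also have "\<dots> \<longleftrightarrow> cmult X (cmult Y Z) \<subseteq> V"
    using sub by (subst cmult_subset_iff[OF _ _ V]) auto
  finally show "cmult (cmult X Y) Z \<subseteq> V \<longleftrightarrow> cmult X (cmult Y Z) \<subseteq> V" .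
qed auto

lemma carrier_galois_algebra: "carrier (galois_algebra M D) = {X. galois_closed X}"
  by (simp add: galois_closed_def)

lemma residuated_lattice_galois_algebra: "residuated_lattice (galois_algebra M D)"
proof
  let ?C = "galois_algebra M D"
  note [simp] = carrier_galois_algebra
  note [simp del] = galois_algebra_simps(1)
  fix X Y Z assume "X \<in> carrier ?C" "Y \<in> carrier ?C" "Z \<in> carrier ?C"
  then have c: "galois_closed X" "galois_closed Y" "galois_closed Z"
    by simp_all
  then have sub: "X \<subseteq> carrier M" "Y \<subseteq> carrier M" "Z \<subseteq> carrier M"
    using galois_closedD by blast+
  show "X \<otimes>\<^bsub>?C\<^esub> Y \<otimes>\<^bsub>?C\<^esub> Z = X \<otimes>\<^bsub>?C\<^esub> (Y \<otimes>\<^bsub>?C\<^esub> Z)"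
    using c by (simp add: cmult_assoc)
  show "X \<^bold>\<or>\<^bsub>?C\<^esub> Y \<^bold>\<or>\<^bsub>?C\<^esub> Z = X \<^bold>\<or>\<^bsub>?C\<^esub> (Y \<^bold>\<or>\<^bsub>?C\<^esub> Z)"
  proof (simp, rule closed_eqI)
    fix V assume V: "galois_closed V"
    have "cl (X \<union> Y) \<subseteq> carrier M" "cl (Y \<union> Z) \<subseteq> carrier M"
      using galois_closedD galois_closed_cl by blast+
    then show "cl (cl (X \<union> Y) \<union> Z) \<subseteq> V \<longleftrightarrow> cl (X \<union> cl (Y \<union> Z)) \<subseteq> V"
      using V sub by (simp add: cl_subset_iff Un_assoc)
  qed auto
  show "X \<otimes>\<^bsub>?C\<^esub> Y \<preceq>\<^bsub>?C\<^esub> Z \<longleftrightarrow> Y \<preceq>\<^bsub>?C\<^esub> under ?C X Z"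
    using c sub by (simp add: cmult_subset_iff) blast
  show "X \<otimes>\<^bsub>?C\<^esub> Y \<preceq>\<^bsub>?C\<^esub> Z \<longleftrightarrow> X \<preceq>\<^bsub>?C\<^esub> over ?C Z Y"
    using c sub by (simp add: cmult_subset_iff) blast
next
  let ?C = "galois_algebra M D"
  note [simp] = carrier_galois_algebra
  note [simp del] = galois_algebra_simps(1)
  fix X Y assume "X \<in> carrier ?C" "Y \<in> carrier ?C"
  then have c: "galois_closed X" "galois_closed Y"
    by simp_all
  then have sub: "X \<subseteq> carrier M" "Y \<subseteq> carrier M"
    using galois_closedD by blast+
  show "X \<otimes>\<^bsub>?C\<^esub> Y \<in> carrier ?C" "X \<^bold>\<and>\<^bsub>?C\<^esub> Y \<in> carrier ?C" "X \<^bold>\<or>\<^bsub>?C\<^esub> Y \<in> carrier ?C"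
    using c by (simp_all add: galois_closed_Int)
  show "under ?C X Y \<in> carrier ?C" "over ?C X Y \<in> carrier ?C"
    using c galois_closedD by (simp_all add: galois_closed_under galois_closed_over)
  show "X \<^bold>\<and>\<^bsub>?C\<^esub> (X \<^bold>\<or>\<^bsub>?C\<^esub> Y) = X" "X \<^bold>\<or>\<^bsub>?C\<^esub> (X \<^bold>\<and>\<^bsub>?C\<^esub> Y) = X"
    using sub c by (auto simp: galois_closure_def galois_closed_def)
next
  let ?C = "galois_algebra M D"
  note [simp] = carrier_galois_algebra
  note [simp del] = galois_algebra_simps(1)
  fix X assume "X \<in> carrier ?C"
  then have c: "galois_closed X"
    by simp
  then have sub: "X \<subseteq> carrier M"
    using galois_closedD by blast
  have one: "cl {\<one>} \<subseteq> carrier M"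
    using galois_closedD galois_closed_cl by blast
  show "\<one>\<^bsub>?C\<^esub> \<otimes>\<^bsub>?C\<^esub> X = X"
  proof (simp, rule closed_eqI)
    fix V assume V: "galois_closed V"
    have "cmult (cl {\<one>}) X \<subseteq> V \<longleftrightarrow> (\<forall>x\<in>X. cl {\<one>} \<subseteq> {u \<in> carrier M. u \<otimes> x \<in> V})"
      using sub one by (subst cmult_subset_iff[OF _ _ V]) auto
    also have "\<dots> \<longleftrightarrow> X \<subseteq> V"
    proof -
      have "cl {\<one>} \<subseteq> {u \<in> carrier M. u \<otimes> x \<in> V} \<longleftrightarrow> x \<in> V" if "x \<in> X" for x
        using that sub by (subst cl_subset_iff[OF _ galois_closed_right_translate[OF V]]) auto
      then show ?thesis
        by blast
    qed
    finally show "cmult (cl {\<one>}) X \<subseteq> V \<longleftrightarrow> X \<subseteq> V" .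
  qed (use c in auto)
  show "X \<otimes>\<^bsub>?C\<^esub> \<one>\<^bsub>?C\<^esub> = X"
  proof (simp, rule closed_eqI)
    fix V assume V: "galois_closed V"
    have "cmult X (cl {\<one>}) \<subseteq> V \<longleftrightarrow> (\<forall>x\<in>X. cl {\<one>} \<subseteq> {u \<in> carrier M. x \<otimes> u \<in> V})"
      using sub one by (subst cmult_subset_iff[OF _ _ V]) auto
    also have "\<dots> \<longleftrightarrow> X \<subseteq> V"
    proof -
      have "cl {\<one>} \<subseteq> {u \<in> carrier M. x \<otimes> u \<in> V} \<longleftrightarrow> x \<in> V" if "x \<in> X" for x
        using that sub by (subst cl_subset_iff[OF _ galois_closed_left_translate[OF V]]) auto
      then show ?thesis
        by blast
    qed
    finally show "cmult X (cl {\<one>}) \<subseteq> V \<longleftrightarrow> X \<subseteq> V" .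
  qed (use c in auto)
qed (auto simp: Int_ac Un_ac galois_closed_cl[unfolded galois_closed_def])

text \<open>
  Closures inside an iterated product do not matter for closed upper bounds: only the elementwise
  products count.
\<close>

lemma lprod_galois_algebra_subset_iff:
  assumes "\<And>i. galois_closed (X i)" "galois_closed Z"
  shows "lprod (galois_algebra M D) (map X m) \<subseteq> Z \<longleftrightarrow>
    (\<forall>xs. list_all2 (\<lambda>x i. x \<in> X i) xs m \<longrightarrow> lprod M xs \<in> Z)"
  using assms(2)
proof (induction m arbitrary: Z)
  case Nil
  then show ?case
    by (simp add: cl_subset_iff)
next
  case (Cons i m)
  let ?P = "lprod (galois_algebra M D) (map X m)"
  interpret C: residuated_lattice "galois_algebra M D"
    by (rule residuated_lattice_galois_algebra)
  have "set (map X m) \<subseteq> carrier (galois_algebra M D)"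
    using assms(1) by (auto simp: galois_closed_def)
  then have "galois_closed ?P"
    using C.lprod_closed by (simp add: galois_closed_def)
  then have sub: "?P \<subseteq> carrier M" "X i \<subseteq> carrier M" for i
    using galois_closedD assms(1) by blast+
  have mem: "lprod M xs \<in> carrier M" if "list_all2 (\<lambda>x i. x \<in> X i) xs m" for xs
  proof (rule lprod_closed)
    show "set xs \<subseteq> carrier M"
      using that by (induction rule: list_all2_induct) (use sub(2) in auto)
  qed
  have "lprod (galois_algebra M D) (map X (i # m)) \<subseteq> Z \<longleftrightarrow> (\<forall>x\<in>X i. ?P \<subseteq> {y \<in> carrier M. x \<otimes> y \<in> Z})"
    using sub Cons.prems by (simp add: cmult_subset_iff) blast
  also have "\<dots> \<longleftrightarrow> (\<forall>x\<in>X i. \<forall>xs. list_all2 (\<lambda>x i. x \<in> X i) xs m \<longrightarrow> x \<otimes> lprod M xs \<in> Z)"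
  proof (rule ball_cong[OF HOL.refl])
    fix x assume "x \<in> X i"
    then have "x \<in> carrier M"
      using sub by blast
    from Cons.IH[OF galois_closed_left_translate[OF Cons.prems this]]
    show "?P \<subseteq> {y \<in> carrier M. x \<otimes> y \<in> Z} \<longleftrightarrow>
      (\<forall>xs. list_all2 (\<lambda>x i. x \<in> X i) xs m \<longrightarrow> x \<otimes> lprod M xs \<in> Z)"
      using mem by simp
  qed
  also have "\<dots> \<longleftrightarrow> (\<forall>xs. list_all2 (\<lambda>x i. x \<in> X i) xs (i # m) \<longrightarrow> lprod M xs \<in> Z)"
    (is "?L \<longleftrightarrow> ?R")
  proof
    assume ?L
    show ?R
    proof (intro allI impI)
      fix ys assume "list_all2 (\<lambda>x i. x \<in> X i) ys (i # m)"
      then obtain x xs where "ys = x # xs" "x \<in> X i" "list_all2 (\<lambda>x i. x \<in> X i) xs m"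
        unfolding list_all2_Cons2 by blast
      then show "lprod M ys \<in> Z"
        using \<open>?L\<close> by simp
    qed
  next
    assume R: ?R
    show ?L
    proof (intro ballI allI impI)
      fix x xs assume "x \<in> X i" "list_all2 (\<lambda>x i. x \<in> X i) xs m"
      then show "x \<otimes> lprod M xs \<in> Z"
        using R[rule_format, of "x # xs"] by simp
    qed
  qed
  finally show ?case .
qed

end

section \<open>The algebra of cuts\<close>

text \<open>
  A partial embedding without injectivity. Partial homomorphisms into several algebras combine to one
  into their product, and only the combination has to be injective.
\<close>

definition partial_hom :: "('a, 'c) rl_scheme \<Rightarrow> 'a set \<Rightarrow> 'b rl \<Rightarrow> ('a \<Rightarrow> 'b) \<Rightarrow> bool" where
  "partial_hom A B C f \<longleftrightarrow>
    f ` B \<subseteq> carrier C \<and>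
    (\<one>\<^bsub>A\<^esub> \<in> B \<longrightarrow> f \<one>\<^bsub>A\<^esub> = \<one>\<^bsub>C\<^esub>) \<and>
    (\<forall>x\<in>B. \<forall>y\<in>B.
      (x \<otimes>\<^bsub>A\<^esub> y \<in> B \<longrightarrow> f (x \<otimes>\<^bsub>A\<^esub> y) = f x \<otimes>\<^bsub>C\<^esub> f y) \<and>
      (x \<^bold>\<and>\<^bsub>A\<^esub> y \<in> B \<longrightarrow> f (x \<^bold>\<and>\<^bsub>A\<^esub> y) = f x \<^bold>\<and>\<^bsub>C\<^esub> f y) \<and>
      (x \<^bold>\<or>\<^bsub>A\<^esub> y \<in> B \<longrightarrow> f (x \<^bold>\<or>\<^bsub>A\<^esub> y) = f x \<^bold>\<or>\<^bsub>C\<^esub> f y) \<and>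
      (under A x y \<in> B \<longrightarrow> f (under A x y) = under C (f x) (f y)) \<and>
      (over A x y \<in> B \<longrightarrow> f (over A x y) = over C (f x) (f y)))"

context residuated_preorder
begin

lemma two_sided_iff:
  "\<lbrakk>u \<in> carrier R; x \<in> carrier R; v \<in> carrier R; b \<in> carrier R\<rbrakk>
    \<Longrightarrow> u \<otimes> x \<otimes> v \<unlhd> b \<longleftrightarrow> x \<unlhd> under R u (over R b v)"
  using over_iff[of "u \<otimes> x" v b] under_iff[of u x "over R b v"] by (simp add: closed)

lemma lprod_mono:
  assumes "list_all2 (\<unlhd>) xs ys" "set xs \<subseteq> carrier R" "set ys \<subseteq> carrier R"
  shows "lprod R xs \<unlhd> lprod R ys"
  using assms by (induction rule: list_all2_induct) (auto intro: mult_mono)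

text \<open>
  By residuation, a bound on all products of elements, one from each \<open>F i\<close>, passes to the product of
  the \<open>g i\<close>, one factor at a time.
\<close>

lemma lprod_lub_le:
  assumes "\<And>i z. \<lbrakk>i \<in> set m; z \<in> carrier R; \<And>x. x \<in> F i \<Longrightarrow> x \<unlhd> z\<rbrakk> \<Longrightarrow> g i \<unlhd> z"
    and "\<And>i. i \<in> set m \<Longrightarrow> F i \<subseteq> carrier R \<and> g i \<in> carrier R"
    and "\<And>xs. list_all2 (\<lambda>x i. x \<in> F i) xs m \<Longrightarrow> lprod R xs \<unlhd> c" and "c \<in> carrier R"
  shows "lprod R (map g m) \<unlhd> c"
  using assms
proof (induction m arbitrary: c)
  case (Cons i m)
  have [simp]: "lprod R (map g m) \<in> carrier R" "g i \<in> carrier R"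
    using Cons.prems(2) by (auto intro!: lprod_closed)
  have "g i \<unlhd> over R c (lprod R (map g m))"
  proof (rule Cons.prems(1))
    fix x assume x: "x \<in> F i"
    then have [simp]: "x \<in> carrier R"
      using Cons.prems(2) by auto
    have "lprod R (map g m) \<unlhd> under R x c"
    proof (rule Cons.IH)
      fix xs assume "list_all2 (\<lambda>x i. x \<in> F i) xs m"
      then have "list_all2 (\<lambda>x i. x \<in> F i) (x # xs) (i # m)"
        using x by simp
      moreover have "set xs \<subseteq> carrier R"
        using \<open>list_all2 (\<lambda>x i. x \<in> F i) xs m\<close> Cons.prems(2)[OF list.set_intros(2)]
        by (induction rule: list_all2_induct) auto
      ultimately show "lprod R xs \<unlhd> under R x c"
        using Cons.prems(3)[of "x # xs"] Cons.prems(4) by (simp add: under_iff)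
    qed (use Cons.prems in \<open>auto simp: closed\<close>)
    then show "x \<unlhd> over R c (lprod R (map g m))"
      using Cons.prems(4) by (simp flip: over_iff under_iff)
  qed (use Cons.prems in \<open>auto simp: closed\<close>)
  then show ?case
    using Cons.prems(4) by (simp add: over_iff)
qed auto

lemma finite_lub:
  assumes "finite F" "F \<noteq> {}" "F \<subseteq> carrier R"
  shows "\<exists>g\<in>carrier R. (\<forall>x\<in>F. x \<unlhd> g) \<and> (\<forall>z\<in>carrier R. (\<forall>x\<in>F. x \<unlhd> z) \<longrightarrow> g \<unlhd> z)"
  using assms
proof (induction rule: finite_ne_induct)
  case (insert x F)
  then obtain g where g: "g \<in> carrier R" "\<forall>x\<in>F. x \<unlhd> g"
    "\<forall>z\<in>carrier R. (\<forall>x\<in>F. x \<unlhd> z) \<longrightarrow> g \<unlhd> z"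
    by auto
  have le: "x \<unlhd> x \<^bold>\<or> g" "g \<unlhd> x \<^bold>\<or> g"
    using insert.prems g by (auto intro!: le_of_order vee_ge1 vee_ge2 closed)
  then have "y \<unlhd> x \<^bold>\<or> g" if "y \<in> F" for y
    using insert.prems g that by (intro trans[OF _ le(2)]) (auto simp: closed)
  then show ?case
    using insert.prems g le by (intro bexI[of _ "x \<^bold>\<or> g"]) (auto simp: closed join_le_iff)
next
  case (singleton x)
  then show ?case
    by (intro bexI[of _ x]) auto
qed

lemma finite_lower_bound:
  assumes "finite F" "F \<subseteq> carrier R"
  shows "\<exists>d\<in>carrier R. \<forall>x\<in>F. d \<unlhd> x"
  using assms
proof (induction rule: finite_induct)
  case (insert x F)
  then obtain d where d: "d \<in> carrier R" "\<forall>x\<in>F. d \<unlhd> x"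
    by auto
  have le: "x \<^bold>\<and> d \<unlhd> x" "x \<^bold>\<and> d \<unlhd> d"
    using insert.prems d by (auto intro!: le_of_order wedge_le1 wedge_le2 closed)
  then have "x \<^bold>\<and> d \<unlhd> y" if "y \<in> F" for y
    using insert.prems d that by (intro trans[OF le(2)]) (auto simp: closed)
  then show ?case
    using insert.prems d le by (intro bexI[of _ "x \<^bold>\<and> d"]) (auto simp: closed)
qed auto

text \<open>
  A variable that occurs on one side of an equation only must receive a value that no monomial with
  this variable can see. In the absence of a least element, a value \<open>d\<close> below finitely many residuals
  will do: since \<open>d\<close> is also below the unit, all but one of its occurrences in a monomial may be replaced by
  the unit, and the remaining one is bounded by the residual.
\<close>

lemma monomials_small_value:
  assumes t: "finite T" and c: "c \<in> carrier R" and h: "\<And>i. h i \<in> carrier R"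
  shows "\<exists>d\<in>carrier R. d \<unlhd> \<one> \<and>
    (\<forall>m\<in>T. (\<exists>i\<in>set m. i \<in> N) \<longrightarrow> lprod R (map (\<lambda>i. if i \<in> N then d else h i) m) \<unlhd> c)"
proof -
  define h1 where "h1 i = (if i \<in> N then \<one> else h i)" for i
  define P where "P m = lprod R (map h1 m)" for m
  have h1: "h1 i \<in> carrier R" for i
    using h by (simp add: h1_def)
  have P: "P m \<in> carrier R" for m
    unfolding P_def using h1 by (intro lprod_closed) auto
  define S where "S = insert \<one> (\<Union>m\<in>T. (\<lambda>k. under R (P (take k m)) (over R c (P (drop (Suc k) m)))) ` {..<length m})"
  have "finite S" "S \<subseteq> carrier R"
    using t by (simp_all add: S_def image_subset_iff UN_subset_iff closed c P)
  from finite_lower_bound[OF this] obtain d where d: "d \<in> carrier R" "\<forall>x\<in>S. d \<unlhd> x"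
    by (rule bexE)
  have "d \<unlhd> \<one>"
    using d by (simp add: S_def)
  let ?h = "\<lambda>i. if i \<in> N then d else h i"
  have le: "lprod R (map ?h m) \<unlhd> P m" for m
    unfolding P_def
  proof (rule lprod_mono)
    show "list_all2 (\<unlhd>) (map ?h m) (map h1 m)"
      using h \<open>d \<unlhd> \<one>\<close> by (simp add: list_all2_conv_all_nth h1_def)
  qed (use d(1) h h1 in auto)
  have cl: "lprod R (map ?h m) \<in> carrier R" for m
    using d(1) h by (intro lprod_closed) auto
  have "lprod R (map ?h m) \<unlhd> c" if m: "m \<in> T" and i: "\<exists>i\<in>set m. i \<in> N" for m
  proof -
    obtain k where k: "k < length m" "m ! k \<in> N"
      using i by (auto simp: in_set_conv_nth)
    have "map ?h m = map ?h (take k m) @ d # map ?h (drop (Suc k) m)"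
      using k by (subst id_take_nth_drop[OF k(1)]) simp
    also have "lprod R \<dots> = lprod R (map ?h (take k m)) \<otimes> (d \<otimes> lprod R (map ?h (drop (Suc k) m)))"
      using d(1) h by (subst lprod_append) auto
    finally have 1: "lprod R (map ?h m) = \<dots>" .
    have "\<dots> \<unlhd> P (take k m) \<otimes> (d \<otimes> P (drop (Suc k) m))"
      using d(1) cl P by (intro mult_mono le) auto
    also have "P (take k m) \<otimes> (d \<otimes> P (drop (Suc k) m)) = P (take k m) \<otimes> d \<otimes> P (drop (Suc k) m)"
      using d(1) P by (simp add: m_assoc)
    finally have 2: "lprod R (map ?h m) \<unlhd> P (take k m) \<otimes> d \<otimes> P (drop (Suc k) m)"
      using 1 by simp
    have "d \<unlhd> under R (P (take k m)) (over R c (P (drop (Suc k) m)))"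
      using m k d(2) by (auto simp: S_def)
    then have "P (take k m) \<otimes> d \<otimes> P (drop (Suc k) m) \<unlhd> c"
      using d(1) P c by (simp add: two_sided_iff)
    from trans[OF 2 this] show ?thesis
      using d(1) P c cl by simp
  qed
  then show ?thesis
    using d(1) \<open>d \<unlhd> \<one>\<close> by (intro bexI[of _ d]) simp_all
qed

end

definition cuts :: "('a, 'b) rl_scheme \<Rightarrow> ('a \<Rightarrow> 'a \<Rightarrow> bool) \<Rightarrow> 'a set \<Rightarrow> 'a set \<Rightarrow> 'a set set" where
  "cuts R r W B = {{x \<in> W. r (u \<otimes>\<^bsub>R\<^esub> x \<otimes>\<^bsub>R\<^esub> v) b} | u v b. u \<in> W \<and> v \<in> W \<and> b \<in> B}"

text \<open>
  The right-hand sides of the cuts are the elements to be embedded only, whereas the contexts \<open>u\<close> and \<open>v\<close>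
  range over all of \<open>W\<close>, which makes the family closed under translations.
\<close>

locale cut_frame = residuated_preorder R le + submonoid W R
  for R (structure) and le (infix \<open>\<unlhd>\<close> 50) and W +
  fixes B
  assumes B_subset: "B \<subseteq> W"
begin

abbreviation \<M> where "\<M> \<equiv> R\<lparr>carrier := W\<rparr>"
abbreviation \<C> where "\<C> \<equiv> galois_algebra \<M> (cuts R le W B)"

lemma W_carrier: "x \<in> W \<Longrightarrow> x \<in> carrier R"
  using subset by blast

lemma B_W: "x \<in> B \<Longrightarrow> x \<in> W"
  using B_subset by blast

sublocale translation_closed \<M> "cuts R le W B"
proof (intro translation_closed.intro translation_closed_axioms.intro submonoid_is_monoid)
  show "monoid R"
    by (rule monoid_axioms)
  fix d x assume "d \<in> cuts R le W B" "x \<in> carrier \<M>"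
  then obtain u v b where "u \<in> W" "v \<in> W" "b \<in> B" "x \<in> W" and d: "d = {x \<in> W. u \<otimes> x \<otimes> v \<unlhd> b}"
    by (auto simp: cuts_def)
  then have "{y \<in> carrier \<M>. x \<otimes>\<^bsub>\<M>\<^esub> y \<in> d} = {y \<in> W. (u \<otimes> x) \<otimes> y \<otimes> v \<unlhd> b}"
    "{y \<in> carrier \<M>. y \<otimes>\<^bsub>\<M>\<^esub> x \<in> d} = {y \<in> W. u \<otimes> y \<otimes> (x \<otimes> v) \<unlhd> b}"
    by (auto simp: W_carrier m_assoc)
  then show "{y \<in> carrier \<M>. x \<otimes>\<^bsub>\<M>\<^esub> y \<in> d} \<in> cuts R le W B"
    "{y \<in> carrier \<M>. y \<otimes>\<^bsub>\<M>\<^esub> x \<in> d} \<in> cuts R le W B"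
    using \<open>u \<in> W\<close> \<open>v \<in> W\<close> \<open>b \<in> B\<close> \<open>x \<in> W\<close> by (auto simp: cuts_def)
qed

lemma closed_memI:
  assumes "galois_closed X" "x \<in> W"
    and "\<And>u v b. \<lbrakk>u \<in> W; v \<in> W; b \<in> B; \<And>y. y \<in> X \<Longrightarrow> u \<otimes> y \<otimes> v \<unlhd> b\<rbrakk> \<Longrightarrow> u \<otimes> x \<otimes> v \<unlhd> b"
  shows "x \<in> X"
proof (rule closed_mem[OF assms(1)])
  fix d assume "d \<in> cuts R le W B" "X \<subseteq> d"
  then obtain u v b where "u \<in> W" "v \<in> W" "b \<in> B" "d = {x \<in> W. u \<otimes> x \<otimes> v \<unlhd> b}"
    by (auto simp: cuts_def)
  then show "x \<in> d"
    using assms(2) assms(3)[of u v b] \<open>X \<subseteq> d\<close> by blast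
qed (use assms in auto)

lemma closed_down:
  assumes X: "galois_closed X" "y \<in> X" "x \<in> W" "x \<unlhd> y"
  shows "x \<in> X"
proof (rule closed_memI[OF X(1,3)])
  fix u v b assume uvb: "u \<in> W" "v \<in> W" "b \<in> B"
    and *: "\<And>y. y \<in> X \<Longrightarrow> u \<otimes> y \<otimes> v \<unlhd> b"
  have [simp]: "y \<in> carrier R" "x \<in> carrier R" "u \<in> carrier R" "v \<in> carrier R" "b \<in> carrier R"
    using galois_closedD[OF X(1,2)] X(3) uvb by (auto simp: W_carrier B_W)
  have "u \<otimes> x \<otimes> v \<unlhd> u \<otimes> y \<otimes> v"
    using X(4) by (simp add: mult_mono)
  from trans[OF this *[OF X(2)]] show "u \<otimes> x \<otimes> v \<unlhd> b"
    by simp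
qed

lemma cut_mem: "\<lbrakk>u \<in> W; v \<in> W; b \<in> B\<rbrakk> \<Longrightarrow> {x \<in> W. u \<otimes> x \<otimes> v \<unlhd> b} \<in> cuts R le W B"
  unfolding cuts_def by blast

lemma one_in_carrier: "\<one> \<in> carrier R"
  using residuated_lattice_axioms by (simp add: residuated_lattice_def monoid.one_closed)

lemma lprod_in_carrier: "set xs \<subseteq> carrier R \<Longrightarrow> lprod R xs \<in> carrier R"
  using residuated_lattice_axioms by (simp add: residuated_lattice_def monoid.lprod_closed)

lemma one_W: "\<one> \<in> W"
  using one_closed by simp

lemma principal_closed:
  assumes "b \<in> B" shows "galois_closed {x \<in> W. x \<unlhd> b}"
proof (rule galois_closedI)
  fix x assume "x \<in> carrier \<M>" and *: "\<And>d. \<lbrakk>d \<in> cuts R le W B; {x \<in> W. x \<unlhd> b} \<subseteq> d\<rbrakk> \<Longrightarrow> x \<in> d"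
  have "{x \<in> W. x \<unlhd> b} = {x \<in> W. \<one> \<otimes> x \<otimes> \<one> \<unlhd> b}"
    by (rule Collect_cong) (simp add: W_carrier cong: conj_cong)
  then have "{x \<in> W. x \<unlhd> b} \<in> cuts R le W B"
    using cut_mem[OF one_W one_W assms] by simp
  then show "x \<in> {x \<in> W. x \<unlhd> b}"
    using * by blast
qed auto

lemma principal_subset_iff:
  assumes "b \<in> B" "galois_closed Z" shows "{x \<in> W. x \<unlhd> b} \<subseteq> Z \<longleftrightarrow> b \<in> Z"
proof
  show "{x \<in> W. x \<unlhd> b} \<subseteq> Z \<Longrightarrow> b \<in> Z"
    using assms by (auto simp: B_W W_carrier)
  show "b \<in> Z \<Longrightarrow> {x \<in> W. x \<unlhd> b} \<subseteq> Z"
    using closed_down[OF assms(2)] by blast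
qed

text \<open>
  Each operation is respected because \<open>{x \<in> W. x \<unlhd> b}\<close> is both the cut of \<open>b\<close> with trivial context and the
  least closed set that contains \<open>b\<close>; the first fact computes meets and residuals, the second one computes unit,
  products and joins.
\<close>

lemma partial_hom_principal: "partial_hom R B \<C> (\<lambda>b. {x \<in> W. x \<unlhd> b})"
proof -
  let ?f = "\<lambda>b. {x \<in> W. x \<unlhd> b}"
  have sub: "?f b \<subseteq> carrier \<M>" for b
    by auto
  have one: "?f \<one> = \<one>\<^bsub>\<C>\<^esub>" if "\<one> \<in> B"
    unfolding galois_algebra_simps
  proof (rule closed_eqI[OF principal_closed[OF that] galois_closed_cl])
    fix Z assume "galois_closed Z"
    then show "?f \<one> \<subseteq> Z \<longleftrightarrow> cl {\<one>\<^bsub>\<M>\<^esub>} \<subseteq> Z"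
      using principal_subset_iff[OF that, of Z] one_closed by (simp add: cl_subset_iff)
  qed
  have two: "(x \<otimes> y \<in> B \<longrightarrow> ?f (x \<otimes> y) = ?f x \<otimes>\<^bsub>\<C>\<^esub> ?f y) \<and>
      (x \<^bold>\<and> y \<in> B \<longrightarrow> ?f (x \<^bold>\<and> y) = ?f x \<^bold>\<and>\<^bsub>\<C>\<^esub> ?f y) \<and>
      (x \<^bold>\<or> y \<in> B \<longrightarrow> ?f (x \<^bold>\<or> y) = ?f x \<^bold>\<or>\<^bsub>\<C>\<^esub> ?f y) \<and>
      (under R x y \<in> B \<longrightarrow> ?f (under R x y) = under \<C> (?f x) (?f y)) \<and>
      (over R x y \<in> B \<longrightarrow> ?f (over R x y) = over \<C> (?f x) (?f y))"
    if x: "x \<in> B" and y: "y \<in> B" for x y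
  proof (intro conjI impI)
    have W [simp]: "x \<in> W" "y \<in> W" and R [simp]: "x \<in> carrier R" "y \<in> carrier R"
      using x y by (auto simp: B_W W_carrier)
    have mult_le: "p \<otimes> q \<unlhd> p' \<otimes> q'" if "p \<in> W" "q \<in> W" "p' \<in> W" "q' \<in> W" "p \<unlhd> p'" "q \<unlhd> q'" for p q p' q'
      using that by (simp add: mult_mono W_carrier)
    show "?f (x \<otimes> y) = ?f x \<otimes>\<^bsub>\<C>\<^esub> ?f y" if xy: "x \<otimes> y \<in> B"
      unfolding galois_algebra_simps
    proof (rule closed_eqI[OF principal_closed[OF that] galois_closed_cl])
      fix Z assume Z: "galois_closed Z"
      have "x \<otimes> y \<in> Z \<longleftrightarrow> (\<forall>p\<in>?f x. \<forall>q\<in>?f y. p \<otimes>\<^bsub>\<M>\<^esub> q \<in> Z)"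
      proof
        assume "x \<otimes> y \<in> Z"
        then show "\<forall>p\<in>?f x. \<forall>q\<in>?f y. p \<otimes>\<^bsub>\<M>\<^esub> q \<in> Z"
          using closed_down[OF Z, of "x \<otimes> y"] by (simp add: mult_le)
      qed simp
      then show "?f (x \<otimes> y) \<subseteq> Z \<longleftrightarrow> cmult (?f x) (?f y) \<subseteq> Z"
        unfolding principal_subset_iff[OF xy Z] cmult_subset_iff[OF sub sub Z] .
    qed
    show "?f (x \<^bold>\<and> y) = ?f x \<^bold>\<and>\<^bsub>\<C>\<^esub> ?f y"
      by (auto simp: le_meet_iff W_carrier)
    show "?f (x \<^bold>\<or> y) = ?f x \<^bold>\<or>\<^bsub>\<C>\<^esub> ?f y" if xy: "x \<^bold>\<or> y \<in> B"
      unfolding galois_algebra_simps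
    proof (rule closed_eqI[OF principal_closed[OF that] galois_closed_cl])
      fix Z assume Z: "galois_closed Z"
      have "x \<^bold>\<or> y \<in> Z \<longleftrightarrow> x \<in> Z \<and> y \<in> Z"
      proof
        assume "x \<^bold>\<or> y \<in> Z"
        then show "x \<in> Z \<and> y \<in> Z"
          using closed_down[OF Z, of "x \<^bold>\<or> y"] by (simp add: le_of_order vee_ge1 vee_ge2 vee_closed)
      next
        assume xy_Z: "x \<in> Z \<and> y \<in> Z"
        show "x \<^bold>\<or> y \<in> Z"
        proof (rule closed_memI[OF Z B_W[OF xy]])
          fix u v b assume "u \<in> W" "v \<in> W" "b \<in> B" "\<And>y. y \<in> Z \<Longrightarrow> u \<otimes> y \<otimes> v \<unlhd> b"
          moreover from this xy_Z have "u \<otimes> x \<otimes> v \<unlhd> b" "u \<otimes> y \<otimes> v \<unlhd> b"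
            by blast+
          ultimately show "u \<otimes> (x \<^bold>\<or> y) \<otimes> v \<unlhd> b"
            by (simp add: two_sided_iff join_le_iff W_carrier B_W closed)
        qed
      qed
      then show "?f (x \<^bold>\<or> y) \<subseteq> Z \<longleftrightarrow> cl (?f x \<union> ?f y) \<subseteq> Z"
        using principal_subset_iff[OF xy Z] principal_subset_iff[OF x Z] principal_subset_iff[OF y Z]
          cl_subset_iff[OF _ Z, of "?f x \<union> ?f y"] by auto
    qed
    have "w \<unlhd> under R x y \<longleftrightarrow> (\<forall>p\<in>?f x. p \<otimes> w \<unlhd> y)" if "w \<in> W" for w
    proof
      assume "w \<unlhd> under R x y"
      then have *: "x \<otimes> w \<unlhd> y"
        using that by (simp add: under_iff W_carrier)
      show "\<forall>p\<in>?f x. p \<otimes> w \<unlhd> y"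
        using that trans[OF mult_le *] by (auto simp: W_carrier)
    qed (use that in \<open>simp add: under_iff W_carrier\<close>)
    then show "?f (under R x y) = under \<C> (?f x) (?f y)"
      by auto
    have "w \<unlhd> over R x y \<longleftrightarrow> (\<forall>p\<in>?f y. w \<otimes> p \<unlhd> x)" if "w \<in> W" for w
    proof
      assume "w \<unlhd> over R x y"
      then have *: "w \<otimes> y \<unlhd> x"
        using that by (simp add: over_iff W_carrier)
      show "\<forall>p\<in>?f y. w \<otimes> p \<unlhd> x"
        using that trans[OF mult_le *] by (auto simp: W_carrier)
    qed (use that in \<open>simp add: over_iff W_carrier\<close>)
    then show "?f (over R x y) = over \<C> (?f x) (?f y)"
      by auto
  qed
  have img: "?f ` B \<subseteq> carrier \<C>"
    unfolding carrier_galois_algebra using principal_closed by auto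
  show ?thesis
    unfolding partial_hom_def
    by (intro conjI[OF img] conjI[OF impI[OF one]] ballI) (assumption | rule two)+
qed

text \<open>
  Let \<open>X\<close> and \<open>Y\<close> be incomparable closed sets, and \<open>x\<close>, \<open>y\<close> elements of one but not of the other. Closed
  sets are down-sets, so \<open>x\<close> and \<open>y\<close> are incomparable. Their join is then a top element, and any closed
  set that contains both \<open>x\<close> and \<open>y\<close> is all of \<open>W\<close>. Dually, \<open>X\<close> and \<open>Y\<close> lie in principal down-sets of
  \<open>A\<close> whose generators \<open>c'\<close> and \<open>c\<close> are incomparable, and the meet of these is a bottom element.
\<close>

lemma unilinear_galois_algebra:
  assumes "unilinear_preorder R le"
  shows "unilinear \<C>"
  unfolding unilinear_def galois_algebra_le galois_algebra_simps(4,5) carrier_galois_algebra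
proof (intro ballI, unfold mem_Collect_eq)
  interpret unilinear_preorder R le
    by (rule assms)
  fix X Y Z V
  assume X: "galois_closed X" and Y: "galois_closed Y" and Z: "galois_closed Z" and V: "galois_closed V"
  show "X \<subseteq> Y \<or> Y \<subseteq> X \<or> X \<inter> Y \<subseteq> V \<and> Z \<subseteq> cl (X \<union> Y)"
  proof (rule ccontr)
    assume neg: "\<not> ?thesis"
    then obtain x y where x: "x \<in> X" "x \<notin> Y" and y: "y \<in> Y" "y \<notin> X"
      by blast
    then have W: "x \<in> W" "y \<in> W"
      using galois_closedD X Y by auto
    note [simp] = W W_carrier[OF W(1)] W_carrier[OF W(2)]
    have "\<not> x \<unlhd> y" "\<not> y \<unlhd> x"
      using closed_down X Y x y W by blast+
    then have top: "z \<unlhd> x \<^bold>\<or> y" if "z \<in> carrier R" for z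
      using unilin[of x y z x] that by simp
    have "Z \<subseteq> cl (X \<union> Y)"
    proof
      fix z assume z: "z \<in> Z"
      then have [simp]: "z \<in> W" "z \<in> carrier R"
        using galois_closedD[OF Z] W_carrier by auto
      show "z \<in> cl (X \<union> Y)"
      proof (rule closed_memI[OF galois_closed_cl])
        fix u v b assume uvb: "u \<in> W" "v \<in> W" "b \<in> B"
          and *: "\<And>y. y \<in> cl (X \<union> Y) \<Longrightarrow> u \<otimes> y \<otimes> v \<unlhd> b"
        have "X \<union> Y \<subseteq> cl (X \<union> Y)"
          using galois_closedD[OF X] galois_closedD[OF Y] by (intro subset_cl) blast
        then have "u \<otimes> x \<otimes> v \<unlhd> b" "u \<otimes> y \<otimes> v \<unlhd> b"
          using x y * by blast+
        then have "x \<^bold>\<or> y \<unlhd> under R u (over R b v)"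
          using uvb by (simp add: two_sided_iff join_le_iff W_carrier B_W closed)
        then have "z \<unlhd> under R u (over R b v)"
          using trans[OF top] uvb by (simp add: W_carrier B_W closed)
        then show "u \<otimes> z \<otimes> v \<unlhd> b"
          using uvb by (simp add: two_sided_iff W_carrier B_W)
      qed simp
    qed
    moreover have "X \<inter> Y \<subseteq> V"
    proof
      have separate: "\<exists>c\<in>carrier R. \<not> p \<unlhd> c \<and> (\<forall>q\<in>Q. q \<unlhd> c)" if Q: "galois_closed Q" "p \<in> W" "p \<notin> Q" for p Q
      proof (rule ccontr)
        assume no: "\<not> ?thesis"
        have "p \<in> Q"
        proof (rule closed_memI[OF Q(1,2)])
          fix u v b assume uvb: "u \<in> W" "v \<in> W" "b \<in> B"
            and *: "\<And>y. y \<in> Q \<Longrightarrow> u \<otimes> y \<otimes> v \<unlhd> b"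
          have iff: "u \<otimes> y \<otimes> v \<unlhd> b \<longleftrightarrow> y \<unlhd> under R u (over R b v)" if "y \<in> W" for y
            using uvb that by (simp add: two_sided_iff W_carrier B_W)
          have "\<forall>q\<in>Q. q \<unlhd> under R u (over R b v)"
            using * iff galois_closedD[OF Q(1)] by simp
          moreover have "under R u (over R b v) \<in> carrier R"
            using uvb by (simp add: W_carrier B_W closed)
          ultimately have "p \<unlhd> under R u (over R b v)"
            using no by blast
          then show "u \<otimes> p \<otimes> v \<unlhd> b"
            using iff[OF Q(2)] by simp
        qed
        then show False
          using Q by simp
      qed
      obtain c where c: "c \<in> carrier R" "\<not> x \<unlhd> c" "\<forall>q\<in>Y. q \<unlhd> c"
        using separate[OF Y W(1) x(2)] by blast
      obtain c' where c': "c' \<in> carrier R" "\<not> y \<unlhd> c'" "\<forall>q\<in>X. q \<unlhd> c'"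
        using separate[OF X W(2) y(2)] by blast
      have "\<not> c \<unlhd> c'" "\<not> c' \<unlhd> c"
        using trans[of y c c'] trans[of x c' c] c c' x y by auto
      then have bot: "c \<^bold>\<and> c' \<unlhd> z" if "z \<in> carrier R" for z
        using unilin[of c c' c z] that c c' by simp
      fix p assume p: "p \<in> X \<inter> Y"
      then have [simp]: "p \<in> W" "p \<in> carrier R"
        using galois_closedD[OF X] W_carrier by auto
      have "p \<unlhd> c \<^bold>\<and> c'"
        using p c c' by (simp add: le_meet_iff)
      then have least: "p \<unlhd> z" if "z \<in> carrier R" for z
        using trans[OF _ bot[OF that]] c c' that by (simp add: closed)
      show "p \<in> V"
      proof (rule closed_memI[OF V])
        fix u v b assume "u \<in> W" "v \<in> W" "b \<in> B"
        then show "u \<otimes> p \<otimes> v \<unlhd> b"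
          by (simp add: two_sided_iff W_carrier B_W closed least)
      qed simp
    qed
    ultimately show False
      using neg by blast
  qed
qed

text \<open>
  Let a product of elements of the closed sets \<open>X i\<close> come from a monomial of \<open>s\<close>. For a cut that contains
  the value \<open>Z\<close> of \<open>t\<close>, assign to each variable the join of the finitely many elements chosen for it. The
  product is below the value of \<open>s\<close>, which equals the value of \<open>t\<close>, and the monomials of the latter are
  joins of products that belong to \<open>Z\<close>. Variables for which no element was chosen get a small
  value that depends on the cut, see \<open>monomials_small_value\<close>.
\<close>

lemma galois_algebra_satisfies:
  assumes st: "s \<in> join_mult_one_terms" "t \<in> join_mult_one_terms"
    and eq: "\<And>v. range v \<subseteq> carrier R \<Longrightarrow> eval R v s = eval R v t"
    and X: "range X \<subseteq> carrier \<C>"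
  shows "eval \<C> X s \<subseteq> eval \<C> X t"
proof -
  interpret C: residuated_lattice \<C>
    by (rule residuated_lattice_galois_algebra)
  have X_closed: "galois_closed (X i)" for i
    using X unfolding carrier_galois_algebra by blast
  have X_W: "x \<in> W" if "x \<in> X i" for x i
    using galois_closedD[OF X_closed that] by simp
  define Z where "Z = eval \<C> X t"
  have Z_carrier: "Z \<in> carrier \<C>"
    unfolding Z_def using X by (rule C.eval_closed)
  then have Z: "galois_closed Z"
    unfolding carrier_galois_algebra by blast
  have lprod_M: "lprod \<M> xs = lprod R xs" for xs
    by (induction xs) auto
  have subset_iff_products: "eval \<C> X r \<subseteq> Z \<longleftrightarrow>
      (\<forall>m\<in>monomials r. \<forall>xs. list_all2 (\<lambda>x i. x \<in> X i) xs m \<longrightarrow> lprod R xs \<in> Z)"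
    if "r \<in> join_mult_one_terms" for r
    using C.order.eval_le_iff_monomials[OF that X Z_carrier]
    unfolding galois_algebra_le lprod_galois_algebra_subset_iff[OF X_closed Z] lprod_M .
  have t_products: "lprod R xs \<in> Z" if "m \<in> monomials t" "list_all2 (\<lambda>x i. x \<in> X i) xs m" for m xs
    using subset_iff_products[OF st(2)] that unfolding Z_def[symmetric] by blast
  have "lprod R xs \<in> Z" if m: "m \<in> monomials s" and xs: "list_all2 (\<lambda>x i. x \<in> X i) xs m" for m xs
  proof -
    have xs_W: "set xs \<subseteq> W"
      using xs by (induction rule: list_all2_induct) (auto dest: X_W)
    have len: "length xs = length m"
      using xs by (rule list_all2_lengthD)
    show ?thesis
    proof (rule closed_memI[OF Z])
      have "lprod \<M> xs \<in> carrier \<M>"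
        using xs_W by (intro lprod_closed) simp
      then show "lprod R xs \<in> W"
        by (simp add: lprod_M)
      fix u v b assume uvb: "u \<in> W" "v \<in> W" "b \<in> B" and test: "\<And>y. y \<in> Z \<Longrightarrow> u \<otimes> y \<otimes> v \<unlhd> b"
      \<comment> \<open>the cut is the trace on \<open>W\<close> of the principal down-set of \<open>c\<close>\<close>
      define c where "c = under R u (over R b v)"
      have c: "c \<in> carrier R"
        using uvb by (simp add: c_def W_carrier B_W closed)
      have c_iff: "u \<otimes> y \<otimes> v \<unlhd> b \<longleftrightarrow> y \<unlhd> c" if "y \<in> W" for y
        unfolding c_def using that uvb by (simp add: two_sided_iff W_carrier B_W)
      have Z_c: "y \<unlhd> c" if "y \<in> Z" for y
        using test[OF that] c_iff galois_closedD[OF Z that] by simp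
      \<comment> \<open>the elements chosen for variable \<open>i\<close>\<close>
      define F where "F i = {xs ! j | j. j < length m \<and> m ! j = i}" for i
      have F_X: "F i \<subseteq> X i" for i
        using xs by (auto simp: F_def list_all2_conv_all_nth)
      then have F_R: "F i \<subseteq> carrier R" for i
        using X_W W_carrier by blast
      have F_fin: "finite (F i)" for i
        by (simp add: F_def)
      have "\<exists>g. g \<in> carrier R \<and> (F i \<noteq> {} \<longrightarrow> (\<forall>x\<in>F i. x \<unlhd> g) \<and>
          (\<forall>z\<in>carrier R. (\<forall>x\<in>F i. x \<unlhd> z) \<longrightarrow> g \<unlhd> z))" for i
        using finite_lub[OF F_fin _ F_R, of i] one_in_carrier by blast
      then obtain h where h_all: "\<And>i. h i \<in> carrier R \<and> (F i \<noteq> {} \<longrightarrow> (\<forall>x\<in>F i. x \<unlhd> h i) \<and>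
          (\<forall>z\<in>carrier R. (\<forall>x\<in>F i. x \<unlhd> z) \<longrightarrow> h i \<unlhd> z))"
        by moura
      have h: "h i \<in> carrier R" for i
        using h_all by blast
      have h_ub: "x \<unlhd> h i" if "x \<in> F i" for i x
        using h_all[of i] that by blast
      have h_lub: "h i \<unlhd> z" if "F i \<noteq> {}" "z \<in> carrier R" "\<And>x. x \<in> F i \<Longrightarrow> x \<unlhd> z" for i z
        using h_all[of i] that by blast
      define N where "N = {i. F i = {}}"
      from monomials_small_value[where h = h, OF finite_monomials c h, of t N]
      obtain d where d: "d \<in> carrier R" "\<forall>m\<in>monomials t. (\<exists>i\<in>set m. i \<in> N) \<longrightarrow>
          lprod R (map (\<lambda>i. if i \<in> N then d else h i) m) \<unlhd> c"
        by (elim bexE conjE)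
      define val where "val i = (if i \<in> N then d else h i)" for i
      have val: "val i \<in> carrier R" for i
        using d(1) h by (simp add: val_def)
      then have val_range: "range val \<subseteq> carrier R"
        by blast
      have "lprod R (map val m') \<unlhd> c" if m': "m' \<in> monomials t" for m'
      proof (cases "\<exists>i\<in>set m'. i \<in> N")
        case True
        then show ?thesis
          using d(2)[rule_format, OF m'] unfolding val_def by simp
      next
        case False
        show ?thesis
        proof (rule lprod_lub_le[of m' F val, OF _ _ _ c])
          fix i z assume i: "i \<in> set m'" and z: "z \<in> carrier R" "\<And>x. x \<in> F i \<Longrightarrow> x \<unlhd> z"
          then have "F i \<noteq> {}" "val i = h i"
            using False by (auto simp: N_def val_def)
          then show "val i \<unlhd> z"
            using h_lub[OF _ z] by simp
        next
          fix ys assume "list_all2 (\<lambda>x i. x \<in> F i) ys m'"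
          then have "list_all2 (\<lambda>x i. x \<in> X i) ys m'"
            by (rule list_all2_mono) (use F_X in blast)
          then show "lprod R ys \<unlhd> c"
            by (intro Z_c t_products[OF m'])
        qed (simp add: F_R val)
      qed
      then have "eval R val t \<unlhd> c"
        unfolding eval_le_iff_monomials[OF st(2) val_range c] by (rule ballI)
      then have "eval R val s \<unlhd> c"
        using eq[OF val_range] by simp
      then have m_c: "lprod R (map val m) \<unlhd> c"
        using eval_le_iff_monomials[OF st(1) val_range c] m by blast
      have "list_all2 (\<unlhd>) xs (map val m)"
        unfolding list_all2_conv_all_nth
      proof (intro conjI allI impI)
        fix j assume "j < length xs"
        then have "xs ! j \<in> F (m ! j)"
          using len by (auto simp: F_def)
        then have "xs ! j \<unlhd> h (m ! j)" "m ! j \<notin> N"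
          using h_ub by (auto simp: N_def)
        then show "xs ! j \<unlhd> map val m ! j"
          using \<open>j < length xs\<close> len by (simp add: val_def)
      qed (simp add: len)
      then have xs_val: "lprod R xs \<unlhd> lprod R (map val m)"
        by (rule lprod_mono) (use xs_W W_carrier val in auto)
      have "lprod R xs \<unlhd> c"
        using trans[OF xs_val m_c] c val lprod_in_carrier xs_W subset by (simp add: image_subset_iff)
      then show "u \<otimes> lprod R xs \<otimes> v \<unlhd> b"
        using c_iff[OF \<open>lprod R xs \<in> W\<close>] by simp
    qed
  qed
  then show ?thesis
    using subset_iff_products[OF st(1)] by (simp add: Z_def)
qed

end

section \<open>Eventual periodicity of step closed sets of exponent vectors\<close>

text \<open>
  Raising an exponent that is at least \<open>m\<close> by a multiple of \<open>d\<close>. This is what the knotted identities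
  allow: the powers with these exponents are related in a fixed direction.
\<close>

definition step_le :: "nat \<Rightarrow> nat \<Rightarrow> nat \<Rightarrow> nat \<Rightarrow> bool" where
  "step_le m d a a' \<longleftrightarrow> a = a' \<or> (m \<le> a \<and> (\<exists>j. a' = a + j * d))"

text \<open>
  The equivalence that identifies numbers from \<open>N\<close> on that are congruent modulo \<open>d\<close>; \<open>trunc\<close> picks
  representatives below \<open>N + d\<close>.
\<close>

definition near :: "nat \<Rightarrow> nat \<Rightarrow> nat \<Rightarrow> nat \<Rightarrow> bool" where
  "near N d a a' \<longleftrightarrow> a = a' \<or> (N \<le> a \<and> N \<le> a' \<and> a mod d = a' mod d)"

definition trunc :: "nat \<Rightarrow> nat \<Rightarrow> nat \<Rightarrow> nat" where
  "trunc N d a = (if a < N then a else N + (a - N) mod d)"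

lemma near_trunc: "near N d a (trunc N d a)"
proof (cases "a < N")
  case False
  then have "(N + (a - N) mod d) mod d = a mod d"
    by (metis le_add_diff_inverse linorder_not_less mod_add_right_eq)
  then show ?thesis
    using False by (simp add: near_def trunc_def)
qed (simp add: near_def trunc_def)

lemma trunc_less: "d > 0 \<Longrightarrow> trunc N d a < N + d"
  by (simp add: trunc_def)

lemma step_le_trunc: "m \<le> N \<Longrightarrow> step_le m d (trunc N d a) a"
proof (cases "a < N")
  case False
  assume "m \<le> N"
  have "a = N + (a - N) mod d + ((a - N) div d) * d"
    using False by (simp add: mod_div_mult_eq)
  then show ?thesis
    using False \<open>m \<le> N\<close> unfolding step_le_def trunc_def by (metis trans_le_add1)
qed (simp add: step_le_def trunc_def)

lemma near_sym: "near N d a a' \<longleftrightarrow> near N d a' a"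
  by (auto simp: near_def)

lemma near_refl: "near N d a a"
  by (simp add: near_def)

lemma near_antimono: "\<lbrakk>near N d a a'; N' \<le> N\<rbrakk> \<Longrightarrow> near N' d a a'"
  by (auto simp: near_def)

lemma mod_diff_cong_nat:
  assumes "a mod d = a' mod d" "m \<le> a" "m \<le> a'"
  shows "(a' - m) mod d = (a - m) mod (d::nat)"
proof (cases "a \<le> a'")
  case True
  then show ?thesis
    using assms mod_eq_dvd_iff_nat[of a a' d] mod_eq_dvd_iff_nat[of "a - m" "a' - m" d] by simp
next
  case False
  then show ?thesis
    using assms mod_eq_dvd_iff_nat[of a' a d] mod_eq_dvd_iff_nat[of "a' - m" "a - m" d] by simp
qed

lemma bounded_nat_family: "finite I \<Longrightarrow> \<exists>b::nat. \<forall>i\<in>I. f i \<le> b"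
  by (intro exI[of _ "sum f I"]) (auto intro: member_le_sum)

text \<open>
  A form of Dickson's lemma. By induction on the length, each section of \<open>P\<close> at a first coordinate has a
  threshold, but these sections are infinitely many. Within a residue class they increase with the first
  coordinate, and their union \<open>U\<close> is itself step closed and thus has a threshold. Beyond it, only the finitely many
  vectors with small entries matter, and each of these enters at some stage. Hence the sections become constant, and
  finitely many thresholds remain.
\<close>

lemma step_closed_threshold:
  assumes "d > 0"
    and "\<And>es es'. \<lbrakk>P es; list_all2 (step_le m d) es es'\<rbrakk> \<Longrightarrow> P es'"
  shows "\<exists>N. \<forall>es es'. length es = K \<longrightarrow> list_all2 (near N d) es es' \<longrightarrow> P es \<longrightarrow> P es'"
  using assms(2)
proof (induction K arbitrary: P)
  case 0
  then show ?case
    by auto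
next
  case (Suc K)
  have step_refl: "step_le m d a a" for a
    by (simp add: step_le_def)
  then have refl: "list_all2 (step_le m d) es es" for es
    by (simp add: list_all2_conv_all_nth)
  have "\<exists>N. \<forall>es es'. length es = K \<longrightarrow> list_all2 (near N d) es es' \<longrightarrow> P (a # es) \<longrightarrow> P (a # es')" for a
  proof (rule Suc.IH)
    fix es es' assume "P (a # es)" "list_all2 (step_le m d) es es'"
    then show "P (a # es')"
      using Suc.prems[of "a # es" "a # es'"] by (simp add: step_refl)
  qed
  then have "\<forall>a. \<exists>N. \<forall>es es'. length es = K \<longrightarrow> list_all2 (near N d) es es' \<longrightarrow> P (a # es) \<longrightarrow> P (a # es')"
    by (rule allI)
  from choice[OF this] obtain NA where NA: "\<forall>a es es'. length es = K \<longrightarrow>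
      list_all2 (near (NA a) d) es es' \<longrightarrow> P (a # es) \<longrightarrow> P (a # es')"
    by (rule exE)
  define U where "U r es \<longleftrightarrow> (\<exists>j. P ((m + r + j * d) # es))" for r es
  have "\<forall>r. \<exists>N. \<forall>es es'. length es = K \<longrightarrow> list_all2 (near N d) es es' \<longrightarrow> U r es \<longrightarrow> U r es'"
  proof (rule allI, rule Suc.IH)
    fix r es es' assume "U r es" and st: "list_all2 (step_le m d) es es'"
    then obtain j where "P ((m + r + j * d) # es)"
      by (auto simp: U_def)
    then have "P ((m + r + j * d) # es')"
      by (rule Suc.prems) (simp add: step_refl st)
    then show "U r es'"
      by (auto simp: U_def)
  qed
  from choice[OF this] obtain NU where NU: "\<forall>r es es'. length es = K \<longrightarrow>
      list_all2 (near (NU r) d) es es' \<longrightarrow> U r es \<longrightarrow> U r es'"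
    by (rule exE)
  have "\<forall>r. \<exists>J. \<forall>es. length es = K \<longrightarrow> U r es \<longrightarrow> P ((m + r + J * d) # es)"
  proof
    fix r
    define N where "N = max (NU r) m"
    define S where "S = {es. set es \<subseteq> {..<N + d} \<and> length es = K}"
    have "finite S"
      unfolding S_def by (intro finite_lists_length_eq) simp
    \<comment> \<open>the stage at which \<open>es\<close> enters the increasing sequence of sections\<close>
    define j where "j es = (SOME j. P ((m + r + j * d) # es))" for es
    from bounded_nat_family[OF \<open>finite S\<close>, of j] obtain J where J: "\<forall>es\<in>S. j es \<le> J"
      by (rule exE)
    have "P ((m + r + J * d) # es)" if len: "length es = K" and U: "U r es" for es
    proof -
      define es0 where "es0 = map (trunc N d) es"
      have "list_all2 (near N d) es es0"
        by (simp add: es0_def list_all2_conv_all_nth near_trunc)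
      then have "list_all2 (near (NU r) d) es es0"
        by (rule list_all2_mono) (auto simp: near_def N_def)
      then have "U r es0"
        using NU[rule_format, OF len _ U] by blast
      then have "P ((m + r + j es0 * d) # es0)"
        unfolding U_def j_def by (rule someI_ex)
      moreover have "es0 \<in> S"
        using len trunc_less[OF assms(1)] by (auto simp: es0_def S_def)
      then have "m + r + J * d = m + r + j es0 * d + (J - j es0) * d"
        using bspec[OF J, of es0] by (simp add: add.assoc flip: add_mult_distrib)
      then have "step_le m d (m + r + j es0 * d) (m + r + J * d)"
        unfolding step_le_def by (intro disjI2 conjI exI[of _ "J - j es0"]) simp_all
      moreover have "list_all2 (step_le m d) es0 es"
        by (simp add: es0_def list_all2_conv_all_nth step_le_trunc N_def)
      ultimately show ?thesis
        using Suc.prems[of "(m + r + j es0 * d) # es0" "(m + r + J * d) # es"] by simp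
    qed
    then show "\<exists>J. \<forall>es. length es = K \<longrightarrow> U r es \<longrightarrow> P ((m + r + J * d) # es)"
      by (intro exI[of _ J] allI impI)
  qed
  from choice[OF this] obtain J where J: "\<forall>r es. length es = K \<longrightarrow> U r es \<longrightarrow> P ((m + r + J r * d) # es)"
    by (rule exE)
  obtain J0 where J0: "\<And>r. r < d \<Longrightarrow> J r \<le> J0"
    using bounded_nat_family[of "{..<d}" J] by auto
  define L where "L = m + d + J0 * d"
  obtain N1 where N1: "\<And>a. a < L \<Longrightarrow> NA a \<le> N1"
    using bounded_nat_family[of "{..<L}" NA] by auto
  obtain N2 where N2: "\<And>r. r < d \<Longrightarrow> NU r \<le> N2"
    using bounded_nat_family[of "{..<d}" NU] by auto
  define N where "N = L + N1 + N2"
  have "P ys'" if len: "length ys = Suc K" and near: "list_all2 (near N d) ys ys'" and P: "P ys" for ys ys'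
  proof -
    obtain a es where ys: "ys = a # es" "length es = K"
      using len by (cases ys) auto
    then obtain a' es' where ys': "ys' = a' # es'" and na: "near N d a a'" and nes: "list_all2 (near N d) es es'"
      using near by (auto simp: list_all2_Cons1)
    show ?thesis
    proof (cases "a < L")
      case True
      then have "a' = a"
        using na by (auto simp: near_def N_def)
      have "list_all2 (near (NA a) d) es es'"
        using nes by (rule list_all2_mono) (use N1[OF True] in \<open>auto simp: near_def N_def\<close>)
      then show ?thesis
        using NA[rule_format, OF ys(2)] P unfolding ys(1) ys' \<open>a' = a\<close> by simp
    next
      case False
      then have a: "L \<le> a" "L \<le> a'" "a mod d = a' mod d"
        using na by (auto simp: near_def N_def)
      define r where "r = (a - m) mod d"
      have r: "r < d" "(a' - m) mod d = r"
      proof -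
        show "r < d"
          using assms(1) by (simp add: r_def)
        have "m \<le> a" "m \<le> a'"
          using a by (simp_all add: L_def)
        then show "(a' - m) mod d = r"
          using mod_diff_cong_nat[OF a(3)] by (simp add: r_def)
      qed
      have decomp: "\<exists>i. x = m + r + J r * d + i * d" if "L \<le> x" "(x - m) mod d = r" for x
      proof -
        define q where "q = (x - m) div d"
        have "x - m = q * d + r"
          using div_mult_mod_eq[of "x - m" d] that(2) by (simp add: q_def)
        then have x: "x = m + r + q * d"
          using that(1) by (simp add: L_def)
        have "J r * d \<le> J0 * d"
          using J0[OF r(1)] by (rule mult_le_mono1)
        then have "J r * d \<le> x - m"
          using that(1) unfolding L_def by linarith
        then have "J r \<le> q"
          using assms(1) by (simp add: less_eq_div_iff_mult_less_eq q_def)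
        then have "q = J r + (q - J r)"
          by simp
        then have "q * d = J r * d + (q - J r) * d"
          by (metis add_mult_distrib)
        with x have "x = m + r + J r * d + (q - J r) * d"
          by linarith
        then show ?thesis ..
      qed
      obtain i where "a = m + r + J r * d + i * d"
        using decomp[of a] a by (auto simp: r_def)
      then have "a = m + r + (J r + i) * d"
        by (simp add: add_mult_distrib)
      then have "U r es"
        using P ys unfolding U_def by blast
      moreover have "list_all2 (near (NU r) d) es es'"
        using nes by (rule list_all2_mono) (use N2[OF r(1)] in \<open>auto simp: near_def N_def\<close>)
      ultimately have "U r es'"
        using NU[rule_format, OF ys(2)] by simp
      moreover have "length es' = K"
        using nes ys by (auto dest: list_all2_lengthD)
      ultimately have "P ((m + r + J r * d) # es')"
        using J by simp
      moreover obtain i' where "a' = m + r + J r * d + i' * d"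
        using decomp[of a'] a r by auto
      then have "step_le m d (m + r + J r * d) a'"
        unfolding step_le_def by auto
      ultimately show ?thesis
        using Suc.prems[of "(m + r + J r * d) # es'" "a' # es'"] unfolding ys' by (simp add: refl)
    qed
  qed
  then show ?case
    by (intro exI[of _ N] allI impI)
qed

section \<open>Block normal forms under weak commutativity\<close>

context monoid
begin

primrec interleave :: "'a \<Rightarrow> (nat \<Rightarrow> 'a) \<Rightarrow> (nat \<Rightarrow> nat) \<Rightarrow> nat \<Rightarrow> 'a" where
  "interleave x y a 0 = x [^] a 0"
| "interleave x y a (Suc n) = interleave x y a n \<otimes> y (Suc n) \<otimes> x [^] a (Suc n)"

lemma interleave_closed [simp]:
  "\<lbrakk>x \<in> carrier G; range y \<subseteq> carrier G\<rbrakk> \<Longrightarrow> interleave x y a n \<in> carrier G"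
  by (induction n) (auto simp: range_subsetD)

text \<open>
  Powers of \<open>x\<close> that follow the exponents are absorbed into the arbitrary elements \<open>y i\<close>, so that a weak
  commutativity identity applies on top of any larger exponents.
\<close>

lemma interleave_shift:
  assumes [simp]: "x \<in> carrier G" and y: "range y \<subseteq> carrier G"
  shows "interleave x (\<lambda>i. x [^] g (i - 1) \<otimes> y i) a n \<otimes> x [^] g n = interleave x y (\<lambda>i. a i + g i) n"
proof (induction n)
  case 0
  then show ?case
    by (simp add: nat_pow_mult)
next
  case (Suc n)
  define I where "I = interleave x (\<lambda>i. x [^] g (i - 1) \<otimes> y i) a"
  have [simp]: "y i \<in> carrier G" for i
    using y by auto
  have [simp]: "I n \<in> carrier G"
    unfolding I_def by (intro interleave_closed) auto
  have "I (Suc n) = I n \<otimes> (x [^] g n \<otimes> y (Suc n)) \<otimes> x [^] a (Suc n)"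
    by (simp add: I_def)
  then have "I (Suc n) \<otimes> x [^] g (Suc n) =
      (I n \<otimes> x [^] g n) \<otimes> y (Suc n) \<otimes> (x [^] a (Suc n) \<otimes> x [^] g (Suc n))"
    by (simp add: m_assoc)
  then show ?case
    unfolding I_def Suc.IH by (simp add: nat_pow_mult)
qed

lemma interleave_cong: "(\<And>i. i \<le> n \<Longrightarrow> a i = a' i) \<Longrightarrow> interleave x y a n = interleave x y a' n"
  by (induction n) auto

text \<open>
  As long as all exponents are positive, the identity changes them by \<open>a i - 1\<close>. Where \<open>a\<close> vanishes, the
  exponent drops by one each time, so eventually some exponent is zero.
\<close>

lemma interleave_vanish:
  assumes x [simp]: "x \<in> carrier G" and y: "range y \<subseteq> carrier G"
    and wc: "\<And>y. range y \<subseteq> carrier G \<Longrightarrow> interleave x y (\<lambda>_. 1) n = interleave x y a n"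
    and i0: "i0 \<le> n" "a i0 = 0"
  shows "\<exists>g. (\<exists>i\<le>n. g i = 0) \<and> interleave x y f n = interleave x y g n"
proof (induction "f i0" arbitrary: f)
  case 0
  then show ?case
    using i0 by metis
next
  case (Suc k)
  show ?case
  proof (cases "\<exists>i\<le>n. f i = 0")
    case False
    define e where "e i = f i - 1" for i
    define f' where "f' i = a i + e i" for i
    have "k = f' i0"
      using Suc.hyps(2) i0 by (simp add: f'_def e_def)
    have z: "range (\<lambda>i. x [^] e (i - 1) \<otimes> y i) \<subseteq> carrier G"
      using y by auto
    have "interleave x y f n = interleave x y (\<lambda>i. 1 + e i) n"
      using False by (intro interleave_cong) (simp add: e_def)
    also have "\<dots> = interleave x (\<lambda>i. x [^] e (i - 1) \<otimes> y i) (\<lambda>_. 1) n \<otimes> x [^] e n"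
      by (rule interleave_shift[OF x y, symmetric])
    also have "\<dots> = interleave x (\<lambda>i. x [^] e (i - 1) \<otimes> y i) a n \<otimes> x [^] e n"
      using wc[OF z] by simp
    also have "\<dots> = interleave x y f' n"
      unfolding f'_def[abs_def] by (rule interleave_shift[OF x y])
    finally show ?thesis
      using Suc.hyps(1)[of f'] \<open>k = f' i0\<close> by simp
  qed blast
qed

definition block_prod :: "('a \<times> nat) list \<Rightarrow> 'a" where
  "block_prod ps = lprod G (map (\<lambda>(x, k). x [^] k) ps)"

lemma block_prod_simps [simp]:
  "block_prod [] = \<one>" "block_prod ((x, k) # ps) = x [^] k \<otimes> block_prod ps"
  by (simp_all add: block_prod_def)

lemma block_prod_closed [simp]: "fst ` set ps \<subseteq> carrier G \<Longrightarrow> block_prod ps \<in> carrier G"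
  by (induction ps) auto

lemma block_prod_append:
  "\<lbrakk>fst ` set ps \<subseteq> carrier G; fst ` set qs \<subseteq> carrier G\<rbrakk>
    \<Longrightarrow> block_prod (ps @ qs) = block_prod ps \<otimes> block_prod qs"
  by (induction ps) (auto simp: m_assoc)

end

text \<open>
  A sequence of blocks, given as pairs of a letter and an exponent, in which \<open>n + 1\<close> blocks of the letter
  \<open>x\<close> have been singled out; arbitrary sequences \<open>q i\<close> lie in between.
\<close>

primrec spread :: "'a \<Rightarrow> (nat \<Rightarrow> ('a \<times> nat) list) \<Rightarrow> (nat \<Rightarrow> nat) \<Rightarrow> nat \<Rightarrow> ('a \<times> nat) list" where
  "spread x q f 0 = q 0 @ [(x, f 0)]"
| "spread x q f (Suc n) = spread x q f n @ q (Suc n) @ [(x, f (Suc n))]"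

lemma length_spread: "length (spread x q f n) = length (spread x q g n)"
  by (induction n) auto

lemma fst_set_spread: "fst ` set (spread x q f n) = fst ` set (spread x q g n)"
  by (induction n) (auto simp: image_Un)

lemma fst_set_part_spread: "i \<le> n \<Longrightarrow> fst ` set (q i) \<subseteq> fst ` set (spread x q f n)"
  by (induction n) (auto simp: image_Un le_Suc_eq)

lemma spread_mem: "i \<le> n \<Longrightarrow> (x, f i) \<in> set (spread x q f n)"
  by (induction n) (auto simp: le_Suc_eq)

lemma spread_cong:
  "(\<And>i. i \<le> n \<Longrightarrow> q i = q' i \<and> f i = f' i) \<Longrightarrow> spread x q f n = spread x q' f' n"
  by (induction n) auto

lemma exists_spread:
  "n < length (filter (\<lambda>p. fst p = x) ps) \<Longrightarrow>
    \<exists>q f rest. ps = spread x q f n @ rest \<and>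
      length (filter (\<lambda>p. fst p = x) ps) = Suc n + length (filter (\<lambda>p. fst p = x) rest)"
proof (induction n)
  case 0
  then have "\<exists>p\<in>set ps. fst p = x"
    by (auto simp: filter_empty_conv)
  from split_list_first_prop[OF this] obtain ys p zs
    where "ps = ys @ p # zs" "fst p = x" "\<forall>p\<in>set ys. fst p \<noteq> x"
    by blast
  then show ?case
    by (intro exI[of _ "\<lambda>_. ys"] exI[of _ "\<lambda>_. snd p"] exI[of _ zs]) (auto simp: filter_empty_conv)
next
  case (Suc n)
  then obtain q f rest where ps: "ps = spread x q f n @ rest"
    and len: "length (filter (\<lambda>p. fst p = x) ps) = Suc n + length (filter (\<lambda>p. fst p = x) rest)"
    by auto
  then have "\<exists>p\<in>set rest. fst p = x"
    using Suc.prems by (auto simp: filter_empty_conv)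
  from split_list_first_prop[OF this] obtain ys p zs
    where rest: "rest = ys @ p # zs" "fst p = x" "\<forall>p\<in>set ys. fst p \<noteq> x"
    by blast
  have "spread x (q(Suc n := ys)) (f(Suc n := snd p)) n = spread x q f n"
    by (rule spread_cong) auto
  moreover have "length (filter (\<lambda>p. fst p = x) rest) = Suc (length (filter (\<lambda>p. fst p = x) zs))"
    using rest by (auto simp: filter_empty_conv)
  ultimately show ?case
    using ps len rest
    by (intro exI[of _ "q(Suc n := ys)"] exI[of _ "f(Suc n := snd p)"] exI[of _ zs])
      (auto simp del: fun_upd_apply simp add: fun_upd_same)
qed

text \<open>
  The conditional in the interleaved product supplies elements of the carrier beyond index \<open>n\<close>.
\<close>

lemma (in monoid) block_prod_spread:
  assumes x: "x \<in> carrier G" and q: "fst ` set (spread x q f n) \<subseteq> carrier G"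
  shows "block_prod (spread x q f n) =
    block_prod (q 0) \<otimes> interleave x (\<lambda>i. if i \<le> n then block_prod (q i) else \<one>) f n"
proof -
  have *: "block_prod (spread x q f k) = block_prod (q 0) \<otimes> interleave x y f k"
    if "k \<le> n" and y: "range y \<subseteq> carrier G" "\<And>i. i \<le> n \<Longrightarrow> y i = block_prod (q i)"
      "fst ` set (spread x q f k) \<subseteq> carrier G" for k y
    using that(1,4)
  proof (induction k)
    case 0
    then show ?case
      using x by (auto simp: block_prod_append)
  next
    case (Suc k)
    have c: "fst ` set (spread x q f k) \<subseteq> carrier G" "fst ` set (q (Suc k)) \<subseteq> carrier G"
      "fst ` set (q 0) \<subseteq> carrier G"
    proof -
      show 1: "fst ` set (spread x q f k) \<subseteq> carrier G" "fst ` set (q (Suc k)) \<subseteq> carrier G"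
        using Suc.prems(2) by (auto simp: image_Un)
      from fst_set_part_spread[of 0 k q x f] 1(1) show "fst ` set (q 0) \<subseteq> carrier G"
        by auto
    qed
    have "block_prod (spread x q f (Suc k)) = block_prod (spread x q f k) \<otimes> (block_prod (q (Suc k)) \<otimes> x [^] f (Suc k))"
      using c x by (simp add: block_prod_append image_Un)
    also have "\<dots> = (block_prod (q 0) \<otimes> interleave x y f k) \<otimes> (block_prod (q (Suc k)) \<otimes> x [^] f (Suc k))"
      using Suc c by simp
    also have "\<dots> = block_prod (q 0) \<otimes> interleave x y f (Suc k)"
      using Suc.prems(1) c x y by (simp add: m_assoc)
    finally show ?case .
  qed
  have q_sub: "fst ` set (q i) \<subseteq> carrier G" if "i \<le> n" for i
  proof -
    from fst_set_part_spread[OF that, of q x f] q show ?thesis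
      by (rule subset_trans)
  qed
  show ?thesis
    by (rule *) (use q q_sub in auto)
qed

lemma length_eq_sum_filter:
  assumes "finite B" "fst ` set ps \<subseteq> B"
  shows "length ps = (\<Sum>x\<in>B. length (filter (\<lambda>p. fst p = x) ps))"
  using assms(2)
proof (induction ps)
  case (Cons p ps)
  have "(\<Sum>x\<in>B. length (filter (\<lambda>p. fst p = x) (p # ps))) =
    (\<Sum>x\<in>B. (if x = fst p then 1 else 0) + length (filter (\<lambda>p. fst p = x) ps))"
    by (intro sum.cong) auto
  also have "\<dots> = length (p # ps)"
    using Cons assms(1) by (simp add: sum.distrib)
  finally show ?case ..
qed simp

text \<open>
  A letter with more than \<open>n\<close> blocks can lose one of them: \<open>interleave_vanish\<close> makes an exponent zero,
  without creating blocks of other letters. Once no letter has more than \<open>n\<close> blocks, there are at most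
  \<open>card B * n\<close> of them.
\<close>

lemma (in monoid) few_blocks:
  assumes B: "finite B" "B \<subseteq> carrier G"
    and wc: "\<And>x y. x \<in> B \<Longrightarrow> range y \<subseteq> carrier G \<Longrightarrow> interleave x y (\<lambda>_. 1) n = interleave x y a n"
    and a: "i0 \<le> n" "a i0 = 0"
  shows "fst ` set ps \<subseteq> B \<Longrightarrow>
    \<exists>qs. fst ` set qs \<subseteq> B \<and> length qs \<le> card B * n \<and> block_prod qs = block_prod ps"
proof (induction ps rule: length_induct)
  case (1 ps)
  show ?case
  proof (cases "length ps \<le> card B * n")
    case False
    have "\<exists>x\<in>B. n < length (filter (\<lambda>p. fst p = x) ps)"
    proof (rule ccontr)
      assume "\<not> ?thesis"
      then have "(\<Sum>x\<in>B. length (filter (\<lambda>p. fst p = x) ps)) \<le> card B * n"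
        using sum_bounded_above[of B "\<lambda>x. length (filter (\<lambda>p. fst p = x) ps)" n] by (simp add: not_less)
      then show False
        using False length_eq_sum_filter[OF B(1) 1(2)] by simp
    qed
    then obtain x where x: "x \<in> B" "n < length (filter (\<lambda>p. fst p = x) ps)"
      by blast
    obtain q f rest where ps: "ps = spread x q f n @ rest"
      using exists_spread[OF x(2)] by blast
    have x_G: "x \<in> carrier G"
      using x B by blast
    have sub: "fst ` set (spread x q f n) \<subseteq> B" "fst ` set rest \<subseteq> B"
      using 1(2) ps by (auto simp: image_Un)
    define y where "y i = (if i \<le> n then block_prod (q i) else \<one>)" for i
    have y: "range y \<subseteq> carrier G"
    proof -
      have "fst ` set (q i) \<subseteq> carrier G" if "i \<le> n" for i
        using fst_set_part_spread[OF that, of q x f] sub(1) B(2) by (meson subset_trans)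
      then have "y i \<in> carrier G" for i
        by (simp add: y_def)
      then show ?thesis
        by blast
    qed
    obtain g i where g: "i \<le> n" "g i = 0" "interleave x y f n = interleave x y g n"
      using interleave_vanish[OF x_G y wc[OF x(1)] a, of f] by blast
    have sub_g: "fst ` set (spread x q g n) \<subseteq> B"
      using sub fst_set_spread[of x q f n g] by simp
    have "block_prod (spread x q g n) = block_prod (spread x q f n)"
      using block_prod_spread[OF x_G, of q f n] block_prod_spread[OF x_G, of q g n] subset_trans[OF sub(1) B(2)]
        subset_trans[OF sub_g B(2)] g(3)
      by (simp add: y_def[abs_def])
    then have eq: "block_prod (spread x q g n @ rest) = block_prod ps"
      using subset_trans[OF sub(1) B(2)] subset_trans[OF sub(2) B(2)] subset_trans[OF sub_g B(2)]
      by (simp add: ps block_prod_append)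
    have "(x, 0) \<in> set (spread x q g n @ rest)"
      using spread_mem[OF g(1), of x g q] g(2) by simp
    then obtain us vs where uv: "spread x q g n @ rest = us @ (x, 0) # vs"
      by (meson split_list)
    have "fst ` set (us @ (x, 0) # vs) \<subseteq> B"
      unfolding uv[symmetric] using sub_g sub(2) by (simp add: image_Un)
    then have sub_uv: "fst ` set us \<subseteq> B" "fst ` set vs \<subseteq> B"
      by (simp_all add: image_Un)
    have "length (us @ vs) < length ps"
      using uv[THEN arg_cong[where f = length]] length_spread[of x q f n g] by (simp add: ps)
    moreover have "fst ` set (us @ vs) \<subseteq> B"
      using sub_uv by (simp add: image_Un)
    ultimately obtain qs where "fst ` set qs \<subseteq> B" "length qs \<le> card B * n"
      "block_prod qs = block_prod (us @ vs)"
      using 1(1)[rule_format, of "us @ vs"] by auto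
    moreover have "block_prod (us @ vs) = block_prod ps"
      using eq subset_trans[OF sub_uv(1) B(2)] subset_trans[OF sub_uv(2) B(2)] x_G
      unfolding uv by (simp add: block_prod_append)
    ultimately show ?thesis
      by auto
  next
    case True
    then show ?thesis
      using 1(2) by (intro exI[of _ ps]) simp
  qed
qed

section \<open>Finiteness of the set of cuts\<close>

definition word_closure :: "('a, 'b) monoid_scheme \<Rightarrow> 'a set \<Rightarrow> 'a set" where
  "word_closure G B = lprod G ` lists B"

context monoid
begin

lemma submonoid_word_closure:
  assumes "B \<subseteq> carrier G" shows "submonoid (word_closure G B) G"
proof
  have sub: "set xs \<subseteq> carrier G" if "xs \<in> lists B" for xs
    using that assms by auto
  show "word_closure G B \<subseteq> carrier G"
    using lprod_closed[OF sub] by (auto simp: word_closure_def simp del: in_lists_conv_set)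
  show "\<one> \<in> word_closure G B"
    unfolding word_closure_def by (rule image_eqI[of _ _ "[]"]) auto
  fix x y assume "x \<in> word_closure G B" "y \<in> word_closure G B"
  then obtain xs ys where "xs \<in> lists B" "ys \<in> lists B" "x = lprod G xs" "y = lprod G ys"
    by (auto simp: word_closure_def)
  then show "x \<otimes> y \<in> word_closure G B"
    unfolding word_closure_def by (intro image_eqI[of _ _ "xs @ ys"]) (simp_all add: lprod_append sub)
qed

lemma subset_word_closure:
  assumes "B \<subseteq> carrier G" shows "B \<subseteq> word_closure G B"
proof
  fix x assume "x \<in> B"
  then show "x \<in> word_closure G B"
    using assms unfolding word_closure_def by (intro image_eqI[of _ _ "[x]"]) auto
qed

lemma lprod_eq_block_prod: "set xs \<subseteq> carrier G \<Longrightarrow> lprod G xs = block_prod (map (\<lambda>x. (x, 1)) xs)"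
  by (induction xs) auto

end

context residuated_preorder
begin

lemma pow_step:
  fixes p q b :: nat
  assumes pq: "\<And>x. x \<in> carrier R \<Longrightarrow> x [^] p \<unlhd> x [^] q" and x: "x \<in> carrier R" and "p \<le> b"
  shows "x [^] b \<unlhd> x [^] (b - p + q)"
proof -
  have "x [^] (b - p) \<otimes> x [^] p \<unlhd> x [^] (b - p) \<otimes> x [^] q"
    using pq x by (intro mult_mono) auto
  then show ?thesis
    using x \<open>p \<le> b\<close> by (simp add: nat_pow_mult)
qed

text \<open>
  The two directions of a knotted identity. In either case a power may be exchanged for one whose
  exponent differs by a multiple of \<open>\<bar>m - n\<bar>\<close>, but the inequality goes opposite ways.
\<close>

lemma pow_steps_up:
  fixes m n b j :: nat
  assumes mn: "\<And>x. x \<in> carrier R \<Longrightarrow> x [^] m \<unlhd> x [^] n" and "m < n" and x: "x \<in> carrier R" and "m \<le> b"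
  shows "x [^] b \<unlhd> x [^] (b + j * (n - m))"
proof (induction j)
  case (Suc j)
  have "x [^] (b + j * (n - m)) \<unlhd> x [^] (b + j * (n - m) - m + n)"
    using assms by (intro pow_step) auto
  also have "b + j * (n - m) - m + n = b + Suc j * (n - m)"
    using assms by simp
  finally show ?case
    using trans[OF Suc] x by simp
qed (use x in simp)

lemma pow_steps_down:
  fixes m n b j :: nat
  assumes mn: "\<And>x. x \<in> carrier R \<Longrightarrow> x [^] m \<unlhd> x [^] n" and "n < m" and x: "x \<in> carrier R" and "n \<le> b"
  shows "x [^] (b + j * (m - n)) \<unlhd> x [^] b"
proof (induction j)
  case (Suc j)
  have "x [^] (b + Suc j * (m - n)) \<unlhd> x [^] (b + Suc j * (m - n) - m + n)"
    using assms by (intro pow_step) auto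
  also have "b + Suc j * (m - n) - m + n = b + j * (m - n)"
    using assms by simp
  finally show ?case
    using trans[OF _ Suc] x by simp
qed (use x in simp)

lemma block_prod_zip_mono:
  assumes "list_all2 (\<lambda>a a'. \<forall>x\<in>carrier R. x [^] a \<unlhd> x [^] a') es es'" "set zs \<subseteq> carrier R"
  shows "block_prod (zip zs es) \<unlhd> block_prod (zip zs es')"
  unfolding block_prod_def
proof (rule lprod_mono)
  show "list_all2 (\<unlhd>) (map (\<lambda>(x, k). x [^] k) (zip zs es)) (map (\<lambda>(x, k). x [^] k) (zip zs es'))"
    using assms(1) nth_mem subsetD[OF assms(2)] by (auto simp: list_all2_conv_all_nth)
qed (use assms(2) in \<open>auto dest!: set_zip_leftD\<close>)

text \<open>
  If raising exponents increases powers, the vectors that violate the bound are closed under steps,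
  otherwise the ones that satisfy it are. A threshold works for both since \<open>near\<close> is symmetric.
\<close>

lemma exponent_threshold:
  fixes m n d :: nat
  assumes mn: "\<And>x. x \<in> carrier R \<Longrightarrow> x [^] m \<unlhd> x [^] n" "m \<noteq> n"
    and zs: "set zs \<subseteq> carrier R" and b: "b \<in> carrier R" and d: "d = (if m < n then n - m else m - n)"
  shows "\<exists>N. \<forall>es es'. length es = length zs \<longrightarrow> list_all2 (near N d) es es' \<longrightarrow>
    block_prod (zip zs es) \<unlhd> b \<longrightarrow> block_prod (zip zs es') \<unlhd> b"
proof -
  have "d > 0"
    using mn(2) d by auto
  have closed: "block_prod (zip zs es) \<in> carrier R" for es
    using zs by (intro block_prod_closed) (auto dest!: set_zip_leftD)
  show ?thesis
  proof (cases "m < n")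
    case True
    have step: "\<forall>x\<in>carrier R. x [^] a \<unlhd> x [^] a'" if "step_le m d a a'" for a a'
      using that pow_steps_up[OF mn(1) True] True by (auto simp: step_le_def d)
    define P where "P es \<longleftrightarrow> \<not> block_prod (zip zs es) \<unlhd> b" for es
    have "P es'" if "P es" "list_all2 (step_le m d) es es'" for es es'
    proof -
      have "list_all2 (\<lambda>a a'. \<forall>x\<in>carrier R. x [^] a \<unlhd> x [^] a') es es'"
        using that(2) by (rule list_all2_mono) (rule step)
      from trans[OF block_prod_zip_mono[OF this zs]] show ?thesis
        using that(1) closed b unfolding P_def by blast
    qed
    from step_closed_threshold[of d P, OF \<open>d > 0\<close> this]
    obtain N where N: "\<forall>es es'. length es = length zs \<longrightarrow> list_all2 (near N d) es es' \<longrightarrow> P es \<longrightarrow> P es'"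
      by (rule exE)
    have "block_prod (zip zs es') \<unlhd> b"
      if "length es = length zs" "list_all2 (near N d) es es'" "block_prod (zip zs es) \<unlhd> b" for es es'
    proof -
      have "length es' = length zs" "list_all2 (near N d) es' es"
        using that by (auto simp: list_all2_conv_all_nth near_sym)
      then show ?thesis
        using N that(3) unfolding P_def by blast
    qed
    then show ?thesis
      by (intro exI[of _ N] allI impI)
  next
    case False
    then have "n < m"
      using mn(2) by simp
    have step: "\<forall>x\<in>carrier R. x [^] a' \<unlhd> x [^] a" if "step_le n d a a'" for a a'
      using that pow_steps_down[OF mn(1) \<open>n < m\<close>] False by (auto simp: step_le_def d)
    have "block_prod (zip zs es') \<unlhd> b"
      if "block_prod (zip zs es) \<unlhd> b" "list_all2 (step_le n d) es es'" for es es'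
    proof -
      have "list_all2 (\<lambda>a a'. \<forall>x\<in>carrier R. x [^] a \<unlhd> x [^] a') es' es"
        using that(2) step by (simp add: list_all2_conv_all_nth)
      from trans[OF block_prod_zip_mono[OF this zs] that(1)] show ?thesis
        using closed b by blast
    qed
    from step_closed_threshold[of d "\<lambda>es. block_prod (zip zs es) \<unlhd> b", OF \<open>d > 0\<close> this]
    show ?thesis .
  qed
qed

text \<open>
  Write \<open>u\<close>, \<open>x\<close>, \<open>v\<close> as products of blocks. There are finitely many sequences of letters for \<open>u x v\<close>, hence
  one threshold for all of them, and truncating the exponents of \<open>u\<close> and \<open>v\<close> at this threshold does not
  change the cut.
\<close>

lemma finite_cuts:
  assumes B: "finite B" "B \<subseteq> carrier R"
    and mn: "\<And>x. x \<in> carrier R \<Longrightarrow> x [^] (m::nat) \<unlhd> x [^] (n::nat)" "m \<noteq> n"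
    and wc: "\<And>x y. x \<in> carrier R \<Longrightarrow> range y \<subseteq> carrier R \<Longrightarrow> interleave x y (\<lambda>_. 1) l = interleave x y a l"
    and a: "i0 \<le> l" "a i0 = 0"
  shows "finite (cuts R le (word_closure R B) B)"
proof -
  define W where "W = word_closure R B"
  interpret W: submonoid W R
    unfolding W_def using B(2) by (rule submonoid_word_closure)
  define K where "K = card B * l"
  define d where "d = (if m < n then n - m else m - n)"
  have d: "d > 0"
    using mn(2) by (auto simp: d_def)
  define S where "S k = {zs. set zs \<subseteq> B \<and> length zs \<le> k}" for k
  have S_fin: "finite (S k)" for k
    unfolding S_def using B(1) by (rule finite_lists_length_le)
  have S_R: "set zs \<subseteq> carrier R" if "zs \<in> S k" for zs k
    using that B(2) by (auto simp: S_def)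
  have blocks: "\<exists>zs es. zs \<in> S K \<and> length es = length zs \<and> w = block_prod (zip zs es)" if w: "w \<in> W" for w
  proof -
    obtain xs where xs: "set xs \<subseteq> B" "w = lprod R xs"
      using w unfolding W_def word_closure_def by auto
    then have "w = block_prod (map (\<lambda>x. (x, 1)) xs)"
      using B(2) by (subst lprod_eq_block_prod[symmetric]) auto
    moreover have "fst ` set (map (\<lambda>x. (x, 1)) xs) \<subseteq> B"
      using xs by auto
    ultimately obtain ps where "fst ` set ps \<subseteq> B" "length ps \<le> K" "block_prod ps = w"
      using few_blocks[OF B wc a, of "map (\<lambda>x. (x, 1)) xs"] B(2) unfolding K_def by blast
    then show ?thesis
      by (intro exI[of _ "map fst ps"] exI[of _ "map snd ps"]) (auto simp: S_def zip_map_fst_snd)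
  qed
  have "\<exists>N. \<forall>zs\<in>S (K + K + K). \<forall>b\<in>B. \<forall>es es'. length es = length zs \<longrightarrow> list_all2 (near N d) es es' \<longrightarrow>
    block_prod (zip zs es) \<unlhd> b \<longrightarrow> block_prod (zip zs es') \<unlhd> b"
  proof -
    let ?T = "S (K + K + K) \<times> B"
    have "\<forall>p\<in>?T. \<exists>N. \<forall>es es'. length es = length (fst p) \<longrightarrow> list_all2 (near N d) es es' \<longrightarrow>
      block_prod (zip (fst p) es) \<unlhd> snd p \<longrightarrow> block_prod (zip (fst p) es') \<unlhd> snd p"
      using exponent_threshold[OF mn _ _ d_def] S_R B(2) by (auto simp: subset_iff)
    from bchoice[OF this] obtain Nf where Nf: "\<forall>p\<in>?T. \<forall>es es'. length es = length (fst p) \<longrightarrow>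
      list_all2 (near (Nf p) d) es es' \<longrightarrow>
      block_prod (zip (fst p) es) \<unlhd> snd p \<longrightarrow> block_prod (zip (fst p) es') \<unlhd> snd p"
      by (rule exE)
    have "finite ?T"
      using S_fin B(1) by simp
    from bounded_nat_family[OF this, of Nf] obtain N where N: "\<forall>p\<in>?T. Nf p \<le> N"
      by (rule exE)
    show ?thesis
    proof (intro exI[of _ N] ballI allI impI)
      fix zs b es es' assume *: "zs \<in> S (K + K + K)" "b \<in> B" "length es = length zs"
        "list_all2 (near N d) es es'" "block_prod (zip zs es) \<unlhd> b"
      have "list_all2 (near (Nf (zs, b)) d) es es'"
        using *(4)
      proof (rule list_all2_mono)
        fix x y assume "near N d x y"
        then show "near (Nf (zs, b)) d x y"
          by (rule near_antimono) (use N *(1,2) in auto)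
      qed
      then show "block_prod (zip zs es') \<unlhd> b"
        using bspec[OF Nf, of "(zs, b)"] * by simp
    qed
  qed
  then obtain N where N: "\<forall>zs\<in>S (K + K + K). \<forall>b\<in>B. \<forall>es es'. length es = length zs \<longrightarrow>
    list_all2 (near N d) es es' \<longrightarrow> block_prod (zip zs es) \<unlhd> b \<longrightarrow> block_prod (zip zs es') \<unlhd> b"
    by (rule exE)
  define V where "V = (\<lambda>(zs, es). block_prod (zip zs es)) `
    (S K \<times> {es. set es \<subseteq> {..<N + d} \<and> length es \<le> K})"
  have "finite V"
    unfolding V_def using S_fin by (intro finite_imageI finite_cartesian_product finite_lists_length_le) auto
  have trunc: "list_all2 (near N d) es (map (trunc N d) es)" "list_all2 (near N d) (map (trunc N d) es) es"
    for es
    by (simp_all add: list_all2_conv_all_nth near_trunc near_sym[of N d "trunc N d _"])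
  have V_mem: "block_prod (zip zs (map (trunc N d) es)) \<in> V" if "zs \<in> S K" "length es = length zs" for zs es
    unfolding V_def using that trunc_less[OF d]
    by (intro image_eqI[where x = "(zs, map (trunc N d) es)"]) (auto simp: S_def)
  have near_refl_list: "list_all2 (near N d) es es" for es
    by (simp add: list_all2_conv_all_nth near_refl)
  have "cuts R le W B \<subseteq> (\<lambda>(u, v, b). {x \<in> W. u \<otimes> x \<otimes> v \<unlhd> b}) ` (V \<times> V \<times> B)"
  proof
    fix c assume "c \<in> cuts R le W B"
    then obtain u v b where uvb: "u \<in> W" "v \<in> W" "b \<in> B" and c: "c = {x \<in> W. u \<otimes> x \<otimes> v \<unlhd> b}"
      by (auto simp: cuts_def)
    obtain zu eu where u: "zu \<in> S K" "length eu = length zu" "u = block_prod (zip zu eu)"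
      using blocks[OF uvb(1)] by blast
    obtain zv ev where v: "zv \<in> S K" "length ev = length zv" "v = block_prod (zip zv ev)"
      using blocks[OF uvb(2)] by blast
    define eu' where "eu' = map (trunc N d) eu"
    define ev' where "ev' = map (trunc N d) ev"
    define u' where "u' = block_prod (zip zu eu')"
    define v' where "v' = block_prod (zip zv ev')"
    have len: "length eu' = length zu" "length ev' = length zv"
      using u v by (simp_all add: eu'_def ev'_def)
    have "u' \<in> V" "v' \<in> V"
      unfolding u'_def v'_def eu'_def ev'_def using u v by (simp_all only: V_mem)
    have "u \<otimes> x \<otimes> v \<unlhd> b \<longleftrightarrow> u' \<otimes> x \<otimes> v' \<unlhd> b" if xW: "x \<in> W" for x
    proof -
      obtain zx ex where x: "zx \<in> S K" "length ex = length zx" "x = block_prod (zip zx ex)"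
        using blocks[OF xW] by blast
      have zip_R: "fst ` set (zip zs es) \<subseteq> carrier R" if "zs \<in> S K" for zs and es :: "nat list"
        using S_R[OF that] by (auto dest!: set_zip_leftD)
      have join: "block_prod (zip zu e1) \<otimes> x \<otimes> block_prod (zip zv e2) = block_prod (zip (zu @ zx @ zv) (e1 @ ex @ e2))"
        if "length e1 = length zu" "length e2 = length zv" for e1 e2
        using that x zip_R[OF u(1)] zip_R[OF v(1)] zip_R[OF x(1)]
        by (simp add: block_prod_append image_Un m_assoc)
      have "zu @ zx @ zv \<in> S (K + K + K)"
        using u(1) v(1) x(1) by (auto simp: S_def)
      note N' = N[rule_format, OF this uvb(3)]
      have "block_prod (zip (zu @ zx @ zv) (eu @ ex @ ev)) \<unlhd> b \<longleftrightarrow>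
        block_prod (zip (zu @ zx @ zv) (eu' @ ex @ ev')) \<unlhd> b"
      proof -
        have "length (eu @ ex @ ev) = length (zu @ zx @ zv)" "length (eu' @ ex @ ev') = length (zu @ zx @ zv)"
          using u v x len by simp_all
        moreover have "list_all2 (near N d) (eu @ ex @ ev) (eu' @ ex @ ev')"
          "list_all2 (near N d) (eu' @ ex @ ev') (eu @ ex @ ev)"
          unfolding eu'_def ev'_def by (intro list_all2_appendI trunc near_refl_list)+
        ultimately show ?thesis
          using N' by (intro iffI)
      qed
      then show ?thesis
        unfolding u(3) v(3) u'_def v'_def using join[OF u(2) v(2)] join[OF len] by simp
    qed
    then have "c = {x \<in> W. u' \<otimes> x \<otimes> v' \<unlhd> b}"
      unfolding c by blast
    then show "c \<in> (\<lambda>(u, v, b). {x \<in> W. u \<otimes> x \<otimes> v \<unlhd> b}) ` (V \<times> V \<times> B)"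
      using \<open>u' \<in> V\<close> \<open>v' \<in> V\<close> uvb(3) by (intro image_eqI[where x = "(u', v', b)"]) simp_all
  qed
  then show ?thesis
    unfolding W_def[symmetric] by (rule finite_subset) (simp add: \<open>finite V\<close> B(1))
qed

end

section \<open>Knotted and weak commutativity identities\<close>

context residuated_lattice
begin

lemma eval_trm_prod: "range v \<subseteq> carrier R \<Longrightarrow> eval R v (trm_prod ts) = lprod R (map (eval R v) ts)"
  by (induction ts rule: trm_prod.induct) (auto simp: eval_closed)

lemma lprod_replicate: "x \<in> carrier R \<Longrightarrow> lprod R (replicate k x) = x [^] k"
  by (induction k) (simp_all add: nat_pow_comm[of x 1, simplified])

lemma eval_trm_pow: "range v \<subseteq> carrier R \<Longrightarrow> eval R v (trm_pow t k) = eval R v t [^] k"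
  by (simp add: trm_pow_def eval_trm_prod lprod_replicate eval_closed)

lemma eval_interleaved:
  assumes v: "range v \<subseteq> carrier R"
  shows "eval R v (interleaved n a) = interleave (v 0) v a n"
proof -
  have [simp]: "v i \<in> carrier R" for i
    using v by auto
  let ?l = "\<lambda>n. concat (map (\<lambda>i. [v i, v 0 [^] a i]) [1..<Suc n])"
  have l: "set (?l n) \<subseteq> carrier R" for n
    by auto
  have eq: "v 0 [^] a 0 \<otimes> lprod R (?l n) = interleave (v 0) v a n"
  proof (induction n)
    case (Suc n)
    have "?l (Suc n) = ?l n @ [v (Suc n), v 0 [^] a (Suc n)]"
      by simp
    then have "v 0 [^] a 0 \<otimes> lprod R (?l (Suc n)) =
        v 0 [^] a 0 \<otimes> (lprod R (?l n) \<otimes> lprod R [v (Suc n), v 0 [^] a (Suc n)])"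
      using l[of n] by (simp only: lprod_append) (simp add: lprod_append)
    also have "\<dots> = (v 0 [^] a 0 \<otimes> lprod R (?l n)) \<otimes> (v (Suc n) \<otimes> v 0 [^] a (Suc n))"
      using lprod_closed[OF l[of n]] by (simp add: m_assoc del: upt_Suc)
    also have "\<dots> = interleave (v 0) v a (Suc n)"
      using v by (simp only: Suc.IH) (simp add: m_assoc)
    finally show ?case .
  qed simp
  have "map (eval R v) (concat (map (\<lambda>i. [Var i, trm_pow (Var 0) (a i)]) [1..<Suc n])) = ?l n"
    by (simp add: map_concat comp_def eval_trm_pow v del: upt_Suc)
  then have "eval R v (interleaved n a) = v 0 [^] a 0 \<otimes> lprod R (?l n)"
    unfolding interleaved_def eval_trm_prod[OF v] by (simp add: eval_trm_pow v del: upt_Suc)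
  with eq show ?thesis
    by simp
qed

end

lemma trm_prod_join_mult_one: "set ts \<subseteq> join_mult_one_terms \<Longrightarrow> trm_prod ts \<in> join_mult_one_terms"
  by (induction ts rule: trm_prod.induct) (auto intro: join_mult_one_terms.intros)

lemma trm_pow_join_mult_one: "t \<in> join_mult_one_terms \<Longrightarrow> trm_pow t k \<in> join_mult_one_terms"
  unfolding trm_pow_def by (intro trm_prod_join_mult_one) auto

lemma knotted_identities_join_mult_one: "knotted_identities \<subseteq> join_mult_one_terms \<times> join_mult_one_terms"
  by (auto simp: knotted_identities_def trm_le_def intro!: join_mult_one_terms.intros trm_pow_join_mult_one)

lemma weak_commutativity_identities_join_mult_one:
  "weak_commutativity_identities \<subseteq> join_mult_one_terms \<times> join_mult_one_terms"
proof -
  have "interleaved n a \<in> join_mult_one_terms" for n a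
    unfolding interleaved_def
    by (intro trm_prod_join_mult_one) (auto intro!: join_mult_one_terms.intros trm_pow_join_mult_one)
  then show ?thesis
    by (auto simp: weak_commutativity_identities_def)
qed

lemma models_knotted:
  fixes A :: "'a rl" (structure)
  assumes "k \<in> knotted_identities" "residuated_lattice A" "A \<in> models {k}"
  obtains m n :: nat where "m \<noteq> n" "\<And>x. x \<in> carrier A \<Longrightarrow> x [^] m \<preceq> x [^] n"
proof -
  interpret residuated_lattice A
    by (rule assms(2))
  obtain m n where k: "k = trm_le (trm_pow (Var 0) m) (trm_pow (Var 0) n)" "m \<noteq> n"
    using assms(1) by (auto simp: knotted_identities_def)
  have "x [^] m \<preceq> x [^] n" if x: "x \<in> carrier A" for x
  proof -
    have r: "range (\<lambda>_::nat. x) \<subseteq> carrier A"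
      using x by auto
    then have "eval A (\<lambda>_. x) (fst k) = eval A (\<lambda>_. x) (snd k)"
      using assms(3) by (auto simp: models_def)
    then show ?thesis
      using x by (simp add: k(1) trm_le_def eval_trm_pow[OF r] le_iff_vee)
  qed
  with k(2) that show thesis
    by blast
qed

text \<open>
  As the exponents sum to \<open>n + 1\<close> and are not all equal to one, some exponent is zero. At its position
  the identity removes occurrences of \<open>x\<close>, which is what the normal form exploits.
\<close>

lemma models_weak_commutativity:
  fixes A :: "'a rl"
  assumes "w \<in> weak_commutativity_identities" "residuated_lattice A" "A \<in> models {w}"
  obtains n a i0 where "i0 \<le> n" "a i0 = 0"
    "\<And>x y. \<lbrakk>x \<in> carrier A; range y \<subseteq> carrier A\<rbrakk> \<Longrightarrow>
      monoid.interleave A x y (\<lambda>_. 1) n = monoid.interleave A x y a n"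
proof -
  interpret residuated_lattice A
    by (rule assms(2))
  obtain n a where w: "w = (interleaved n (\<lambda>_. 1), interleaved n a)" "(\<Sum>i\<le>n. a i) = n + 1" "\<exists>i\<le>n. a i \<noteq> 1"
    using assms(1) by (auto simp: weak_commutativity_identities_def)
  have "\<exists>i\<le>n. a i = 0"
  proof (rule ccontr)
    assume "\<not> ?thesis"
    then have pos: "1 \<le> a i" if "i \<le> n" for i
      using that by (simp add: Suc_le_eq)
    obtain j where "j \<le> n" "a j \<noteq> 1"
      using w(3) by blast
    then have "1 < a j"
      using pos[of j] by simp
    have "(\<Sum>i\<le>n. 1) < (\<Sum>i\<le>n. a i)"
    proof (rule sum_strict_mono_ex1)
      show "\<exists>i\<in>{..n}. 1 < a i"
        using \<open>j \<le> n\<close> \<open>1 < a j\<close> by auto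
    qed (use pos in auto)
    then show False
      using w(2) by simp
  qed
  then obtain i0 where "i0 \<le> n" "a i0 = 0"
    by blast
  moreover have "interleave x y (\<lambda>_. 1) n = interleave x y a n"
    if x: "x \<in> carrier A" and y: "range y \<subseteq> carrier A" for x y
  proof -
    define v where "v = y(0 := x)"
    have v: "range v \<subseteq> carrier A"
      using x y by (auto simp: v_def)
    have eq: "eval A v (fst w) = eval A v (snd w)"
      using assms(3) v by (auto simp: models_def)
    have v_y: "interleave (v 0) v b n = interleave x y b n" for b
      by (induction n) (simp_all add: v_def)
    show ?thesis
      using eq unfolding w(1) fst_conv snd_conv eval_interleaved[OF v] v_y .
  qed
  ultimately show thesis
    using that by blast
qed

section \<open>Finite products and isomorphic copies\<close>

definition rl_product :: "'i set \<Rightarrow> ('i \<Rightarrow> 'a rl) \<Rightarrow> ('i \<Rightarrow> 'a) rl" where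
  "rl_product I C = \<lparr>
    carrier = (\<Pi>\<^sub>E i\<in>I. carrier (C i)),
    monoid.mult = (\<lambda>x y. \<lambda>i\<in>I. x i \<otimes>\<^bsub>C i\<^esub> y i),
    one = (\<lambda>i\<in>I. \<one>\<^bsub>C i\<^esub>),
    wedge = (\<lambda>x y. \<lambda>i\<in>I. x i \<^bold>\<and>\<^bsub>C i\<^esub> y i),
    vee = (\<lambda>x y. \<lambda>i\<in>I. x i \<^bold>\<or>\<^bsub>C i\<^esub> y i),
    under = (\<lambda>x y. \<lambda>i\<in>I. under (C i) (x i) (y i)),
    over = (\<lambda>x y. \<lambda>i\<in>I. over (C i) (x i) (y i))\<rparr>"

lemma rl_product_simps [simp]:
  "carrier (rl_product I C) = (\<Pi>\<^sub>E i\<in>I. carrier (C i))"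
  "x \<otimes>\<^bsub>rl_product I C\<^esub> y = (\<lambda>i\<in>I. x i \<otimes>\<^bsub>C i\<^esub> y i)"
  "\<one>\<^bsub>rl_product I C\<^esub> = (\<lambda>i\<in>I. \<one>\<^bsub>C i\<^esub>)"
  "x \<^bold>\<and>\<^bsub>rl_product I C\<^esub> y = (\<lambda>i\<in>I. x i \<^bold>\<and>\<^bsub>C i\<^esub> y i)"
  "x \<^bold>\<or>\<^bsub>rl_product I C\<^esub> y = (\<lambda>i\<in>I. x i \<^bold>\<or>\<^bsub>C i\<^esub> y i)"
  "under (rl_product I C) x y = (\<lambda>i\<in>I. under (C i) (x i) (y i))"
  "over (rl_product I C) x y = (\<lambda>i\<in>I. over (C i) (x i) (y i))"
  by (simp_all add: rl_product_def)

lemma rl_product_le: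
  assumes "x \<in> carrier (rl_product I C)"
  shows "x \<preceq>\<^bsub>rl_product I C\<^esub> y \<longleftrightarrow> (\<forall>i\<in>I. x i \<preceq>\<^bsub>C i\<^esub> y i)"
proof
  assume "x \<preceq>\<^bsub>rl_product I C\<^esub> y"
  then have *: "(\<lambda>i\<in>I. x i \<^bold>\<and>\<^bsub>C i\<^esub> y i) = x"
    by (simp add: rl_le_def)
  have "x i \<^bold>\<and>\<^bsub>C i\<^esub> y i = x i" if "i \<in> I" for i
    using fun_cong[OF *, of i] that by simp
  then show "\<forall>i\<in>I. x i \<preceq>\<^bsub>C i\<^esub> y i"
    by (simp add: rl_le_def)
next
  assume *: "\<forall>i\<in>I. x i \<preceq>\<^bsub>C i\<^esub> y i"
  have "(\<lambda>i\<in>I. x i \<^bold>\<and>\<^bsub>C i\<^esub> y i) = x"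
    using assms by (intro PiE_ext[of _ I "\<lambda>i. UNIV" _]) (use * in \<open>auto simp: rl_le_def PiE_iff\<close>)
  then show "x \<preceq>\<^bsub>rl_product I C\<^esub> y"
    by (simp add: rl_le_def)
qed

lemma residuated_lattice_product:
  assumes "\<And>i. i \<in> I \<Longrightarrow> residuated_lattice (C i)"
  shows "residuated_lattice (rl_product I C)"
proof -
  have mon: "monoid (C i)" if "i \<in> I" for i
    using assms[OF that] by (simp add: residuated_lattice_def)
  note rl = residuated_lattice.wedge_closed residuated_lattice.vee_closed
    residuated_lattice.under_closed residuated_lattice.over_closed
  have mem: "x i \<in> carrier (C i)" if "x \<in> carrier (rl_product I C)" "i \<in> I" for x i
    using that by auto
  have closed: "(\<lambda>i\<in>I. f i) \<in> carrier (rl_product I C) \<longleftrightarrow> (\<forall>i\<in>I. f i \<in> carrier (C i))" for f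
    by auto
  have ext: "(\<lambda>i\<in>I. f i) = (\<lambda>i\<in>I. g i)" if "\<And>i. i \<in> I \<Longrightarrow> f i = g i" for f g :: "'a \<Rightarrow> 'b"
    using that by (rule restrict_ext)
  have ext': "(\<lambda>i\<in>I. f i) = x" if "\<And>i. i \<in> I \<Longrightarrow> f i = x i" "x \<in> carrier (rl_product I C)" for f x
    using that by (intro extensionalityI[of _ I]) (auto simp: PiE_def)
  show ?thesis
  proof
    fix x y assume xy: "x \<in> carrier (rl_product I C)" "y \<in> carrier (rl_product I C)"
    note m = mem[OF xy(1)] mem[OF xy(2)]
    show "x \<otimes>\<^bsub>rl_product I C\<^esub> y \<in> carrier (rl_product I C)"
      "x \<^bold>\<and>\<^bsub>rl_product I C\<^esub> y \<in> carrier (rl_product I C)"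
      "x \<^bold>\<or>\<^bsub>rl_product I C\<^esub> y \<in> carrier (rl_product I C)"
      "under (rl_product I C) x y \<in> carrier (rl_product I C)"
      "over (rl_product I C) x y \<in> carrier (rl_product I C)"
      unfolding rl_product_simps(2-7) closed
      using m assms mon by (simp_all add: monoid.m_closed rl)
    show "x \<^bold>\<and>\<^bsub>rl_product I C\<^esub> y = y \<^bold>\<and>\<^bsub>rl_product I C\<^esub> x"
      unfolding rl_product_simps(2-7)
      by (rule ext) (rule residuated_lattice.wedge_comm[OF assms m])
    show "x \<^bold>\<or>\<^bsub>rl_product I C\<^esub> y = y \<^bold>\<or>\<^bsub>rl_product I C\<^esub> x"
      unfolding rl_product_simps(2-7)
      by (rule ext) (rule residuated_lattice.vee_comm[OF assms m])
    show "x \<^bold>\<and>\<^bsub>rl_product I C\<^esub> (x \<^bold>\<or>\<^bsub>rl_product I C\<^esub> y) = x"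
      unfolding rl_product_simps(2-7)
      by (rule ext'[OF _ xy(1)]) (simp add: residuated_lattice.wedge_absorb assms m)
    show "x \<^bold>\<or>\<^bsub>rl_product I C\<^esub> (x \<^bold>\<and>\<^bsub>rl_product I C\<^esub> y) = x"
      unfolding rl_product_simps(2-7)
      by (rule ext'[OF _ xy(1)]) (simp add: residuated_lattice.vee_absorb assms m)
  next
    fix x y z assume xyz: "x \<in> carrier (rl_product I C)" "y \<in> carrier (rl_product I C)" "z \<in> carrier (rl_product I C)"
    note m = mem[OF xyz(1)] mem[OF xyz(2)] mem[OF xyz(3)]
    show "x \<otimes>\<^bsub>rl_product I C\<^esub> y \<otimes>\<^bsub>rl_product I C\<^esub> z = x \<otimes>\<^bsub>rl_product I C\<^esub> (y \<otimes>\<^bsub>rl_product I C\<^esub> z)"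
      unfolding rl_product_simps(2-7) by (rule ext) (simp add: monoid.m_assoc mon m)
    show "(x \<^bold>\<and>\<^bsub>rl_product I C\<^esub> y) \<^bold>\<and>\<^bsub>rl_product I C\<^esub> z = x \<^bold>\<and>\<^bsub>rl_product I C\<^esub> (y \<^bold>\<and>\<^bsub>rl_product I C\<^esub> z)"
      unfolding rl_product_simps(2-7) by (rule ext) (simp add: residuated_lattice.wedge_assoc assms m)
    show "(x \<^bold>\<or>\<^bsub>rl_product I C\<^esub> y) \<^bold>\<or>\<^bsub>rl_product I C\<^esub> z = x \<^bold>\<or>\<^bsub>rl_product I C\<^esub> (y \<^bold>\<or>\<^bsub>rl_product I C\<^esub> z)"
      unfolding rl_product_simps(2-7) by (rule ext) (simp add: residuated_lattice.vee_assoc assms m)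
    have xy: "x \<otimes>\<^bsub>rl_product I C\<^esub> y \<in> carrier (rl_product I C)"
      unfolding rl_product_simps(2-7) closed using m mon by (simp add: monoid.m_closed)
    show "x \<otimes>\<^bsub>rl_product I C\<^esub> y \<preceq>\<^bsub>rl_product I C\<^esub> z \<longleftrightarrow> y \<preceq>\<^bsub>rl_product I C\<^esub> under (rl_product I C) x z"
      unfolding rl_product_le[OF xy] rl_product_le[OF xyz(2)] unfolding rl_product_simps(2-7)
      using residuated_lattice.residual_under[OF assms m] by simp
    show "x \<otimes>\<^bsub>rl_product I C\<^esub> y \<preceq>\<^bsub>rl_product I C\<^esub> z \<longleftrightarrow> x \<preceq>\<^bsub>rl_product I C\<^esub> over (rl_product I C) z y"
      unfolding rl_product_le[OF xy] rl_product_le[OF xyz(1)] unfolding rl_product_simps(2-7)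
      using residuated_lattice.residual_over[OF assms m] by simp
  next
    show "\<one>\<^bsub>rl_product I C\<^esub> \<in> carrier (rl_product I C)"
      unfolding rl_product_simps(2-7) closed using mon by (simp add: monoid.one_closed)
    fix x assume x: "x \<in> carrier (rl_product I C)"
    show "\<one>\<^bsub>rl_product I C\<^esub> \<otimes>\<^bsub>rl_product I C\<^esub> x = x"
      unfolding rl_product_simps(2-7) by (rule ext'[OF _ x]) (simp add: monoid.l_one mon mem[OF x])
    show "x \<otimes>\<^bsub>rl_product I C\<^esub> \<one>\<^bsub>rl_product I C\<^esub> = x"
      unfolding rl_product_simps(2-7) by (rule ext'[OF _ x]) (simp add: monoid.r_one mon mem[OF x])
  qed
qed

lemma eval_product:
  assumes "range v \<subseteq> carrier (rl_product I C)"
  shows "eval (rl_product I C) v t = (\<lambda>i\<in>I. eval (C i) (\<lambda>n. v n i) t)"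
proof (induction t)
  case (Var n)
  have "v n \<in> (\<Pi>\<^sub>E i\<in>I. carrier (C i))"
    using assms by auto
  then show ?case
    by (simp add: PiE_restrict)
qed (simp_all cong: restrict_cong)

lemma models_product:
  assumes "\<And>i. i \<in> I \<Longrightarrow> C i \<in> models E" shows "rl_product I C \<in> models E"
proof -
  have "eval (rl_product I C) v s = eval (rl_product I C) v t"
    if st: "(s, t) \<in> E" and v: "range v \<subseteq> carrier (rl_product I C)" for s t v
  proof -
    have "eval (C i) (\<lambda>n. v n i) s = eval (C i) (\<lambda>n. v n i) t" if "i \<in> I" for i
    proof -
      have "range (\<lambda>n. v n i) \<subseteq> carrier (C i)"
        using v that by (auto simp: image_subset_iff)
      then show ?thesis
        using assms[OF that] st by (auto simp: models_def)
    qed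
    then show ?thesis
      unfolding eval_product[OF v] by (rule restrict_ext)
  qed
  then show ?thesis
    by (auto simp: models_def)
qed

lemma SRL_product:
  assumes "\<And>i. i \<in> I \<Longrightarrow> C i \<in> SRL" shows "rl_product I C \<in> SRL"
  using assms residuated_lattice_product[of I C] models_product[of I C] by (simp add: SRL_def)

lemma partial_hom_product:
  assumes "\<And>i. i \<in> I \<Longrightarrow> partial_hom A B (C i) (f i)"
  shows "partial_hom A B (rl_product I C) (\<lambda>x. \<lambda>i\<in>I. f i x)"
proof -
  have f: "f i x \<in> carrier (C i)" if "x \<in> B" "i \<in> I" for i x
    using assms[OF that(2)] that(1) by (auto simp: partial_hom_def)
  then show ?thesis
    using assms unfolding partial_hom_def rl_product_simps
    by (simp add: image_subset_iff restrict_PiE_iff cong: restrict_cong)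
qed

definition rl_copy :: "('a \<Rightarrow> 'b) \<Rightarrow> 'a rl \<Rightarrow> 'b rl" where
  "rl_copy g R = (let h = inv_into (carrier R) g in \<lparr>
    carrier = g ` carrier R,
    monoid.mult = (\<lambda>x y. g (h x \<otimes>\<^bsub>R\<^esub> h y)),
    one = g \<one>\<^bsub>R\<^esub>,
    wedge = (\<lambda>x y. g (h x \<^bold>\<and>\<^bsub>R\<^esub> h y)),
    vee = (\<lambda>x y. g (h x \<^bold>\<or>\<^bsub>R\<^esub> h y)),
    under = (\<lambda>x y. g (under R (h x) (h y))),
    over = (\<lambda>x y. g (over R (h x) (h y)))\<rparr>)"

locale injective_copy = residuated_lattice R for R :: "'a rl" (structure) +
  fixes g :: "'a \<Rightarrow> 'b"
  assumes inj: "inj_on g (carrier R)"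
begin

lemma inv_g [simp]: "x \<in> carrier R \<Longrightarrow> inv_into (carrier R) g (g x) = x"
  using inj by simp

lemma g_eq_iff [simp]: "\<lbrakk>x \<in> carrier R; y \<in> carrier R\<rbrakk> \<Longrightarrow> g x = g y \<longleftrightarrow> x = y"
  using inj by (auto dest: inj_onD)

lemma copy_simps [simp]:
  "carrier (rl_copy g R) = g ` carrier R"
  "\<one>\<^bsub>rl_copy g R\<^esub> = g \<one>"
  "\<lbrakk>x \<in> carrier R; y \<in> carrier R\<rbrakk> \<Longrightarrow> g x \<otimes>\<^bsub>rl_copy g R\<^esub> g y = g (x \<otimes> y)"
  "\<lbrakk>x \<in> carrier R; y \<in> carrier R\<rbrakk> \<Longrightarrow> g x \<^bold>\<and>\<^bsub>rl_copy g R\<^esub> g y = g (x \<^bold>\<and> y)"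
  "\<lbrakk>x \<in> carrier R; y \<in> carrier R\<rbrakk> \<Longrightarrow> g x \<^bold>\<or>\<^bsub>rl_copy g R\<^esub> g y = g (x \<^bold>\<or> y)"
  "\<lbrakk>x \<in> carrier R; y \<in> carrier R\<rbrakk> \<Longrightarrow> under (rl_copy g R) (g x) (g y) = g (under R x y)"
  "\<lbrakk>x \<in> carrier R; y \<in> carrier R\<rbrakk> \<Longrightarrow> over (rl_copy g R) (g x) (g y) = g (over R x y)"
  by (simp_all add: rl_copy_def Let_def)

lemma copy_le [simp]: "\<lbrakk>x \<in> carrier R; y \<in> carrier R\<rbrakk> \<Longrightarrow> g x \<preceq>\<^bsub>rl_copy g R\<^esub> g y \<longleftrightarrow> x \<preceq> y"
  by (simp add: rl_le_def closed)

lemma residuated_lattice_copy: "residuated_lattice (rl_copy g R)"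
  by unfold_locales
    (auto simp: closed m_assoc wedge_assoc vee_assoc wedge_absorb vee_absorb
      residual_under residual_over[symmetric] intro: wedge_comm vee_comm)

lemma eval_copy:
  assumes "range v \<subseteq> carrier R" shows "eval (rl_copy g R) (g \<circ> v) t = g (eval R v t)"
  by (induction t) (simp_all add: eval_closed assms)

lemma models_copy:
  assumes "R \<in> models E" shows "rl_copy g R \<in> models E"
proof -
  have "eval (rl_copy g R) u s = eval (rl_copy g R) u t"
    if st: "(s, t) \<in> E" and u: "range u \<subseteq> carrier (rl_copy g R)" for s t u
  proof -
    define v where "v = inv_into (carrier R) g \<circ> u"
    have "u i \<in> g ` carrier R" for i
      using u by auto
    then have v: "range v \<subseteq> carrier R" and uv: "u = g \<circ> v"
      by (auto simp: v_def inv_into_into f_inv_into_f fun_eq_iff)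
    have "eval R v s = eval R v t"
      using assms st v by (auto simp: models_def)
    then show ?thesis
      by (simp add: uv eval_copy v)
  qed
  then show ?thesis
    by (auto simp: models_def)
qed

lemma SRL_copy: "R \<in> SRL \<Longrightarrow> rl_copy g R \<in> SRL"
  using residuated_lattice_copy models_copy by (simp add: SRL_def)

lemma partial_hom_copy:
  assumes "partial_hom A B R f" shows "partial_hom A B (rl_copy g R) (g \<circ> f)"
proof -
  have "f x \<in> carrier R" if "x \<in> B" for x
    using assms that by (auto simp: partial_hom_def)
  then show ?thesis
    using assms by (simp add: partial_hom_def image_subset_iff)
qed

end

section \<open>The finite embeddability property\<close>

text \<open>
  The principal set of \<open>a\<close> contains \<open>a\<close>, whereas that of \<open>b\<close> does not, since the filter omits the residual
  \<open>a\<close> under \<open>b\<close>.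
\<close>

lemma finite_separating_algebra:
  fixes A :: "'a rl"
  assumes A: "A \<in> SRL \<inter> models E"
    and k: "k \<in> knotted_identities" "k \<in> E"
    and w: "w \<in> weak_commutativity_identities" "w \<in> E"
    and E: "E \<subseteq> join_mult_one_terms \<times> join_mult_one_terms"
    and B: "finite B" "B \<subseteq> carrier A"
    and ab: "a \<in> B" "b \<in> B" "\<not> a \<preceq>\<^bsub>A\<^esub> b"
  shows "\<exists>C :: 'a set rl. \<exists>f. C \<in> SRL \<inter> models E \<and> finite (carrier C) \<and> partial_hom A B C f \<and> f a \<noteq> f b"
proof -
  interpret A: residuated_lattice A
    using A by (simp add: SRL_def)
  have ab_A: "a \<in> carrier A" "b \<in> carrier A"
    using ab B by auto
  have "\<not> \<one>\<^bsub>A\<^esub> \<preceq>\<^bsub>A\<^esub> under A a b"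
    using ab(3) ab_A A.residual_under[of a "\<one>\<^bsub>A\<^esub>" b] by simp
  from SRL_prime_filter[OF _ A.under_closed[OF ab_A] this] A
  obtain F where F: "under A a b \<notin> F" "unilinear_preorder A (\<lambda>x y. under A x y \<in> F)"
    by auto
  let ?le = "\<lambda>x y. under A x y \<in> F"
  interpret unilinear_preorder A ?le
    by (rule F(2))
  let ?W = "word_closure A B"
  interpret cut_frame A ?le ?W B
    by (intro cut_frame.intro cut_frame_axioms.intro residuated_preorder_axioms
        A.submonoid_word_closure A.subset_word_closure B)
  have models: "A \<in> models {e}" if "e \<in> E" for e
    using A that by (auto simp: models_def)
  obtain m n :: nat where mn: "m \<noteq> n" "\<And>x. x \<in> carrier A \<Longrightarrow> x [^]\<^bsub>A\<^esub> m \<preceq>\<^bsub>A\<^esub> x [^]\<^bsub>A\<^esub> n"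
    by (rule models_knotted[OF k(1) A.residuated_lattice_axioms models[OF k(2)]]) (rule that; assumption)
  obtain l e i0 where le: "i0 \<le> l" "e i0 = 0" "\<And>x y. x \<in> carrier A \<Longrightarrow> range y \<subseteq> carrier A \<Longrightarrow>
      A.interleave x y (\<lambda>_. 1) l = A.interleave x y e l"
    by (rule models_weak_commutativity[OF w(1) A.residuated_lattice_axioms models[OF w(2)]]) (rule that; assumption)
  have "finite (cuts A ?le ?W B)"
  proof (rule finite_cuts[OF B _ mn(1) le(3) le(1,2)])
    show "?le (x [^]\<^bsub>A\<^esub> m) (x [^]\<^bsub>A\<^esub> n)" if "x \<in> carrier A" for x
      using mn(2)[OF that] that by (intro le_of_order) auto
  qed
  then have fin: "finite (carrier \<C>)"
    by (rule finite_galois_algebra)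
  have "\<C> \<in> SRL"
    using residuated_lattice_galois_algebra unilinear_galois_algebra[OF F(2)] by (rule unilinear_in_SRL)
  moreover have "\<C> \<in> models E"
  proof -
    have "eval \<C> X s = eval \<C> X t" if st: "(s, t) \<in> E" and X: "range X \<subseteq> carrier \<C>" for s t X
    proof (rule subset_antisym)
      have t: "s \<in> join_mult_one_terms" "t \<in> join_mult_one_terms"
        using st E by auto
      have eq: "eval A v s = eval A v t" if "range v \<subseteq> carrier A" for v
        using A st that by (auto simp: models_def)
      show "eval \<C> X s \<subseteq> eval \<C> X t"
        by (rule galois_algebra_satisfies[OF t eq X])
      show "eval \<C> X t \<subseteq> eval \<C> X s"
        by (rule galois_algebra_satisfies[OF t(2,1) eq[symmetric] X])
    qed
    then show ?thesis
      by (auto simp: models_def simp del: galois_algebra_simps)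
  qed
  moreover have "{x \<in> ?W. ?le x a} \<noteq> {x \<in> ?W. ?le x b}"
  proof
    assume "{x \<in> ?W. ?le x a} = {x \<in> ?W. ?le x b}"
    moreover have "a \<in> {x \<in> ?W. ?le x a}"
      using B_W[OF ab(1)] refl[OF ab_A(1)] by simp
    ultimately show False
      using F(1) by simp
  qed
  ultimately show ?thesis
    using fin partial_hom_principal
    by (intro exI[of _ "\<C>"] exI[of _ "\<lambda>b. {x \<in> ?W. ?le x b}"] conjI IntI)
qed

theorem theorem5p3:
  fixes k w :: equation and E :: "equation set"
  assumes "k \<in> knotted_identities"
    and "w \<in> weak_commutativity_identities"
    and "E \<subseteq> join_mult_one_terms \<times> join_mult_one_terms"
  shows "finite_embeddability_property
           (SRL \<inter> models ({k, w} \<union> E) :: 'a rl set)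
           (SRL \<inter> models ({k, w} \<union> E) :: nat rl set)"
  unfolding finite_embeddability_property_def
proof (intro ballI allI impI, elim conjE)
  fix A :: "'a rl" and B
  let ?E = "{k, w} \<union> E"
  assume A: "A \<in> SRL \<inter> models ?E" and B: "B \<subseteq> carrier A" "finite B"
  interpret A: residuated_lattice A
    using A by (simp add: SRL_def)
  have E: "?E \<subseteq> join_mult_one_terms \<times> join_mult_one_terms"
    using assms knotted_identities_join_mult_one weak_commutativity_identities_join_mult_one by blast
  \<comment> \<open>one factor for each pair that has to be separated\<close>
  define I where "I = {(a, b) \<in> B \<times> B. \<not> a \<preceq>\<^bsub>A\<^esub> b}"
  have "finite I"
    unfolding I_def using B(2) by (intro finite_subset[OF _ finite_cartesian_product[OF B(2) B(2)]]) auto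
  have "\<forall>i\<in>I. \<exists>Cf :: 'a set rl \<times> ('a \<Rightarrow> 'a set). fst Cf \<in> SRL \<inter> models ?E \<and> finite (carrier (fst Cf)) \<and>
      partial_hom A B (fst Cf) (snd Cf) \<and> snd Cf (fst i) \<noteq> snd Cf (snd i)"
  proof
    fix i assume "i \<in> I"
    then have "fst i \<in> B" "snd i \<in> B" "\<not> fst i \<preceq>\<^bsub>A\<^esub> snd i"
      by (auto simp: I_def)
    from finite_separating_algebra[OF A assms(1) _ assms(2) _ E B(2,1) this]
    show "\<exists>Cf :: 'a set rl \<times> ('a \<Rightarrow> 'a set). fst Cf \<in> SRL \<inter> models ?E \<and> finite (carrier (fst Cf)) \<and>
      partial_hom A B (fst Cf) (snd Cf) \<and> snd Cf (fst i) \<noteq> snd Cf (snd i)"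
      by auto
  qed
  from bchoice[OF this] obtain Cf :: "'a \<times> 'a \<Rightarrow> 'a set rl \<times> ('a \<Rightarrow> 'a set)"
    where Cf: "\<forall>i\<in>I. fst (Cf i) \<in> SRL \<inter> models ?E \<and> finite (carrier (fst (Cf i))) \<and>
      partial_hom A B (fst (Cf i)) (snd (Cf i)) \<and> snd (Cf i) (fst i) \<noteq> snd (Cf i) (snd i)"
    by (rule exE)
  define P where "P = rl_product I (\<lambda>i. fst (Cf i))"
  define f where "f x = (\<lambda>i\<in>I. snd (Cf i) x)" for x
  have P_SRL: "P \<in> SRL"
    unfolding P_def using Cf by (intro SRL_product) blast
  have P_models: "P \<in> models ?E"
    unfolding P_def using Cf by (intro models_product) blast
  have P_fin: "finite (carrier P)"
    unfolding P_def using Cf \<open>finite I\<close> by (simp add: finite_PiE)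
  have f: "partial_hom A B P f"
    unfolding P_def f_def[abs_def] using Cf by (intro partial_hom_product) blast
  have f_inj: "inj_on f B"
  proof (rule inj_onI)
    fix x y assume xy: "x \<in> B" "y \<in> B" "f x = f y"
    have "(a, b) \<notin> I" if "f a = f b" for a b
    proof
      assume "(a, b) \<in> I"
      then show False
        using Cf fun_cong[OF that, of "(a, b)"] by (auto simp: f_def)
    qed
    then have "x \<preceq>\<^bsub>A\<^esub> y" "y \<preceq>\<^bsub>A\<^esub> x"
      using xy xy(3)[symmetric] unfolding I_def by blast+
    then show "x = y"
      using xy B by (intro A.le_antisym) auto
  qed
  obtain g :: "('a \<times> 'a \<Rightarrow> 'a set) \<Rightarrow> nat" where g: "inj_on g (carrier P)"
    using finite_imp_inj_to_nat_seg[OF P_fin] by blast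
  interpret P: injective_copy P g
    using P_SRL g by (intro injective_copy.intro injective_copy_axioms.intro) (simp_all add: SRL_def)
  have "partial_embedding A B (rl_copy g P) (g \<circ> f)"
  proof -
    have "f ` B \<subseteq> carrier P"
      using f by (simp add: partial_hom_def)
    then have "inj_on (g \<circ> f) B"
      using f_inj g by (intro comp_inj_on) (auto intro: inj_on_subset)
    then show ?thesis
      using P.partial_hom_copy[OF f] unfolding partial_hom_def partial_embedding_def by blast
  qed
  moreover have "rl_copy g P \<in> SRL \<inter> models ?E"
    using P.SRL_copy[OF P_SRL] P.models_copy[OF P_models] by blast
  moreover have "finite (carrier (rl_copy g P))"
    using P_fin by simp
  ultimately show "\<exists>C\<in>SRL \<inter> models ?E. finite (carrier C) \<and> (\<exists>f. partial_embedding A B (C :: nat rl) f)"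
    by blast
qed

end
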